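(* Let $\mathcal G$ be a graph of group actions, $T$ its associated tree and $G$ its universal group. Let $\mathcal G'$ and $\mathcal G''$ be the reduced and the arc-reduced graph of group actions of $\mathcal G$, respectively. Then the augmented base digraphs for $\mathcal G'$ and $\mathcal G''$ are equal to the augmented base digraph for $\mathcal G$, and thus the associated trees for all three graphs of group actions are equal. Furthermore, the induced actions of the universal groups of all three graphs of group actions on $T$ are isomorphic.
   Context: **Graphs.** A graph $\Gamma$ has a vertex set $V\Gamma$, an arc set $A\Gamma$, maps $o,t\colon A\Gamma\to V\Gamma$ (origin, terminus) and an involution $a\mapsto\bar a$ on arcs with $o(a)=t(\bar a)$; an arc with $\bar a=a$ is called self-reverse (loops with $\bar a\ne a$ are also allowed). Graph morphisms preserve $o$, $t$ and reversal; a digraph is the same without the reversal map. A tree is a connected graph without loops and without two arcs having the same origin and the same terminus, which has no simple cycles of length $\ge 3$. Actions on trees are isomorphic if there is a group isomorphism together with an equivariant tree isomorphism. **Group actions.** A permutation group action $(G,X)$ is a faithful action of a group $G$ on a non-empty set $X$. For $Y\subseteq X$, $G^Y$ is the permutation group induced on $Y$ by the setwise stabiliser of $Y$ in $G$. An embedding $(H,Y)\hookrightarrow(G,X)$ is given by an injection $\Phi\colon Y\to X$ such that $h\mapsto \Phi h\Phi^{-1}$ is an isomorphism from $H$ onto $G^{\Phi(Y)}$. **Graph of group actions (gga).** A gga $\mathcal G$ consists of: a connected graph $\Delta$ (base graph); for every $v\in V\Delta$ a permutation group action $(G(v),X(v))$; for every $a\in A\Delta$ a permutation group action $(H(a),Y(a))$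 with $(H(\bar a),Y(\bar a))=(H(a),Y(a))$ and an embedding $\Phi_a\colon(H(a),Y(a))\hookrightarrow(G(t(a)),X(t(a)))$; and for every self-reverse arc $a$ a permutation $h_a$ of $Y(a)$ with $h_aH(a)h_a^{-1}=H(a)$ and $h_a^2\in H(a)$ (inversion agent). An $a$-adhesion map is a map $g\Phi_a\colon Y(a)\to X(t(a))$ with $g\in G(t(a))$; its image is called an $a$-adhesion set. If $a$ is self-reverse, a twisted $a$-adhesion map is a map $g\Phi_ah_a$ with $g\in G(t(a))$. **Augmented base digraph.** The index $i(a)$ is the number of distinct $a$-adhesion sets. $\Delta_+$ is the digraph obtained from $\Delta$ by adding, for each arc $a$, $i(a)-1$ new arcs with the same origin and terminus as $a$. **Reduced gga's.** The reduced gga $\mathcal G'$ has the same base graph $\Delta$, the same arc actions and inversion agents; the action at $v$ is $(G(v)^{X'(v)},X'(v))$, where $X'(v)\subseteq X(v)$ is the union of all adhesion sets in $X(v)$; and $\Phi'_a(y)=\Phi_a(y)$. The arc-reduced gga $\mathcal G''$ has the same base graph $\Delta$, the same arc actions and inversion agents; the set at $v$ is the disjoint union $X''(v)$ of all adhesion sets in $X(v)$ (an $a$-adhesion set and a $b$-adhesion set being regarded as distinct when $a\neq b$), acted on by the permutation group $G(v)^{X''(v)}$ induced by the natural action of $G(v)$ on $X''(v)$; and $\Phi''_a$ maps $y\in Y(a)$ to the element $\Phi_a(y)$ of the copy of the $a$-adhesion set $\Phi_a(Y(a))$ in $X''(t(a))$. (If $\Delta$ has no arcs these sets are empty, and this is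 allowed here.) **Scaffolding.** A scaffolding $(\Sigma,\sim,\pi,p)$ for $\mathcal G$ is a graph $\Sigma$ with an equivalence relation $\sim$ on $V\Sigma$, extended to $A\Sigma$ by $a\sim a'$ iff $o(a)\sim o(a')$ and $t(a)\sim t(a')$ (write $[x]$ for the class of $x$ as a set and $\llbracket x\rrbracket$ for the class as a vertex or arc of $T_\Sigma:=\Sigma/\!\sim$), such that: (i) $T_\Sigma$ is a tree; (ii) no arc of $\Sigma$ has both ends in the same class; (iii) $\pi\colon T_\Sigma\to\Delta$ is a graph morphism; (iv) $p$ is a map from $V\Sigma\cup A\Sigma$ to $\bigcup_v X(v)\cup\bigcup_a Y(a)$ such that: $p$ restricts to bijections $[v]\to X(\pi(\llbracket v\rrbracket))$ and $[a]\to Y(\pi(\llbracket a\rrbracket))$; $p(\bar b)=p(b)$ for every arc $b$; if $\Psi_{\llbracket a\rrbracket}$ is the unique map with $\Psi_{\llbracket a\rrbracket}(p(b))=p(t(b))$ for all $b\in[a]$, then $\Psi_{\llbracket a\rrbracket}$ is a $\pi(\llbracket a\rrbracket)$-adhesion map when $\pi(\llbracket a\rrbracket)$ is not self-reverse, while when $\pi(\llbracket a\rrbracket)$ is self-reverse one of $\Psi_{\llbracket a\rrbracket},\Psi_{\llbracket\bar a\rrbracket}$ is a $\pi(\llbracket a\rrbracket)$-adhesion map and the other is a twisted one; and for every vertex $\llbracket v\rrbracket$ of $T_\Sigma$, every $b\in A\Delta$ with $t(b)=\pi(\llbracket v\rrbracket)$ and every $b$-adhesion set $S$, there is exactly one arc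 $\llbracket a\rrbracket$ of $T_\Sigma$ with $t(\llbracket a\rrbracket)=\llbracket v\rrbracket$, $\pi(\llbracket a\rrbracket)=b$ and $\Psi_{\llbracket a\rrbracket}(Y(b))=S$. **Universal group.** Fix a scaffolding. $\mathcal U(\mathcal G)$ is the group of all graph automorphisms $g$ of $\Sigma$ which preserve $\sim$ and $\pi$ and are acceptable: for every $\llbracket v\rrbracket\in VT_\Sigma$ the permutation $g_{\llbracket v\rrbracket}$ of $X(\pi(\llbracket v\rrbracket))$ determined by $g_{\llbracket v\rrbracket}(p(x))=p(g(x))$, $x\in[v]$, lies in $G(\pi(\llbracket v\rrbracket))$. The associated tree is $T_{\mathcal G}=T_\Sigma$ (up to isomorphism, the unique tree $T$ with a surjective digraph morphism $T\to\Delta_+$ that restricts to a bijection $t^{-1}(x)\to t^{-1}(\text{image of }x)$ for each vertex $x$ of $T$). The induced action of $\mathcal U(\mathcal G)$ on it is the action of its image in $\mathrm{Aut}(T_{\mathcal G})$. *)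

theory Defs
  imports "Graph_Theory.Graph_Theory" "HOL-Algebra.Bij"
begin

section \<open>Graphs with arc reversal\<close>

text \<open>
  Digraphs are those of \<^typ>\<open>('v, 'a) pre_digraph\<close>; \<^const>\<open>tail\<close> is the origin map and
  \<^const>\<open>head\<close> the terminus map. The library's bidirected digraphs exclude self-reverse arcs,
  which are needed here.
\<close>

locale arc_graph = wf_digraph \<Gamma> for \<Gamma> :: "('v, 'a) pre_digraph" +
  fixes r :: "'a \<Rightarrow> 'a"
  assumes rev_in_arcs: "a \<in> arcs \<Gamma> \<Longrightarrow> r a \<in> arcs \<Gamma>"
    and rev_rev: "a \<in> arcs \<Gamma> \<Longrightarrow> r (r a) = a"
    and tail_eq_head_rev: "a \<in> arcs \<Gamma> \<Longrightarrow> tail \<Gamma> a = head \<Gamma> (r a)"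

definition graph_hom ::
  "('v, 'a) pre_digraph \<Rightarrow> ('a \<Rightarrow> 'a) \<Rightarrow> ('w, 'b) pre_digraph \<Rightarrow> ('b \<Rightarrow> 'b) \<Rightarrow>
    ('v \<Rightarrow> 'w) \<Rightarrow> ('a \<Rightarrow> 'b) \<Rightarrow> bool" where
  "graph_hom \<Gamma> r \<Gamma>' r' fV fA \<longleftrightarrow>
    fV ` verts \<Gamma> \<subseteq> verts \<Gamma>' \<and> fA ` arcs \<Gamma> \<subseteq> arcs \<Gamma>' \<and>
    (\<forall>a\<in>arcs \<Gamma>. tail \<Gamma>' (fA a) = fV (tail \<Gamma> a) \<and> head \<Gamma>' (fA a) = fV (head \<Gamma> a) \<and>
      fA (r a) = r' (fA a))"

definition graph_iso ::
  "('v, 'a) pre_digraph \<Rightarrow> ('a \<Rightarrow> 'a) \<Rightarrow> ('w, 'b) pre_digraph \<Rightarrow> ('b \<Rightarrow> 'b) \<Rightarrow>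
    ('v \<Rightarrow> 'w) \<Rightarrow> ('a \<Rightarrow> 'b) \<Rightarrow> bool" where
  "graph_iso \<Gamma> r \<Gamma>' r' fV fA \<longleftrightarrow> graph_hom \<Gamma> r \<Gamma>' r' fV fA \<and>
    bij_betw fV (verts \<Gamma>) (verts \<Gamma>') \<and> bij_betw fA (arcs \<Gamma>) (arcs \<Gamma>')"

definition is_tree :: "('v, 'a) pre_digraph \<Rightarrow> ('a \<Rightarrow> 'a) \<Rightarrow> bool" where
  "is_tree \<Gamma> r \<longleftrightarrow> arc_graph \<Gamma> r \<and> connected \<Gamma> \<and> loopfree_digraph \<Gamma> \<and> nomulti_digraph \<Gamma> \<and>
    (\<nexists>p. pre_digraph.cycle \<Gamma> p \<and> 3 \<le> length p)"

section \<open>Permutation groups\<close>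

text \<open>
  A faithful action on \<open>X\<close> is identified with the group of permutations of \<open>X\<close> it induces, that
  is, with a subgroup of \<^term>\<open>BijGroup X\<close>, whose elements are extensional functions.
\<close>

definition perm_group :: "('x \<Rightarrow> 'x) set \<Rightarrow> 'x set \<Rightarrow> ('x \<Rightarrow> 'x) monoid" where
  "perm_group H X = (BijGroup X)\<lparr>carrier := H\<rparr>"

definition induced_perms :: "('x \<Rightarrow> 'x) set \<Rightarrow> 'x set \<Rightarrow> ('x \<Rightarrow> 'x) set" where
  "induced_perms H Y = {restrict g Y | g. g \<in> H \<and> g ` Y = Y}"

definition action_embedding ::
  "('y \<Rightarrow> 'y) set \<Rightarrow> 'y set \<Rightarrow> ('x \<Rightarrow> 'x) set \<Rightarrow> 'x set \<Rightarrow> ('y \<Rightarrow> 'x) \<Rightarrow> bool" where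
  "action_embedding H Y G X \<Phi> \<longleftrightarrow> \<Phi> ` Y \<subseteq> X \<and> inj_on \<Phi> Y \<and>
    (\<lambda>h. \<lambda>x\<in>\<Phi> ` Y. \<Phi> (h (inv_into Y \<Phi> x)))
      \<in> iso (perm_group H Y) (perm_group (induced_perms G (\<Phi> ` Y)) (\<Phi> ` Y))"

section \<open>Graphs of group actions\<close>

record ('v, 'a, 'x, 'y) gga_data =
  base :: "('v, 'a) pre_digraph"
  base_rev :: "'a \<Rightarrow> 'a"
  vset :: "'v \<Rightarrow> 'x set"
  vgrp :: "'v \<Rightarrow> ('x \<Rightarrow> 'x) set"
  aset :: "'a \<Rightarrow> 'y set"
  agrp :: "'a \<Rightarrow> ('y \<Rightarrow> 'y) set"
  emb :: "'a \<Rightarrow> 'y \<Rightarrow> 'x"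
  agent :: "'a \<Rightarrow> 'y \<Rightarrow> 'y"

locale gga =
  fixes \<G> :: "('v, 'a, 'x, 'y) gga_data"
  assumes base_graph: "arc_graph (base \<G>) (base_rev \<G>)"
    and base_connected: "connected (base \<G>)"
    and vertex_action: "v \<in> verts (base \<G>) \<Longrightarrow>
      vset \<G> v \<noteq> {} \<and> subgroup (vgrp \<G> v) (BijGroup (vset \<G> v))"
    and arc_action: "a \<in> arcs (base \<G>) \<Longrightarrow>
      aset \<G> a \<noteq> {} \<and> subgroup (agrp \<G> a) (BijGroup (aset \<G> a))"
    and arc_action_rev: "a \<in> arcs (base \<G>) \<Longrightarrow>
      agrp \<G> (base_rev \<G> a) = agrp \<G> a \<and> aset \<G> (base_rev \<G> a) = aset \<G> a"
    and embedding: "a \<in> arcs (base \<G>) \<Longrightarrow>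
      action_embedding (agrp \<G> a) (aset \<G> a)
        (vgrp \<G> (head (base \<G>) a)) (vset \<G> (head (base \<G>) a)) (emb \<G> a)"
    and inversion_agent: "a \<in> arcs (base \<G>) \<Longrightarrow> base_rev \<G> a = a \<Longrightarrow>
      agent \<G> a \<in> carrier (BijGroup (aset \<G> a)) \<and>
      {agent \<G> a \<otimes>\<^bsub>BijGroup (aset \<G> a)\<^esub> h \<otimes>\<^bsub>BijGroup (aset \<G> a)\<^esub> inv\<^bsub>BijGroup (aset \<G> a)\<^esub> agent \<G> a
        | h. h \<in> agrp \<G> a} = agrp \<G> a \<and>
      agent \<G> a \<otimes>\<^bsub>BijGroup (aset \<G> a)\<^esub> agent \<G> a \<in> agrp \<G> a"

definition adhesion_maps :: "('v, 'a, 'x, 'y) gga_data \<Rightarrow> 'a \<Rightarrow> ('y \<Rightarrow> 'x) set" where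
  "adhesion_maps \<G> a = {compose (aset \<G> a) g (emb \<G> a) | g. g \<in> vgrp \<G> (head (base \<G>) a)}"

definition adhesion_sets :: "('v, 'a, 'x, 'y) gga_data \<Rightarrow> 'a \<Rightarrow> 'x set set" where
  "adhesion_sets \<G> a = (\<lambda>f. f ` aset \<G> a) ` adhesion_maps \<G> a"

definition twisted_adhesion_maps :: "('v, 'a, 'x, 'y) gga_data \<Rightarrow> 'a \<Rightarrow> ('y \<Rightarrow> 'x) set" where
  "twisted_adhesion_maps \<G> a =
    {compose (aset \<G> a) g (compose (aset \<G> a) (emb \<G> a) (agent \<G> a))
      | g. g \<in> vgrp \<G> (head (base \<G>) a)}"

section \<open>The augmented base digraph\<close>

text \<open>
  The \<open>i(a)\<close> parallel arcs formed by \<open>a\<close> and the arcs added for it are labelled \<open>(a, S)\<close>, with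
  \<open>S\<close> running over the \<open>a\<close>-adhesion sets; this also makes sense for infinite \<open>i(a)\<close>. The
  label belonging to the old arc \<open>a\<close> itself is the one with \<open>S = \<Phi>\<^sub>a(Y(a))\<close>.
\<close>

definition aug_digraph :: "('v, 'a, 'x, 'y) gga_data \<Rightarrow> ('v, 'a \<times> 'x set) pre_digraph" where
  "aug_digraph \<G> = \<lparr>verts = verts (base \<G>),
    arcs = {(a, S). a \<in> arcs (base \<G>) \<and> S \<in> adhesion_sets \<G> a},
    tail = (\<lambda>(a, S). tail (base \<G>) a),
    head = (\<lambda>(a, S). head (base \<G>) a)\<rparr>"

definition old_arc :: "('v, 'a, 'x, 'y) gga_data \<Rightarrow> 'a \<Rightarrow> 'a \<times> 'x set" where
  "old_arc \<G> a = (a, emb \<G> a ` aset \<G> a)"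

text \<open>
  The added arcs carry no names of their own. Two augmented base digraphs of the same base graph
  are equal if they have the same vertices and their arcs correspond so that ends are
  preserved, old arcs are fixed, and an arc added for \<open>a\<close> corresponds to an arc added for \<open>a\<close>.
  In particular the indices \<open>i(a)\<close> agree.
\<close>

definition aug_digraphs_equal ::
  "('v, 'a, 'x, 'y) gga_data \<Rightarrow> ('v, 'a, 'x2, 'y2) gga_data \<Rightarrow> bool" where
  "aug_digraphs_equal \<G> \<G>2 \<longleftrightarrow> base \<G> = base \<G>2 \<and>
    verts (aug_digraph \<G>) = verts (aug_digraph \<G>2) \<and>
    (\<exists>\<phi>. bij_betw \<phi> (arcs (aug_digraph \<G>)) (arcs (aug_digraph \<G>2)) \<and>
      (\<forall>e\<in>arcs (aug_digraph \<G>).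
        tail (aug_digraph \<G>2) (\<phi> e) = tail (aug_digraph \<G>) e \<and>
        head (aug_digraph \<G>2) (\<phi> e) = head (aug_digraph \<G>) e \<and>
        fst (\<phi> e) = fst e) \<and>
      (\<forall>a\<in>arcs (base \<G>). \<phi> (old_arc \<G> a) = old_arc \<G>2 a))"

section \<open>Reduced and arc-reduced graphs of group actions\<close>

definition reduced_vset :: "('v, 'a, 'x, 'y) gga_data \<Rightarrow> 'v \<Rightarrow> 'x set" where
  "reduced_vset \<G> v = (\<Union>a \<in> {a \<in> arcs (base \<G>). head (base \<G>) a = v}. \<Union>(adhesion_sets \<G> a))"

definition reduced_gga :: "('v, 'a, 'x, 'y) gga_data \<Rightarrow> ('v, 'a, 'x, 'y) gga_data" where
  "reduced_gga \<G> = \<G>\<lparr>vset := reduced_vset \<G>,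
    vgrp := (\<lambda>v. induced_perms (vgrp \<G> v) (reduced_vset \<G> v))\<rparr>"

text \<open>The copy of an \<open>a\<close>-adhesion set \<open>S\<close> in the disjoint union is \<open>{(a, S, x) | x \<in> S}\<close>.\<close>

definition arc_reduced_vset :: "('v, 'a, 'x, 'y) gga_data \<Rightarrow> 'v \<Rightarrow> ('a \<times> 'x set \<times> 'x) set" where
  "arc_reduced_vset \<G> v =
    {(a, S, x). a \<in> arcs (base \<G>) \<and> head (base \<G>) a = v \<and> S \<in> adhesion_sets \<G> a \<and> x \<in> S}"

definition arc_reduced_vgrp ::
  "('v, 'a, 'x, 'y) gga_data \<Rightarrow> 'v \<Rightarrow> ('a \<times> 'x set \<times> 'x \<Rightarrow> 'a \<times> 'x set \<times> 'x) set" where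
  "arc_reduced_vgrp \<G> v =
    {\<lambda>(a, S, x)\<in>arc_reduced_vset \<G> v. (a, g ` S, g x) | g. g \<in> vgrp \<G> v}"

definition arc_reduced_gga ::
  "('v, 'a, 'x, 'y) gga_data \<Rightarrow> ('v, 'a, 'a \<times> 'x set \<times> 'x, 'y) gga_data" where
  "arc_reduced_gga \<G> = \<lparr>base = base \<G>, base_rev = base_rev \<G>,
    vset = arc_reduced_vset \<G>, vgrp = arc_reduced_vgrp \<G>,
    aset = aset \<G>, agrp = agrp \<G>,
    emb = (\<lambda>a y. (a, emb \<G> a ` aset \<G> a, emb \<G> a y)),
    agent = agent \<G>\<rparr>"

section \<open>Scaffoldings\<close>

text \<open>
  The graph \<open>\<Sigma>\<close> with its reversal and the relation \<open>\<sim>\<close>, the vertex and arc parts of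
  \<open>\<pi>\<close>, and the restrictions of \<open>p\<close> to vertices and to arcs.
\<close>

record ('s, 'b, 'v, 'a, 'x, 'y) scaffold_data =
  sgraph :: "('s, 'b) pre_digraph"
  srev :: "'b \<Rightarrow> 'b"
  srel :: "('s \<times> 's) set"
  piV :: "'s set \<Rightarrow> 'v"
  piA :: "'b set \<Rightarrow> 'a"
  pV :: "'s \<Rightarrow> 'x"
  pA :: "'b \<Rightarrow> 'y"

definition sarc_rel :: "('s, 'b, 'v, 'a, 'x, 'y) scaffold_data \<Rightarrow> ('b \<times> 'b) set" where
  "sarc_rel \<S> = {(a, a'). a \<in> arcs (sgraph \<S>) \<and> a' \<in> arcs (sgraph \<S>) \<and>
    (tail (sgraph \<S>) a, tail (sgraph \<S>) a') \<in> srel \<S> \<and>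
    (head (sgraph \<S>) a, head (sgraph \<S>) a') \<in> srel \<S>}"

text \<open>
  The quotient \<open>T\<^sub>\<Sigma> = \<Sigma>/\<sim>\<close>. Only the reduced and arc-reduced graphs of group actions
  over a base graph without arcs have an empty vertex set \<open>X(v)\<close>; the base graph is then a single
  vertex, \<open>\<Sigma>\<close> is the empty graph, and its associated tree is the single vertex whose class
  is empty. The image of a class \<open>A\<close> of arcs under \<^const>\<open>tail\<close> lies in one class of vertices,
  which is recovered as \<open>srel \<S> `` (tail (sgraph \<S>) ` A)\<close>.
\<close>

definition stree :: "('s, 'b, 'v, 'a, 'x, 'y) scaffold_data \<Rightarrow> ('s set, 'b set) pre_digraph" where
  "stree \<S> = \<lparr>verts = (if verts (sgraph \<S>) = {} then {{}} else verts (sgraph \<S>) // srel \<S>),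
    arcs = arcs (sgraph \<S>) // sarc_rel \<S>,
    tail = (\<lambda>A. srel \<S> `` (tail (sgraph \<S>) ` A)),
    head = (\<lambda>A. srel \<S> `` (head (sgraph \<S>) ` A))\<rparr>"

definition stree_rev :: "('s, 'b, 'v, 'a, 'x, 'y) scaffold_data \<Rightarrow> 'b set \<Rightarrow> 'b set" where
  "stree_rev \<S> A = srev \<S> ` A"

text \<open>
  Since \<^const>\<open>pA\<close> maps \<open>A\<close> bijectively onto \<open>Y(\<pi>(A))\<close>, this is the unique map \<open>\<Psi>\<^sub>A\<close> on
  \<open>Y(\<pi>(A))\<close> with \<open>\<Psi>\<^sub>A(p(b)) = p(t(b))\<close> for all \<open>b \<in> A\<close>.
\<close>

definition Psi ::
  "('v, 'a, 'x, 'y) gga_data \<Rightarrow> ('s, 'b, 'v, 'a, 'x, 'y) scaffold_data \<Rightarrow> 'b set \<Rightarrow> 'y \<Rightarrow> 'x" where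
  "Psi \<G> \<S> A = (\<lambda>y\<in>aset \<G> (piA \<S> A). pV \<S> (head (sgraph \<S>) (inv_into A (pA \<S>) y)))"

locale scaffolding =
  fixes \<G> :: "('v, 'a, 'x, 'y) gga_data"
    and \<S> :: "('s, 'b, 'v, 'a, 'x, 'y) scaffold_data"
  assumes sgraph: "arc_graph (sgraph \<S>) (srev \<S>)"
    and srel_equiv: "equiv (verts (sgraph \<S>)) (srel \<S>)"
    and tree: "is_tree (stree \<S>) (stree_rev \<S>)"
    and ends_not_related: "e \<in> arcs (sgraph \<S>) \<Longrightarrow>
      (tail (sgraph \<S>) e, head (sgraph \<S>) e) \<notin> srel \<S>"
    and pi_hom: "graph_hom (stree \<S>) (stree_rev \<S>) (base \<G>) (base_rev \<G>) (piV \<S>) (piA \<S>)"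
    and pV_bij: "C \<in> verts (stree \<S>) \<Longrightarrow> bij_betw (pV \<S>) C (vset \<G> (piV \<S> C))"
    and pA_bij: "A \<in> arcs (stree \<S>) \<Longrightarrow> bij_betw (pA \<S>) A (aset \<G> (piA \<S> A))"
    and pA_rev: "e \<in> arcs (sgraph \<S>) \<Longrightarrow> pA \<S> (srev \<S> e) = pA \<S> e"
    and Psi_adhesion: "A \<in> arcs (stree \<S>) \<Longrightarrow> base_rev \<G> (piA \<S> A) \<noteq> piA \<S> A \<Longrightarrow>
      Psi \<G> \<S> A \<in> adhesion_maps \<G> (piA \<S> A)"
    and Psi_self_reverse: "A \<in> arcs (stree \<S>) \<Longrightarrow> base_rev \<G> (piA \<S> A) = piA \<S> A \<Longrightarrow>
      Psi \<G> \<S> A \<in> adhesion_maps \<G> (piA \<S> A) \<and>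
      Psi \<G> \<S> (stree_rev \<S> A) \<in> twisted_adhesion_maps \<G> (piA \<S> A) \<or>
      Psi \<G> \<S> A \<in> twisted_adhesion_maps \<G> (piA \<S> A) \<and>
      Psi \<G> \<S> (stree_rev \<S> A) \<in> adhesion_maps \<G> (piA \<S> A)"
    and unique_arc: "C \<in> verts (stree \<S>) \<Longrightarrow> b \<in> arcs (base \<G>) \<Longrightarrow>
      head (base \<G>) b = piV \<S> C \<Longrightarrow> S \<in> adhesion_sets \<G> b \<Longrightarrow>
      \<exists>!A. A \<in> arcs (stree \<S>) \<and> head (stree \<S>) A = C \<and> piA \<S> A = b \<and>
        Psi \<G> \<S> A ` aset \<G> b = S"

section \<open>The universal group and its action on the associated tree\<close>

text \<open>Automorphisms are pairs consisting of the permutation of vertices and that of arcs.\<close>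

definition universal_group ::
  "('v, 'a, 'x, 'y) gga_data \<Rightarrow> ('s, 'b, 'v, 'a, 'x, 'y) scaffold_data \<Rightarrow>
    (('s \<Rightarrow> 's) \<times> ('b \<Rightarrow> 'b)) monoid" where
  "universal_group \<G> \<S> = (BijGroup (verts (sgraph \<S>)) \<times>\<times> BijGroup (arcs (sgraph \<S>)))
    \<lparr>carrier := {(gV, gA).
      gV \<in> carrier (BijGroup (verts (sgraph \<S>))) \<and>
      gA \<in> carrier (BijGroup (arcs (sgraph \<S>))) \<and>
      graph_iso (sgraph \<S>) (srev \<S>) (sgraph \<S>) (srev \<S>) gV gA \<and>
      (\<forall>x\<in>verts (sgraph \<S>). \<forall>y\<in>verts (sgraph \<S>). (gV x, gV y) \<in> srel \<S> \<longleftrightarrow> (x, y) \<in> srel \<S>) \<and>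
      (\<forall>C\<in>verts (stree \<S>). piV \<S> (gV ` C) = piV \<S> C) \<and>
      (\<forall>A\<in>arcs (stree \<S>). piA \<S> (gA ` A) = piA \<S> A) \<and>
      (\<forall>C\<in>verts (stree \<S>).
        (\<lambda>z\<in>vset \<G> (piV \<S> C). pV \<S> (gV (inv_into C (pV \<S>) z))) \<in> vgrp \<G> (piV \<S> C))}\<rparr>"

definition tree_action ::
  "('s, 'b, 'v, 'a, 'x, 'y) scaffold_data \<Rightarrow> ('s \<Rightarrow> 's) \<times> ('b \<Rightarrow> 'b) \<Rightarrow>
    ('s set \<Rightarrow> 's set) \<times> ('b set \<Rightarrow> 'b set)" where
  "tree_action \<S> g =
    (\<lambda>C\<in>verts (stree \<S>). fst g ` C, \<lambda>A\<in>arcs (stree \<S>). snd g ` A)"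

definition induced_tree_group ::
  "('v, 'a, 'x, 'y) gga_data \<Rightarrow> ('s, 'b, 'v, 'a, 'x, 'y) scaffold_data \<Rightarrow>
    (('s set \<Rightarrow> 's set) \<times> ('b set \<Rightarrow> 'b set)) monoid" where
  "induced_tree_group \<G> \<S> = (BijGroup (verts (stree \<S>)) \<times>\<times> BijGroup (arcs (stree \<S>)))
    \<lparr>carrier := tree_action \<S> ` carrier (universal_group \<G> \<S>)\<rparr>"

definition tree_actions_isomorphic ::
  "('v, 'a) pre_digraph \<Rightarrow> ('a \<Rightarrow> 'a) \<Rightarrow> (('v \<Rightarrow> 'v) \<times> ('a \<Rightarrow> 'a)) monoid \<Rightarrow>
    ('w, 'b) pre_digraph \<Rightarrow> ('b \<Rightarrow> 'b) \<Rightarrow> (('w \<Rightarrow> 'w) \<times> ('b \<Rightarrow> 'b)) monoid \<Rightarrow> bool" where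
  "tree_actions_isomorphic T r P T' r' P' \<longleftrightarrow>
    (\<exists>\<theta>V \<theta>A \<phi>. graph_iso T r T' r' \<theta>V \<theta>A \<and> \<phi> \<in> iso P P' \<and>
      (\<forall>g\<in>carrier P.
        (\<forall>v\<in>verts T. \<theta>V (fst g v) = fst (\<phi> g) (\<theta>V v)) \<and>
        (\<forall>a\<in>arcs T. \<theta>A (snd g a) = snd (\<phi> g) (\<theta>A a))))"

end

theory Submission
  imports Defs
begin

text \<open>
  Forgetting \<open>\<Sigma>\<close>, a scaffolding is the tree \<open>T\<close> with \<open>\<pi>\<close> and the maps \<open>\<Psi>\<^sub>A\<close>, and a tree automorphism
  \<open>\<gamma>\<close> lies in the induced group iff it preserves \<open>\<pi>\<close> and there are \<open>g\<^sub>C \<in> G(\<pi>(C))\<close> and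
  permutations \<open>h\<^sub>A\<close> of \<open>Y(\<pi>(A))\<close>, equal on an arc and its reverse, with
  \<open>g\<^sub>C \<circ> \<Psi>\<^sub>A = \<Psi>\<^bsub>\<gamma>(A)\<^esub> \<circ> h\<^sub>A\<close> for every arc \<open>A\<close> with terminus \<open>C\<close>. Only the values of \<open>g\<^sub>C\<close> on adhesion
  sets matter here, so the condition does not change when the actions \<open>(G(v), X(v))\<close> are reduced, and
  a scaffolding of either reduced graph of group actions is, in this sense, one of the original.
  Two such trees are isomorphic by a map of the same kind as \<open>\<gamma>\<close>, built outwards from a root; conjugation
  by it identifies the induced groups.
\<close>

section \<open>Reduced walks in trees\<close>

text \<open>Neighbouring vertices of the tree are coupled only through the permutation
  \<open>h A\<close> shared by an arc and its reverse. So everything rests on one local fact: if a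
  group element at one end of an arc realises \<open>h\<close>, then some group element at the other
  end realises it too. Over an arc a of \<Delta> different from its reverse, both ends ask for
  \<open>h\<close> to lie in H(a). The obstacle is a self-reverse arc: one of its two maps is
  twisted by the inversion agent t, so that \<open>h\<close> is sought in H(a) or in its coset
  tH(a), and tH(a)t^-1 = H(a) together with t^2 in H(a) makes the demands at both ends equivalent. A
  second obstacle is that a reduced graph of group actions may have empty vertex sets and so need
  not be a \<open>gga\<close>; its trees are therefore pulled back to \<G> and compared there.
  Extending outwards from a root only produces a map of trees that is bijective on the arcs ending
  at each vertex. Uniqueness of reduced walks turns it into an isomorphism.\<close>

lemma connected_induct [consumes 4, case_names base arc]:
  assumes "arc_graph \<Gamma> r" "connected \<Gamma>" "u \<in> verts \<Gamma>" "v \<in> verts \<Gamma>" "P u"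
    and step: "\<And>a. a \<in> arcs \<Gamma> \<Longrightarrow> P (tail \<Gamma> a) \<Longrightarrow> P (head \<Gamma> a)"
  shows "P v"
proof -
  interpret arc_graph \<Gamma> r by fact
  have "(u, v) \<in> rtrancl_on (verts \<Gamma>) (parcs (mk_symmetric \<Gamma>))"
    using assms(2-4) unfolding connected_def strongly_connected_def reachable_def
    by (simp add: mk_symmetric_def with_proj_def arcs_ends_conv)
  then show ?thesis
  proof (induct rule: rtrancl_on_induct)
    case base
    show ?case by fact
  next
    case (step y z)
    then obtain a where "a \<in> arcs \<Gamma>"
      and "y = tail \<Gamma> a \<and> z = head \<Gamma> a \<or> y = head \<Gamma> a \<and> z = tail \<Gamma> a"
      by (auto simp: mk_symmetric_def)
    \<comment> \<open>Connectedness refers to the symmetric closure; crossing \<open>a\<close>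
      backwards is crossing \<open>r a\<close> forwards, so one forward rule covers both.\<close>
    then show ?case
      using assms(6)[of a] assms(6)[of "r a"] step(5) rev_in_arcs[of a] rev_rev[of a]
        tail_eq_head_rev[of a] tail_eq_head_rev[of "r a"] by auto
  qed
qed

abbreviation backtrack_free :: "('a \<Rightarrow> 'a) \<Rightarrow> 'a list \<Rightarrow> bool" where
  "backtrack_free r p \<equiv> successively (\<lambda>a b. b \<noteq> r a) p"

locale arc_tree = arc_graph T r for T :: "('v, 'a) pre_digraph" and r :: "'a \<Rightarrow> 'a" +
  assumes tree: "is_tree T r"
begin

lemma head_rev: "a \<in> arcs T \<Longrightarrow> head T (r a) = tail T a"
  by (simp add: tail_eq_head_rev)

lemma tail_rev: "a \<in> arcs T \<Longrightarrow> tail T (r a) = head T a"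
  using tail_eq_head_rev[of "r a"] by (simp add: rev_rev rev_in_arcs)

text \<open>If the heads along a nonempty walk are distinct, it is a cycle and so has length at most
  2: a loop is excluded, and two arcs would be mutually reverse because there are no parallel arcs.
  If a head repeats, the stretch in between is a shorter closed walk. Only consecutive arcs are
  compared, so \<open>backtrack_free\<close> passes to that stretch.\<close>

lemma closed_backtrack_free_walk:
  "awalk u p u \<Longrightarrow> backtrack_free r p \<Longrightarrow> p = []"
proof (induct "length p" arbitrary: p u rule: less_induct)
  case less
  interpret loopfree_digraph T using tree by (simp add: is_tree_def)
  interpret nomulti_digraph T using tree by (simp add: is_tree_def)
  show ?case
  proof (rule ccontr)
    assume "p \<noteq> []"
    have vs: "tl (awalk_verts u p) = map (head T) p"
      using less.prems(1) \<open>p \<noteq> []\<close> awalk_verts_conv'[of u p u] by (auto simp: awalk_def)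
    show False
    proof (cases "distinct (map (head T) p)")
      case True
      with less.prems(1) \<open>p \<noteq> []\<close> vs have "cycle p" by (auto simp: cycle_def)
      then have "length p < 3" using tree by (auto simp: is_tree_def not_le)
      then consider a where "p = [a]" | a b where "p = [a, b]"
        using \<open>p \<noteq> []\<close> by (cases p; cases "tl p"; cases "tl (tl p)") auto
      then show False
      proof cases
        case 1
        then show False using less.prems(1) no_loops[of a] by (auto simp: awalk_simps)
      next
        case 2
        then have "b = r a"
          using less.prems(1)
          by (intro no_multi_arcs)
            (auto simp: awalk_simps arc_to_ends_def head_rev tail_rev rev_in_arcs)
        then show False using less.prems(2) 2 by simp
      qed
    next
      case False
      then obtain xs y ys zs where "map (head T) p = xs @ [y] @ ys @ [y] @ zs"
        using not_distinct_decomp by blast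
      then obtain p1 a p2 b p3 where p: "p = p1 @ [a] @ p2 @ [b] @ p3" "head T a = head T b"
        by (auto simp: map_eq_append_conv append_eq_map_conv map_eq_Cons_conv Cons_eq_map_conv)
      have "p2 @ [b] = []"
      proof (rule less.hyps)
        show "length (p2 @ [b]) < length p" using p by simp
        show "awalk (head T a) (p2 @ [b]) (head T a)"
          using less.prems(1) p by (auto simp: awalk_simps)
        show "backtrack_free r (p2 @ [b])"
          using less.prems(2) p by (auto simp: successively_append_iff successively_Cons)
      qed
      then show False by simp
    qed
  qed
qed

text \<open>A common first arc cancels. If the first arcs \<open>a\<close> and \<open>b\<close>
  differ, the reverse of one walk followed by the other is closed, and it does not backtrack at the
  junction because \<open>b\<close> is not \<open>r (r a)\<close>; hence it is empty.\<close>

lemma backtrack_free_walk_unique: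
  "awalk u p v \<Longrightarrow> awalk u q v \<Longrightarrow> backtrack_free r p \<Longrightarrow> backtrack_free r q \<Longrightarrow> p = q"
proof (induct p arbitrary: u q)
  case Nil
  then show ?case using closed_backtrack_free_walk[of u q] by (auto simp: awalk_simps)
next
  case (Cons a p)
  have reversed: "awalk v (map r (rev p)) w" if "awalk w p v" for w p
    using that
  proof (induct p arbitrary: w)
    case Nil
    then show ?case by (auto simp: awalk_simps)
  next
    case (Cons c p)
    then have c: "awalk v (map r (rev p)) (head T c)" "c \<in> arcs T" "w = tail T c"
      by (auto simp: awalk_simps)
    then have "awlast v (map r (rev p)) = head T c" by auto
    with c show ?case by (simp add: awalk_simps head_rev tail_rev rev_in_arcs)
  qed
  show ?case
  proof (cases q)
    case Nil
    then show ?thesis using Cons closed_backtrack_free_walk[of u "a # p"]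
      by (auto simp: awalk_simps)
  next
    case (Cons b q')
    show ?thesis
    proof (cases "a = b")
      case True
      then show ?thesis using Cons Cons.hyps[of "head T a" q'] Cons.prems
        by (auto simp: awalk_simps successively_Cons)
    next
      case False
      have a: "a \<in> arcs T" using Cons.prems by (simp add: awalk_simps)
      have sub: "set (a # p) \<subseteq> arcs T" using Cons.prems(1) by blast
      have w: "awalk v (map r (rev (a # p))) u" using reversed Cons.prems(1) by blast
      moreover have "awlast v (map r (rev (a # p))) = u" using w by blast
      ultimately have "awalk v (map r (rev (a # p)) @ q) v"
        using Cons.prems(2) by (simp del: map_append rev.simps)
      moreover have "backtrack_free r (map r (rev (a # p)))"
        unfolding successively_map successively_rev
        by (rule successively_mono[OF Cons.prems(3)]) (use sub in \<open>auto simp: rev_rev\<close>)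
      then have "backtrack_free r (map r (rev (a # p)) @ q)"
        using Cons.prems(4) False a Cons rev_rev[OF a]
        unfolding successively_append_iff by simp
      ultimately have "map r (rev (a # p)) @ q = []" by (rule closed_backtrack_free_walk)
      then show ?thesis by simp
    qed
  qed
qed

lemma backtrack_free_walk_exists:
  assumes "c \<in> verts T" "v \<in> verts T"
  shows "\<exists>p. awalk v p c \<and> backtrack_free r p"
proof -
  have conn: "connected T" using tree by (simp add: is_tree_def)
  from arc_graph_axioms conn assms show ?thesis
  proof (induct rule: connected_induct)
    case base
    show ?case
      using assms(1) by (intro exI[of _ "[]"]) (simp add: awalk_simps)
  next
    case (arc a)
    then obtain p where p: "awalk (tail T a) p c" "backtrack_free r p" by blast
    show ?case
    proof (cases "p \<noteq> [] \<and> hd p = a")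
      case True
      then have "p = a # tl p" by (cases p) auto
      then show ?thesis using p by (metis awalk_Cons_iff successively_Cons successively.simps(1))
    next
      case False
      then show ?thesis
        using p arc(1)
        by (intro exI[of _ "r a # p"])
          (auto simp: awalk_simps head_rev tail_rev rev_in_arcs successively_Cons rev_rev)
    qed
  qed
qed

text \<open>The form in which a tree supports recursion: \<rho> v is the reduced walk from v to the
  root, its length is the induction measure, and along every arc the walk of one end prolongs that
  of the other.\<close>

lemma rooting_exists:
  assumes "c \<in> verts T"
  shows "\<exists>\<rho>. \<rho> c = [] \<and>
    (\<forall>v\<in>verts T. v \<noteq> c \<longrightarrow> (\<exists>a\<in>arcs T. tail T a = v \<and> \<rho> v = a # \<rho> (head T a))) \<and>
    (\<forall>a\<in>arcs T. \<rho> (tail T a) = a # \<rho> (head T a) \<or> \<rho> (head T a) = r a # \<rho> (tail T a))"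
proof -
  define \<rho> where "\<rho> v = (SOME p. awalk v p c \<and> backtrack_free r p)" for v
  have \<rho>: "awalk v (\<rho> v) c \<and> backtrack_free r (\<rho> v)" if "v \<in> verts T" for v
    unfolding \<rho>_def by (rule someI_ex) (rule backtrack_free_walk_exists[OF assms that])
  have \<rho>_eq: "\<rho> v = p" if "awalk v p c" "backtrack_free r p" for v p
    using that \<rho>[of v] backtrack_free_walk_unique[of v p c "\<rho> v"] by auto
  have "\<rho> c = []" using assms by (intro \<rho>_eq) (auto simp: awalk_simps)
  moreover have "\<exists>a\<in>arcs T. tail T a = v \<and> \<rho> v = a # \<rho> (head T a)"
    if "v \<in> verts T" "v \<noteq> c" for v
  proof (cases "\<rho> v")
    case Nil
    then show ?thesis using \<rho>[OF that(1)] that by (auto simp: awalk_simps)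
  next
    case (Cons a p)
    then have "\<rho> (head T a) = p"
      using \<rho>[OF that(1)] by (intro \<rho>_eq) (auto simp: awalk_simps successively_Cons)
    then show ?thesis using Cons \<rho>[OF that(1)] by (auto simp: awalk_simps)
  qed
  moreover have "\<rho> (tail T a) = a # \<rho> (head T a) \<or> \<rho> (head T a) = r a # \<rho> (tail T a)"
    if a: "a \<in> arcs T" for a
  proof (cases "\<rho> (head T a) \<noteq> [] \<and> hd (\<rho> (head T a)) = r a")
    case True
    then obtain p where p: "\<rho> (head T a) = r a # p" by (cases "\<rho> (head T a)") auto
    then have "\<rho> (tail T a) = p"
      using \<rho>[of "head T a"] a
      by (intro \<rho>_eq) (auto simp: awalk_simps successively_Cons head_rev)
    with p show ?thesis by simp
  next
    case False
    then have "\<rho> (tail T a) = a # \<rho> (head T a)"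
      using \<rho>[of "head T a"] a by (intro \<rho>_eq) (auto simp: awalk_simps successively_Cons)
    then show ?thesis ..
  qed
  ultimately show ?thesis by blast
qed

end

lemma arc_treeI: "is_tree T r \<Longrightarrow> arc_tree T r"
  by (simp add: arc_tree_def arc_tree_axioms_def is_tree_def)

text \<open>Injectivity: a covering takes the reduced walk from a vertex to the root to the reduced walk
  from the image of that vertex.\<close>

lemma tree_covering_iso:
  assumes "is_tree T r" "is_tree T' r'" and hom: "graph_hom T r T' r' fV fA"
    and inj: "\<And>a b. a \<in> arcs T \<Longrightarrow> b \<in> arcs T \<Longrightarrow> head T a = head T b \<Longrightarrow> fA a = fA b \<Longrightarrow> a = b"
    and surj: "\<And>v a'. v \<in> verts T \<Longrightarrow> a' \<in> arcs T' \<Longrightarrow> head T' a' = fV v \<Longrightarrow>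
      \<exists>a\<in>arcs T. head T a = v \<and> fA a = a'"
  shows "graph_iso T r T' r' fV fA"
proof -
  interpret T: arc_tree T r using assms(1) by (rule arc_treeI)
  interpret T': arc_tree T' r' using assms(2) by (rule arc_treeI)
  have fV: "fV v \<in> verts T'" if "v \<in> verts T" for v using hom that by (auto simp: graph_hom_def)
  have fA: "fA a \<in> arcs T'" "tail T' (fA a) = fV (tail T a)" "head T' (fA a) = fV (head T a)"
    "fA (r a) = r' (fA a)" if "a \<in> arcs T" for a using hom that by (auto simp: graph_hom_def)
  have conn: "connected T" "connected T'" using assms(1,2) by (auto simp: is_tree_def)
  obtain c where c: "c \<in> verts T"
    using conn(1) by (auto simp: connected_def strongly_connected_def mk_symmetric_def)
  obtain \<rho> where \<rho>: "\<rho> c = []"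
    "\<And>v. v \<in> verts T \<Longrightarrow> v \<noteq> c \<Longrightarrow> \<exists>a\<in>arcs T. tail T a = v \<and> \<rho> v = a # \<rho> (head T a)"
    using T.rooting_exists[OF c] by blast
  obtain \<rho>' where \<rho>': "\<rho>' (fV c) = []"
    "\<And>a. a \<in> arcs T' \<Longrightarrow>
      \<rho>' (tail T' a) = a # \<rho>' (head T' a) \<or> \<rho>' (head T' a) = r' a # \<rho>' (tail T' a)"
    using T'.rooting_exists[OF fV[OF c]] by blast
  have walk: "\<rho>' (fV v) = map fA (\<rho> v)" if "v \<in> verts T" for v
    using that
  proof (induct "length (\<rho> v)" arbitrary: v rule: less_induct)
    case less
    show ?case
    proof (cases "v = c")
      case True
      then show ?thesis using \<rho>(1) \<rho>'(1) by simp
    next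
      case False
      obtain a where a: "a \<in> arcs T" "tail T a = v" "\<rho> v = a # \<rho> (head T a)"
        using \<rho>(2)[OF less.prems False] by blast
      have IH: "\<rho>' (fV (head T a)) = map fA (\<rho> (head T a))" using a by (intro less.hyps) auto
      consider "\<rho>' (fV v) = fA a # \<rho>' (fV (head T a))"
        | "\<rho>' (fV (head T a)) = fA (r a) # \<rho>' (fV v)"
        using \<rho>'(2)[of "fA a"] fA[of a] a by auto
      then show ?thesis
      proof cases
        case 1
        then show ?thesis using IH a by simp
      next
        case 2
        \<comment> \<open>Here the image walk would backtrack. The first arc \<open>b\<close> of
          \<open>\<rho> (head T a)\<close> has the same image as \<open>r a\<close>;
          \<open>inj\<close>, applied to the reverses, which both end at \<open>head T a\<close>,
          gives \<open>b = r a\<close>. Then each of \<open>\<rho> v\<close> and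
          \<open>\<rho> (head T a)\<close> would be longer than the other.\<close>
        then have "\<rho> (head T a) \<noteq> []" using IH by auto
        then have "head T a \<noteq> c" using \<rho>(1) by auto
        then obtain b where b: "b \<in> arcs T" "tail T b = head T a"
          "\<rho> (head T a) = b # \<rho> (head T b)"
          using \<rho>(2)[of "head T a"] a by auto
        have "fA (r b) = fA (r (r a))" using 2 IH b fA(4)[of b] fA(4)[of "r a"] a T.rev_in_arcs
          by auto
        then have "r b = r (r a)"
          using a b by (intro inj) (auto simp: T.rev_in_arcs T.head_rev T.tail_rev T.rev_rev)
        then have "r a = b" using a b T.rev_rev[of b] T.rev_rev[of a] T.rev_rev[of "r a"] T.rev_in_arcs by metis
        then have "head T b = v" using a T.head_rev by auto
        then show ?thesis using arg_cong[OF a(3), of length] arg_cong[OF b(3), of length] by simp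
      qed
    qed
  qed
  \<comment> \<open>By \<open>walk\<close>, the reduced walks of \<open>v\<close> and
    \<open>w\<close> have equal images. The heads of their first arcs agree by induction, and
    \<open>inj\<close> then identifies the arcs themselves.\<close>
  have "v = w" if "v \<in> verts T" "w \<in> verts T" "fV v = fV w" for v w
    using that
  proof (induct "length (\<rho> v)" arbitrary: v w rule: less_induct)
    case less
    then have eq: "map fA (\<rho> v) = map fA (\<rho> w)" using walk by metis
    show ?case
    proof (cases "v = c \<or> w = c")
      case True
      then have "\<rho> v = [] \<and> \<rho> w = []" using eq \<rho>(1) by auto
      then show ?thesis using \<rho>(2) less.prems by (metis list.discI)
    next
      case False
      obtain a where a: "a \<in> arcs T" "tail T a = v" "\<rho> v = a # \<rho> (head T a)"
        using \<rho>(2) less.prems False by blast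
      obtain b where b: "b \<in> arcs T" "tail T b = w" "\<rho> w = b # \<rho> (head T b)"
        using \<rho>(2) less.prems False by blast
      have ab: "fA a = fA b" using a b eq by simp
      then have "head T a = head T b" using a b fA(3)[of a] fA(3)[of b] by (intro less.hyps) auto
      then have "a = b" using a b ab by (intro inj) auto
      then show ?thesis using a b by simp
    qed
  qed
  then have injV: "inj_on fV (verts T)" by (rule inj_onI)
  \<comment> \<open>The hypothesis \<open>surj\<close> lifts arcs ending at a vertex, so an arc
    leaving the image is lifted through its reverse.\<close>
  have "v' \<in> fV ` verts T" if "v' \<in> verts T'" for v'
    using T'.arc_graph_axioms conn(2) fV[OF c] that
  proof (induct rule: connected_induct)
    case base
    show ?case using c by blast
  next
    case (arc a')
    then obtain v where v: "v \<in> verts T" "head T' (r' a') = fV v" by (auto simp: T'.head_rev)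
    then obtain a where "a \<in> arcs T" "fA a = r' a'" using surj T'.rev_in_arcs[OF arc(1)] by blast
    then show ?case using fA(2)[of a] arc(1) by (auto simp: T'.tail_rev)
  qed
  then have bV: "bij_betw fV (verts T) (verts T')" using injV fV by (auto simp: bij_betw_def)
  have "inj_on fA (arcs T)"
  proof (rule inj_onI)
    fix a b assume ab: "a \<in> arcs T" "b \<in> arcs T" "fA a = fA b"
    then have "head T a = head T b" using fA(3)[of a] fA(3)[of b] injV by (auto simp: inj_on_def)
    with ab show "a = b" by (blast intro: inj)
  qed
  moreover have "a' \<in> fA ` arcs T" if a': "a' \<in> arcs T'" for a'
  proof -
    obtain v where "v \<in> verts T" "head T' a' = fV v"
      using bV T'.head_in_verts[OF a'] by (auto simp: bij_betw_def)
    then show ?thesis using surj[OF _ a'] by blast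
  qed
  ultimately have "bij_betw fA (arcs T) (arcs T')" using fA(1) by (auto simp: bij_betw_def)
  with bV hom show ?thesis by (simp add: graph_iso_def)
qed

section \<open>Adhesion maps\<close>

text \<open>Pointwise form of the subgroup axioms, in which an inverse appears only through its
  cancellation laws.\<close>

lemma subgroup_BijGroupD:
  assumes "subgroup H (BijGroup X)"
  shows "g \<in> H \<Longrightarrow> bij_betw g X X"
    and "(\<lambda>x\<in>X. x) \<in> H"
    and "g \<in> H \<Longrightarrow> k \<in> H \<Longrightarrow> compose X g k \<in> H"
    and "g \<in> H \<Longrightarrow> \<exists>k\<in>H. \<forall>x\<in>X. k (g x) = x \<and> g (k x) = x"
proof -
  have sub: "H \<subseteq> Bij X" using subgroup.subset[OF assms] by (simp add: BijGroup_def)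
  show bij: "bij_betw g X X" if "g \<in> H" for g
    using that sub by (auto simp: Bij_def)
  show "(\<lambda>x\<in>X. x) \<in> H" using subgroup.one_closed[OF assms] by (simp add: BijGroup_def)
  show "compose X g k \<in> H" if "g \<in> H" "k \<in> H" for g k
    using subgroup.m_closed[OF assms that] that sub by (auto simp: BijGroup_def subset_iff)
  show "\<exists>k\<in>H. \<forall>x\<in>X. k (g x) = x \<and> g (k x) = x" if "g \<in> H" for g
  proof
    have "inv\<^bsub>BijGroup X\<^esub> g = (\<lambda>x\<in>X. inv_into X g x)" using that sub by (intro inv_BijGroup) auto
    then show "(\<lambda>x\<in>X. inv_into X g x) \<in> H" using subgroup.m_inv_closed[OF assms that] by simp
    show "\<forall>x\<in>X. (\<lambda>x\<in>X. inv_into X g x) (g x) = x \<and> g ((\<lambda>x\<in>X. inv_into X g x) x) = x"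
      using bij[OF that] by (auto simp: bij_betw_def f_inv_into_f)
  qed
qed

text \<open>The scaffolding conditions on \<open>Psi\<close> for an arc over \<open>a\<close> and
  its reverse in a single statement. For a self-reverse \<open>a\<close> either direction may carry
  the twist, whence the alternative.\<close>

definition adhesion_pair ::
  "('v, 'a, 'x, 'y) gga_data \<Rightarrow> 'a \<Rightarrow> ('y \<Rightarrow> 'x) \<Rightarrow> ('y \<Rightarrow> 'x) \<Rightarrow> bool" where
  "adhesion_pair \<G> a f f' \<longleftrightarrow>
    (if base_rev \<G> a \<noteq> a then f \<in> adhesion_maps \<G> a \<and> f' \<in> adhesion_maps \<G> (base_rev \<G> a)
     else f \<in> adhesion_maps \<G> a \<and> f' \<in> twisted_adhesion_maps \<G> a \<or>
       f \<in> twisted_adhesion_maps \<G> a \<and> f' \<in> adhesion_maps \<G> a)"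

context gga
begin

lemmas arc_graph_simps =
  arc_graph.rev_in_arcs[OF base_graph] arc_graph.rev_rev[OF base_graph]

lemma base_head [simp]: "a \<in> arcs (base \<G>) \<Longrightarrow> head (base \<G>) a \<in> verts (base \<G>)"
  using base_graph by (simp add: arc_graph_def wf_digraph.head_in_verts)

lemma vgrp_subgroup: "v \<in> verts (base \<G>) \<Longrightarrow> subgroup (vgrp \<G> v) (BijGroup (vset \<G> v))"
  using vertex_action by simp

lemma agrp_subgroup: "a \<in> arcs (base \<G>) \<Longrightarrow> subgroup (agrp \<G> a) (BijGroup (aset \<G> a))"
  using arc_action by simp

lemmas vgrpD = subgroup_BijGroupD[OF vgrp_subgroup]
lemmas agrpD = subgroup_BijGroupD[OF agrp_subgroup]

lemma emb_inj: "a \<in> arcs (base \<G>) \<Longrightarrow> inj_on (emb \<G> a) (aset \<G> a)"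
  and emb_into: "a \<in> arcs (base \<G>) \<Longrightarrow> y \<in> aset \<G> a \<Longrightarrow> emb \<G> a y \<in> vset \<G> (head (base \<G>) a)"
  using embedding by (auto simp: action_embedding_def)

lemma emb_extend:
  assumes a: "a \<in> arcs (base \<G>)" and k: "k \<in> agrp \<G> a"
  shows "\<exists>g\<in>vgrp \<G> (head (base \<G>) a). \<forall>y\<in>aset \<G> a. g (emb \<G> a y) = emb \<G> a (k y)"
proof -
  let ?Y = "aset \<G> a" and ?\<Phi> = "emb \<G> a"
  have "(\<lambda>x\<in>?\<Phi> ` ?Y. ?\<Phi> (k (inv_into ?Y ?\<Phi> x))) \<in> induced_perms (vgrp \<G> (head (base \<G>) a)) (?\<Phi> ` ?Y)"
    using embedding[OF a] k by (auto simp: action_embedding_def iso_def hom_def perm_group_def)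
  then obtain g where g: "g \<in> vgrp \<G> (head (base \<G>) a)"
    "(\<lambda>x\<in>?\<Phi> ` ?Y. ?\<Phi> (k (inv_into ?Y ?\<Phi> x))) = restrict g (?\<Phi> ` ?Y)"
    by (auto simp: induced_perms_def)
  have "g (?\<Phi> y) = ?\<Phi> (k y)" if "y \<in> ?Y" for y
    using fun_cong[OF g(2), of "?\<Phi> y"] that emb_inj[OF a] by simp
  with g(1) show ?thesis by blast
qed

text \<open>Converse of \<open>emb_extend\<close>, from surjectivity onto the induced group: as
  \<open>h\<close> permutes Y(a), \<open>g\<close> stabilises \<Phi>(Y(a)) setwise and induces an
  element of that group. Off Y(a) the map \<open>h\<close> is arbitrary, whence the pointwise
  conclusion.\<close>

lemma emb_cancel:
  assumes a: "a \<in> arcs (base \<G>)" and g: "g \<in> vgrp \<G> (head (base \<G>) a)"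
    and h: "bij_betw h (aset \<G> a) (aset \<G> a)"
    and eq: "\<And>y. y \<in> aset \<G> a \<Longrightarrow> g (emb \<G> a y) = emb \<G> a (h y)"
  shows "\<exists>k\<in>agrp \<G> a. \<forall>y\<in>aset \<G> a. h y = k y"
proof -
  let ?Y = "aset \<G> a" and ?\<Phi> = "emb \<G> a"
  have "g ` ?\<Phi> ` ?Y = ?\<Phi> ` h ` ?Y" using eq by (auto simp: image_iff)
  then have "restrict g (?\<Phi> ` ?Y) \<in> induced_perms (vgrp \<G> (head (base \<G>) a)) (?\<Phi> ` ?Y)"
    using g h by (auto simp: induced_perms_def bij_betw_def)
  moreover have "(\<lambda>h. \<lambda>x\<in>?\<Phi> ` ?Y. ?\<Phi> (h (inv_into ?Y ?\<Phi> x))) ` agrp \<G> a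
      = induced_perms (vgrp \<G> (head (base \<G>) a)) (?\<Phi> ` ?Y)"
    using embedding[OF a] by (auto simp: action_embedding_def iso_def bij_betw_def perm_group_def)
  ultimately obtain k where k: "k \<in> agrp \<G> a"
    "restrict g (?\<Phi> ` ?Y) = (\<lambda>x\<in>?\<Phi> ` ?Y. ?\<Phi> (k (inv_into ?Y ?\<Phi> x)))" by blast
  have "h y = k y" if y: "y \<in> ?Y" for y
  proof -
    have "?\<Phi> (h y) = ?\<Phi> (k y)"
      using fun_cong[OF k(2), of "?\<Phi> y"] y emb_inj[OF a] eq[OF y] by simp
    moreover have "h y \<in> ?Y" "k y \<in> ?Y" using h agrpD(1)[OF a k(1)] y by (auto simp: bij_betw_def)
    ultimately show ?thesis using emb_inj[OF a] by (simp add: inj_on_def)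
  qed
  with k(1) show ?thesis by blast
qed

text \<open>Adhesion maps are the maps \<open>f\<close> with \<open>parallel a (\<lambda>y. y) f\<close>, twisted ones those with
  \<open>parallel a (agent \<G> a) f\<close>.\<close>

definition parallel :: "'a \<Rightarrow> ('y \<Rightarrow> 'y) \<Rightarrow> ('y \<Rightarrow> 'x) \<Rightarrow> bool" where
  "parallel a s f \<longleftrightarrow> bij_betw s (aset \<G> a) (aset \<G> a) \<and>
    (\<exists>g\<in>vgrp \<G> (head (base \<G>) a). \<forall>y\<in>aset \<G> a. f y = g (emb \<G> a (s y)))"

lemma parallel_adhesion_map: "f \<in> adhesion_maps \<G> a \<Longrightarrow> parallel a (\<lambda>y. y) f"
  by (auto simp: parallel_def adhesion_maps_def compose_eq bij_betw_def)

lemma parallel_twisted_adhesion_map: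
  assumes "a \<in> arcs (base \<G>)" "base_rev \<G> a = a" "f \<in> twisted_adhesion_maps \<G> a"
  shows "parallel a (agent \<G> a) f"
  using inversion_agent[OF assms(1,2)] assms(3)
  by (auto simp: parallel_def twisted_adhesion_maps_def compose_eq BijGroup_def Bij_def)

lemma parallel_inj:
  assumes a: "a \<in> arcs (base \<G>)" and "parallel a s f"
  shows "inj_on f (aset \<G> a)"
proof -
  obtain g where g: "g \<in> vgrp \<G> (head (base \<G>) a)" "\<And>y. y \<in> aset \<G> a \<Longrightarrow> f y = g (emb \<G> a (s y))"
    and s: "bij_betw s (aset \<G> a) (aset \<G> a)"
    using assms(2) by (auto simp: parallel_def)
  have gi: "inj_on g (vset \<G> (head (base \<G>) a))" using vgrpD(1)[OF base_head[OF a] g(1)]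
    by (simp add: bij_betw_def)
  show ?thesis
  proof (rule inj_onI)
    fix y z assume yz: "y \<in> aset \<G> a" "z \<in> aset \<G> a" "f y = f z"
    then have sm: "s y \<in> aset \<G> a" "s z \<in> aset \<G> a" using s by (auto simp: bij_betw_def)
    then have "emb \<G> a (s y) = emb \<G> a (s z)"
      using gi yz g(2) emb_into[OF a] by (auto simp: inj_on_def)
    then show "y = z" using sm emb_inj[OF a] s yz by (auto simp: inj_on_def bij_betw_def)
  qed
qed

text \<open>The factor \<open>s\<close> permutes Y(a) and leaves the image unchanged; in particular
  a twisted adhesion map has an ordinary adhesion set as its image.\<close>

lemma parallel_image:
  assumes a: "a \<in> arcs (base \<G>)" and p: "parallel a s f" and g: "g \<in> vgrp \<G> (head (base \<G>) a)"
  shows "g ` f ` aset \<G> a \<in> adhesion_sets \<G> a"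
proof -
  let ?v = "head (base \<G>) a"
  obtain k where k: "k \<in> vgrp \<G> ?v" "\<And>y. y \<in> aset \<G> a \<Longrightarrow> f y = k (emb \<G> a (s y))"
    and s: "bij_betw s (aset \<G> a) (aset \<G> a)"
    using p by (auto simp: parallel_def)
  have "g ` f ` aset \<G> a = (\<lambda>y. g (k (emb \<G> a y))) ` s ` aset \<G> a"
    using k(2) by (auto simp: image_iff)
  also have "\<dots> = (\<lambda>y. g (k (emb \<G> a y))) ` aset \<G> a" using s by (simp add: bij_betw_def)
  also have "\<dots> = compose (aset \<G> a) (compose (vset \<G> ?v) g k) (emb \<G> a) ` aset \<G> a"
    using emb_into[OF a] by (auto simp: compose_eq image_iff)
  finally show ?thesis using vgrpD(3)[OF base_head[OF a] g k(1)]
    by (auto simp: adhesion_sets_def adhesion_maps_def)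
qed

lemma parallel_into:
  assumes a: "a \<in> arcs (base \<G>)" and p: "parallel a s f" and y: "y \<in> aset \<G> a"
  shows "f y \<in> vset \<G> (head (base \<G>) a)"
proof -
  obtain k where k: "k \<in> vgrp \<G> (head (base \<G>) a)" "f y = k (emb \<G> a (s y))"
    and s: "s y \<in> aset \<G> a"
    using p y by (auto simp: parallel_def bij_betw_def)
  then show ?thesis using emb_into[OF a s] vgrpD(1)[OF base_head[OF a] k(1)]
    by (auto simp: bij_betw_def)
qed

text \<open>With f = k\<Phi>s and f' = k'\<Phi>s', the equation says that k'^-1 g k acts on
  \<Phi>(Y(a)) as s'hs^-1 does on Y(a), so the latter belongs to H(a) by
  \<open>emb_cancel\<close>.\<close>

lemma parallel_cancel:
  assumes a: "a \<in> arcs (base \<G>)" and p: "parallel a s f" "parallel a s' f'"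
    and g: "g \<in> vgrp \<G> (head (base \<G>) a)" and h: "bij_betw h (aset \<G> a) (aset \<G> a)"
    and eq: "\<And>y. y \<in> aset \<G> a \<Longrightarrow> g (f y) = f' (h y)"
  shows "\<exists>k\<in>agrp \<G> a. \<forall>y\<in>aset \<G> a. s' (h y) = k (s y)"
proof -
  let ?Y = "aset \<G> a" and ?v = "head (base \<G>) a"
  obtain k where k: "k \<in> vgrp \<G> ?v" "\<And>y. y \<in> ?Y \<Longrightarrow> f y = k (emb \<G> a (s y))"
    and s: "bij_betw s ?Y ?Y"
    using p by (auto simp: parallel_def)
  obtain k' where k': "k' \<in> vgrp \<G> ?v" "\<And>y. y \<in> ?Y \<Longrightarrow> f' y = k' (emb \<G> a (s' y))"
    and s': "bij_betw s' ?Y ?Y"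
    using p by (auto simp: parallel_def)
  note V = vgrpD[OF base_head[OF a]]
  obtain l where l: "l \<in> vgrp \<G> ?v" "\<And>x. x \<in> vset \<G> ?v \<Longrightarrow> l (k' x) = x" using V(4)[OF k'(1)] by blast
  let ?g = "compose (vset \<G> ?v) l (compose (vset \<G> ?v) g k)" and ?h = "s' \<circ> h \<circ> inv_into ?Y s"
  have si: "bij_betw (inv_into ?Y s) ?Y ?Y" using s by (rule bij_betw_inv_into)
  have "\<exists>k\<in>agrp \<G> a. \<forall>y\<in>?Y. ?h y = k y"
  proof (rule emb_cancel[OF a])
    show "?g \<in> vgrp \<G> ?v" using V(3) g k(1) l(1) by blast
    show "bij_betw ?h ?Y ?Y" by (intro bij_betw_trans[OF si] bij_betw_trans[OF h] s')
    fix y assume y: "y \<in> ?Y"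
    let ?z = "inv_into ?Y s y"
    have z: "?z \<in> ?Y" "s ?z = y" using y s by (auto simp: bij_betw_def inv_into_into f_inv_into_f)
    have m: "h ?z \<in> ?Y" "s' (h ?z) \<in> ?Y" using z h s' by (auto simp: bij_betw_def)
    have "?g (emb \<G> a y) = l (g (f ?z))" using y z k(2)[OF z(1)] emb_into[OF a y]
      by (simp add: compose_eq)
    also have "\<dots> = l (k' (emb \<G> a (s' (h ?z))))" using eq z k'(2) m by simp
    also have "\<dots> = emb \<G> a (?h y)" using l(2) emb_into[OF a m(2)] by simp
    finally show "?g (emb \<G> a y) = emb \<G> a (?h y)" .
  qed
  then obtain c where c: "c \<in> agrp \<G> a" "\<And>y. y \<in> ?Y \<Longrightarrow> ?h y = c y" by blast
  have "s' (h y) = c (s y)" if "y \<in> ?Y" for y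
    using c(2)[of "s y"] that s by (auto simp: bij_betw_def)
  with c(1) show ?thesis by blast
qed

text \<open>\<open>parallel_cancel\<close> read backwards: if \<open>d\<close> extends
  \<open>c\<close> to G(t(a)), the witness is k'dk^-1.\<close>

lemma parallel_extend:
  assumes a: "a \<in> arcs (base \<G>)" and p: "parallel a s f" "parallel a s' f'"
    and h: "bij_betw h (aset \<G> a) (aset \<G> a)"
    and c: "c \<in> agrp \<G> a" "\<And>y. y \<in> aset \<G> a \<Longrightarrow> s' (h y) = c (s y)"
  shows "\<exists>g\<in>vgrp \<G> (head (base \<G>) a). \<forall>y\<in>aset \<G> a. g (f y) = f' (h y)"
proof -
  let ?Y = "aset \<G> a" and ?v = "head (base \<G>) a"
  obtain k where k: "k \<in> vgrp \<G> ?v" "\<And>y. y \<in> ?Y \<Longrightarrow> f y = k (emb \<G> a (s y))"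
    and s: "bij_betw s ?Y ?Y"
    using p by (auto simp: parallel_def)
  obtain k' where k': "k' \<in> vgrp \<G> ?v" "\<And>y. y \<in> ?Y \<Longrightarrow> f' y = k' (emb \<G> a (s' y))"
    using p by (auto simp: parallel_def)
  note V = vgrpD[OF base_head[OF a]]
  obtain l where l: "l \<in> vgrp \<G> ?v" "\<And>x. x \<in> vset \<G> ?v \<Longrightarrow> l (k x) = x" using V(4)[OF k(1)] by blast
  obtain d where d: "d \<in> vgrp \<G> ?v" "\<And>y. y \<in> ?Y \<Longrightarrow> d (emb \<G> a y) = emb \<G> a (c y)"
    using emb_extend[OF a c(1)] by blast
  let ?g = "compose (vset \<G> ?v) k' (compose (vset \<G> ?v) d l)"
  have "?g (f y) = f' (h y)" if y: "y \<in> ?Y" for y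
  proof -
    have m: "s y \<in> ?Y" "h y \<in> ?Y" using y s h by (auto simp: bij_betw_def)
    have "?g (f y) = k' (d (l (f y)))" using parallel_into[OF a p(1) y] by (simp add: compose_eq)
    also have "\<dots> = k' (emb \<G> a (c (s y)))" using k(2)[OF y] l(2) emb_into[OF a m(1)] d(2)[OF m(1)]
      by simp
    also have "\<dots> = f' (h y)" using k'(2)[OF m(2)] c(2)[OF y] by simp
    finally show ?thesis .
  qed
  then show ?thesis using V(3) k'(1) d(1) l(1) by blast
qed

section \<open>Inversion agents and the two ends of an arc\<close>

lemma agent_conj:
  assumes a: "a \<in> arcs (base \<G>)" "base_rev \<G> a = a"
  shows "k \<in> agrp \<G> a \<Longrightarrow> \<exists>l\<in>agrp \<G> a. \<forall>y\<in>aset \<G> a. agent \<G> a (k y) = l (agent \<G> a y)"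
    and "l \<in> agrp \<G> a \<Longrightarrow> \<exists>k\<in>agrp \<G> a. \<forall>y\<in>aset \<G> a. agent \<G> a (k y) = l (agent \<G> a y)"
    and "\<exists>k\<in>agrp \<G> a. \<forall>y\<in>aset \<G> a. agent \<G> a (agent \<G> a y) = k y"
    and "bij_betw (agent \<G> a) (aset \<G> a) (aset \<G> a)"
proof -
  let ?Y = "aset \<G> a" and ?t = "agent \<G> a"
  interpret B: group "BijGroup ?Y" by (rule group_BijGroup)
  have t: "?t \<in> carrier (BijGroup ?Y)"
    and conj: "{?t \<otimes>\<^bsub>BijGroup ?Y\<^esub> h \<otimes>\<^bsub>BijGroup ?Y\<^esub> inv\<^bsub>BijGroup ?Y\<^esub> ?t | h. h \<in> agrp \<G> a} = agrp \<G> a"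
    and sq: "?t \<otimes>\<^bsub>BijGroup ?Y\<^esub> ?t \<in> agrp \<G> a"
    using inversion_agent[OF a] by auto
  have sub: "agrp \<G> a \<subseteq> carrier (BijGroup ?Y)" using subgroup.subset[OF agrp_subgroup[OF a(1)]] .
  have pw: "(f \<otimes>\<^bsub>BijGroup ?Y\<^esub> g) y = f (g y)"
    if "f \<in> carrier (BijGroup ?Y)" "g \<in> carrier (BijGroup ?Y)" "y \<in> ?Y" for f g y
    using that by (simp add: BijGroup_def compose_eq)
  \<comment> \<open>From l = tkt^-1 follows lt = tk. Both inclusions between tH(a) and H(a)t come
    from this identity.\<close>
  have *: "?t (k y) = l (?t y)"
    if "k \<in> agrp \<G> a" "l = ?t \<otimes>\<^bsub>BijGroup ?Y\<^esub> k \<otimes>\<^bsub>BijGroup ?Y\<^esub> inv\<^bsub>BijGroup ?Y\<^esub> ?t" "y \<in> ?Y"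
      for k l y
  proof -
    have k: "k \<in> carrier (BijGroup ?Y)" using that sub by blast
    then have l: "l \<in> carrier (BijGroup ?Y)" using that t by simp
    have "l \<otimes>\<^bsub>BijGroup ?Y\<^esub> ?t = ?t \<otimes>\<^bsub>BijGroup ?Y\<^esub> k" using that k t by (simp add: B.m_assoc)
    then show ?thesis using pw[OF l t that(3)] pw[OF t k that(3)] by simp
  qed
  show "\<exists>l\<in>agrp \<G> a. \<forall>y\<in>?Y. ?t (k y) = l (?t y)" if "k \<in> agrp \<G> a" for k
    using that conj *[OF that refl] by blast
  show "\<exists>k\<in>agrp \<G> a. \<forall>y\<in>?Y. ?t (k y) = l (?t y)" if l: "l \<in> agrp \<G> a" for l
  proof -
    obtain k where "k \<in> agrp \<G> a" "l = ?t \<otimes>\<^bsub>BijGroup ?Y\<^esub> k \<otimes>\<^bsub>BijGroup ?Y\<^esub> inv\<^bsub>BijGroup ?Y\<^esub> ?t"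
      using l conj by (smt (verit) mem_Collect_eq)
    then show ?thesis using * by blast
  qed
  show "\<exists>k\<in>agrp \<G> a. \<forall>y\<in>?Y. ?t (?t y) = k y"
    using sq pw[OF t t] by metis
  show "bij_betw ?t ?Y ?Y" using t by (simp add: BijGroup_def Bij_def)
qed

text \<open>Write t for the agent and H for H(a). The first equivalence is tH = Ht with t cancelled;
  the second also uses t^2 in H. They translate a condition on \<open>h\<close> at one end of a
  self-reverse arc into the condition at the other end.\<close>

lemma agent_swap:
  assumes a: "a \<in> arcs (base \<G>)" "base_rev \<G> a = a"
    and h: "bij_betw h (aset \<G> a) (aset \<G> a)"
  shows "(\<exists>k\<in>agrp \<G> a. \<forall>y\<in>aset \<G> a. agent \<G> a (h y) = k (agent \<G> a y)) \<longleftrightarrow>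
      (\<exists>k\<in>agrp \<G> a. \<forall>y\<in>aset \<G> a. h y = k y)" (is "?A \<longleftrightarrow> ?B")
    and "(\<exists>k\<in>agrp \<G> a. \<forall>y\<in>aset \<G> a. h y = k (agent \<G> a y)) \<longleftrightarrow>
      (\<exists>k\<in>agrp \<G> a. \<forall>y\<in>aset \<G> a. agent \<G> a (h y) = k y)" (is "?C \<longleftrightarrow> ?D")
proof -
  let ?Y = "aset \<G> a" and ?t = "agent \<G> a"
  note H = agrpD[OF a(1)]
  have t: "?t y \<in> ?Y" if "y \<in> ?Y" for y using agent_conj(4)[OF a] that by (auto simp: bij_betw_def)
  have ti: "y = z" if "?t y = ?t z" "y \<in> ?Y" "z \<in> ?Y" for y z
    using agent_conj(4)[OF a] that by (auto simp: bij_betw_def inj_on_def)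
  have hm: "h y \<in> ?Y" if "y \<in> ?Y" for y using h that by (auto simp: bij_betw_def)
  have km: "k y \<in> ?Y" if "k \<in> agrp \<G> a" "y \<in> ?Y" for k y using H(1)[OF that(1)] that
    by (auto simp: bij_betw_def)
  show "?A \<longleftrightarrow> ?B"
  proof
    assume ?A
    then obtain k where k: "k \<in> agrp \<G> a" "\<And>y. y \<in> ?Y \<Longrightarrow> ?t (h y) = k (?t y)" by blast
    obtain l where l: "l \<in> agrp \<G> a" "\<And>y. y \<in> ?Y \<Longrightarrow> ?t (l y) = k (?t y)"
      using agent_conj(2)[OF a k(1)] by blast
    have "h y = l y" if y: "y \<in> ?Y" for y
      by (rule ti) (simp_all add: k(2)[OF y] l(2)[OF y] hm[OF y] km[OF l(1) y])
    with l(1) show ?B by blast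
  next
    assume ?B
    then obtain k where k: "k \<in> agrp \<G> a" "\<And>y. y \<in> ?Y \<Longrightarrow> h y = k y" by blast
    with agent_conj(1)[OF a k(1)] show ?A by auto
  qed
  obtain q where q: "q \<in> agrp \<G> a" "\<And>y. y \<in> ?Y \<Longrightarrow> ?t (?t y) = q y" using agent_conj(3)[OF a] by blast
  show "?C \<longleftrightarrow> ?D"
  proof
    assume ?C
    then obtain k where k: "k \<in> agrp \<G> a" "\<And>y. y \<in> ?Y \<Longrightarrow> h y = k (?t y)" by blast
    obtain l where l: "l \<in> agrp \<G> a" "\<And>y. y \<in> ?Y \<Longrightarrow> ?t (k y) = l (?t y)"
      using agent_conj(1)[OF a k(1)] by blast
    have "?t (h y) = compose ?Y l q y" if "y \<in> ?Y" for y
      using k(2) l(2) q(2) t that by (simp add: compose_eq)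
    then show ?D using H(3)[OF l(1) q(1)] by (intro bexI[of _ "compose ?Y l q"]) auto
  next
    assume ?D
    then obtain k where k: "k \<in> agrp \<G> a" "\<And>y. y \<in> ?Y \<Longrightarrow> ?t (h y) = k y" by blast
    obtain l where l: "l \<in> agrp \<G> a" "\<And>y. y \<in> ?Y \<Longrightarrow> ?t (k y) = l (?t y)"
      using agent_conj(1)[OF a k(1)] by blast
    obtain q' where q': "q' \<in> agrp \<G> a" "\<And>y. y \<in> ?Y \<Longrightarrow> q' (q y) = y" using H(4)[OF q(1)] by blast
    have "h y = compose ?Y q' l (?t y)" if y: "y \<in> ?Y" for y
    proof -
      have "q (h y) = l (?t y)" using q(2)[OF hm[OF y]] k(2)[OF y] l(2)[OF y] by simp
      then show ?thesis using q'(2)[OF hm[OF y]] t[OF y] by (simp add: compose_eq)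
    qed
    then show ?C using H(3)[OF q'(1) l(1)] by (intro bexI[of _ "compose ?Y q' l"]) auto
  qed
qed

lemma adhesion_pair_parallel:
  assumes "a \<in> arcs (base \<G>)" "adhesion_pair \<G> a f f'"
  shows "\<exists>s. parallel a s f"
  using assms parallel_adhesion_map parallel_twisted_adhesion_map
  by (fastforce simp: adhesion_pair_def split: if_splits)

text \<open>The coupling between the two ends of an arc: the same \<open>h\<close> is realised at
  the terminus of the reverse. If \<open>a\<close> is not self-reverse, \<open>h\<close> agrees with
  an element of H(a), which is also the group of the reverse arc and extends through its
  embedding.\<close>

lemma adhesion_pair_transfer:
  assumes a: "a \<in> arcs (base \<G>)" and p: "adhesion_pair \<G> a f1 f1'" "adhesion_pair \<G> a f2 f2'"
    and g: "g \<in> vgrp \<G> (head (base \<G>) a)" and h: "bij_betw h (aset \<G> a) (aset \<G> a)"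
    and eq: "\<And>y. y \<in> aset \<G> a \<Longrightarrow> g (f1 y) = f2 (h y)"
  shows "\<exists>g\<in>vgrp \<G> (head (base \<G>) (base_rev \<G> a)). \<forall>y\<in>aset \<G> a. g (f1' y) = f2' (h y)"
proof (cases "base_rev \<G> a = a")
  case False
  have "\<exists>k\<in>agrp \<G> a. \<forall>y\<in>aset \<G> a. h y = k y"
    by (rule parallel_cancel[where f = f1 and f' = f2, OF a _ _ g h])
      (use p False eq in \<open>auto simp: adhesion_pair_def intro: parallel_adhesion_map\<close>)
  then obtain k where "k \<in> agrp \<G> (base_rev \<G> a)" "\<And>y. y \<in> aset \<G> (base_rev \<G> a) \<Longrightarrow> h y = k y"
    using arc_action_rev[OF a] by auto
  then have "\<exists>g\<in>vgrp \<G> (head (base \<G>) (base_rev \<G> a)). \<forall>y\<in>aset \<G> (base_rev \<G> a). g (f1' y) = f2' (h y)"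
    using p False h arc_action_rev[OF a] arc_graph_simps(1)[OF a]
    by (intro parallel_extend) (auto simp: adhesion_pair_def intro: parallel_adhesion_map)
  then show ?thesis using arc_action_rev[OF a] by simp
next
  case True
  note tw = parallel_twisted_adhesion_map[OF a True] and ad = parallel_adhesion_map
  have *: "\<exists>g\<in>vgrp \<G> (head (base \<G>) (base_rev \<G> a)). \<forall>y\<in>aset \<G> a. g (f1' y) = f2' (h y)"
    if s: "parallel a s1 f1" "parallel a s2 f2" "parallel a s1' f1'" "parallel a s2' f2'"
      and imp: "(\<exists>k\<in>agrp \<G> a. \<forall>y\<in>aset \<G> a. s2 (h y) = k (s1 y)) \<Longrightarrow>
        (\<exists>k\<in>agrp \<G> a. \<forall>y\<in>aset \<G> a. s2' (h y) = k (s1' y))" for s1 s2 s1' s2'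
    using imp[OF parallel_cancel[OF a s(1,2) g h eq]] parallel_extend[OF a s(3,4) h] True by auto
  note sw = agent_swap[OF a True h]
  consider "parallel a (\<lambda>y. y) f1 \<and> parallel a (agent \<G> a) f1'" | "parallel a (agent \<G> a) f1 \<and>
      parallel a (\<lambda>y. y) f1'"
    using p(1) True by (auto simp: adhesion_pair_def dest: tw ad)
  moreover consider "parallel a (\<lambda>y. y) f2 \<and>
      parallel a (agent \<G> a) f2'" | "parallel a (agent \<G> a) f2 \<and> parallel a (\<lambda>y. y) f2'"
    using p(2) True by (auto simp: adhesion_pair_def dest: tw ad)
  \<comment> \<open>Four combinations of which map of each pair is twisted.
    \<open>parallel_cancel\<close> yields \<open>s2 h\<close> in H(a)\<open>s1\<close>, whereas
    \<open>s2' h\<close> in H(a)\<open>s1'\<close> is wanted; in each combination this is one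
    direction of one of the equivalences in \<open>agent_swap\<close>.\<close>
  ultimately show ?thesis
    using *[of "\<lambda>y. y" "\<lambda>y. y" "agent \<G> a" "agent \<G> a"]
      *[of "\<lambda>y. y" "agent \<G> a" "agent \<G> a" "\<lambda>y. y"]
      *[of "agent \<G> a" "\<lambda>y. y" "\<lambda>y. y" "agent \<G> a"]
      *[of "agent \<G> a" "agent \<G> a" "\<lambda>y. y" "\<lambda>y. y"] sw
    by argo
qed

end

section \<open>Trees of adhesion maps\<close>

text \<open>What remains of a scaffolding when the graph \<open>\<Sigma>\<close> is forgotten and only the tree, \<open>\<pi>\<close> and the
  maps \<open>\<Psi>\<^sub>A\<close> are kept. In \<open>adhesion_iso\<close> below, \<open>g C\<close> and \<open>h A\<close> stand for the maps
  \<open>X(\<pi>(C)) \<Rightarrow> X(\<pi>(C))\<close> and \<open>Y(\<pi>(A)) \<Rightarrow> Y(\<pi>(A))\<close> that an automorphism of \<open>\<Sigma>\<close> induces via \<open>p\<close>.\<close>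

record ('w, 'e, 'v, 'a, 'x, 'y) adhesion_tree =
  atree :: "('w, 'e) pre_digraph"
  atree_rev :: "'e \<Rightarrow> 'e"
  vtype :: "'w \<Rightarrow> 'v"
  atype :: "'e \<Rightarrow> 'a"
  amap :: "'e \<Rightarrow> 'y \<Rightarrow> 'x"

definition adhesion_model ::
  "('v, 'a, 'x, 'y) gga_data \<Rightarrow> ('w, 'e, 'v, 'a, 'x, 'y) adhesion_tree \<Rightarrow> bool" where
  "adhesion_model \<G> M \<longleftrightarrow> is_tree (atree M) (atree_rev M) \<and>
    graph_hom (atree M) (atree_rev M) (base \<G>) (base_rev \<G>) (vtype M) (atype M) \<and>
    (\<forall>A\<in>arcs (atree M). adhesion_pair \<G> (atype M A) (amap M A) (amap M (atree_rev M A))) \<and>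
    (\<forall>C\<in>verts (atree M). \<forall>b\<in>arcs (base \<G>). \<forall>S\<in>adhesion_sets \<G> b.
      head (base \<G>) b = vtype M C \<longrightarrow>
      (\<exists>!A. A \<in> arcs (atree M) \<and> head (atree M) A = C \<and> atype M A = b \<and> amap M A ` aset \<G> b = S))"

definition adhesion_iso ::
  "('v, 'a, 'x, 'y) gga_data \<Rightarrow> ('w, 'e, 'v, 'a, 'x, 'y) adhesion_tree \<Rightarrow>
    ('w2, 'e2, 'v, 'a, 'x, 'y) adhesion_tree \<Rightarrow> ('w \<Rightarrow> 'w2) \<Rightarrow> ('e \<Rightarrow> 'e2) \<Rightarrow> bool" where
  "adhesion_iso \<G> M N fV fA \<longleftrightarrow>
    graph_iso (atree M) (atree_rev M) (atree N) (atree_rev N) fV fA \<and>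
    (\<forall>C\<in>verts (atree M). vtype N (fV C) = vtype M C) \<and>
    (\<forall>A\<in>arcs (atree M). atype N (fA A) = atype M A) \<and>
    (\<exists>g h. (\<forall>C\<in>verts (atree M). g C \<in> vgrp \<G> (vtype M C)) \<and>
      (\<forall>A\<in>arcs (atree M). bij_betw (h A) (aset \<G> (atype M A)) (aset \<G> (atype M A)) \<and>
        (\<forall>y\<in>aset \<G> (atype M A). h (atree_rev M A) y = h A y \<and>
          g (head (atree M) A) (amap M A y) = amap N (fA A) (h A y))))"

text \<open>Membership in \<open>Bij\<close> makes the maps extensional, so that this group can be
  literally equal to \<open>induced_tree_group\<close>.\<close>

definition adhesion_auts ::
  "('v, 'a, 'x, 'y) gga_data \<Rightarrow> ('w, 'e, 'v, 'a, 'x, 'y) adhesion_tree \<Rightarrow>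
    (('w \<Rightarrow> 'w) \<times> ('e \<Rightarrow> 'e)) monoid" where
  "adhesion_auts \<G> M = (BijGroup (verts (atree M)) \<times>\<times> BijGroup (arcs (atree M)))
    \<lparr>carrier := {(fV, fA). fV \<in> Bij (verts (atree M)) \<and> fA \<in> Bij (arcs (atree M)) \<and>
      adhesion_iso \<G> M M fV fA}\<rparr>"

section \<open>Composition and inversion of isomorphisms of adhesion trees\<close>

lemma graph_hom_cong:
  assumes "arc_graph T r" "\<And>v. v \<in> verts T \<Longrightarrow> fV v = gV v" "\<And>a. a \<in> arcs T \<Longrightarrow> fA a = gA a"
  shows "graph_hom T r T' r' fV fA \<longleftrightarrow> graph_hom T r T' r' gV gA"
proof -
  interpret arc_graph T r by fact
  have "fV ` verts T = gV ` verts T" "fA ` arcs T = gA ` arcs T" using assms(2,3) by auto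
  then show ?thesis using assms(2,3) rev_in_arcs by (auto simp: graph_hom_def)
qed

lemma graph_iso_cong:
  assumes "arc_graph T r" "\<And>v. v \<in> verts T \<Longrightarrow> fV v = gV v" "\<And>a. a \<in> arcs T \<Longrightarrow> fA a = gA a"
  shows "graph_iso T r T' r' fV fA \<longleftrightarrow> graph_iso T r T' r' gV gA"
proof -
  have "graph_hom T r T' r' fV fA \<longleftrightarrow> graph_hom T r T' r' gV gA"
    by (rule graph_hom_cong) (simp_all add: assms)
  moreover have "bij_betw fV (verts T) (verts T') \<longleftrightarrow> bij_betw gV (verts T) (verts T')"
    by (rule bij_betw_cong) (simp add: assms)
  moreover have "bij_betw fA (arcs T) (arcs T') \<longleftrightarrow> bij_betw gA (arcs T) (arcs T')"
    by (rule bij_betw_cong) (simp add: assms)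
  ultimately show ?thesis by (simp add: graph_iso_def)
qed

text \<open>Values off the tree are immaterial, which allows restricted maps such as conjugates to
  be replaced by plain compositions.\<close>

lemma adhesion_iso_cong:
  assumes "arc_graph (atree M) (atree_rev M)"
    and "\<And>v. v \<in> verts (atree M) \<Longrightarrow> fV v = gV v" "\<And>a. a \<in> arcs (atree M) \<Longrightarrow> fA a = gA a"
  shows "adhesion_iso \<G> M N fV fA \<longleftrightarrow> adhesion_iso \<G> M N gV gA"
proof -
  have "graph_iso (atree M) (atree_rev M) (atree N) (atree_rev N) fV fA \<longleftrightarrow>
      graph_iso (atree M) (atree_rev M) (atree N) (atree_rev N) gV gA"
    by (rule graph_iso_cong) (simp_all add: assms)
  then show ?thesis using assms(2,3) by (simp add: adhesion_iso_def cong: ball_cong)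
qed

lemma graph_iso_comp:
  assumes "arc_graph T r" "graph_iso T r T' r' fV fA" "graph_iso T' r' T'' r'' gV gA"
  shows "graph_iso T r T'' r'' (gV \<circ> fV) (gA \<circ> fA)"
proof -
  have "graph_hom T r T'' r'' (gV \<circ> fV) (gA \<circ> fA)"
    using assms(2,3) by (auto simp: graph_iso_def graph_hom_def image_subset_iff)
  then show ?thesis using assms(2,3) by (auto simp: graph_iso_def intro: bij_betw_trans)
qed

lemma graph_iso_inv:
  assumes "arc_graph T r" "arc_graph T' r'" "graph_iso T r T' r' fV fA"
  shows "graph_iso T' r' T r (inv_into (verts T) fV) (inv_into (arcs T) fA)"
proof -
  interpret T: arc_graph T r by fact
  have f: "bij_betw fV (verts T) (verts T')" "bij_betw fA (arcs T) (arcs T')"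
    "graph_hom T r T' r' fV fA"
    using assms(3) by (auto simp: graph_iso_def)
  then have b: "bij_betw (inv_into (verts T) fV) (verts T') (verts T)"
    "bij_betw (inv_into (arcs T) fA) (arcs T') (arcs T)" by (simp_all add: bij_betw_inv_into)
  have *: "tail T a = inv_into (verts T) fV (tail T' (fA a)) \<and>
      head T a = inv_into (verts T) fV (head T' (fA a)) \<and>
      inv_into (arcs T) fA (r' (fA a)) = r a" if a: "a \<in> arcs T" for a
  proof -
    have "tail T' (fA a) = fV (tail T a)" "head T' (fA a) = fV (head T a)" "r' (fA a) = fA (r a)"
      using f(3) a by (auto simp: graph_hom_def)
    then show ?thesis
      using a T.rev_in_arcs[OF a] bij_betw_inv_into_left[OF f(1)] bij_betw_inv_into_left[OF f(2)]
      by simp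
  qed
  have "tail T (inv_into (arcs T) fA a') = inv_into (verts T) fV (tail T' a') \<and>
      head T (inv_into (arcs T) fA a') = inv_into (verts T) fV (head T' a') \<and>
      inv_into (arcs T) fA (r' a') = r (inv_into (arcs T) fA a')" if a': "a' \<in> arcs T'" for a'
  proof -
    obtain a where "a \<in> arcs T" "a' = fA a" using a' f(2) by (auto simp: bij_betw_def)
    then show ?thesis using * bij_betw_inv_into_left[OF f(2)] by simp
  qed
  with b show ?thesis by (auto simp: graph_iso_def graph_hom_def bij_betw_def)
qed

context gga
begin

lemma adhesion_modelD:
  assumes "adhesion_model \<G> M"
  shows "arc_tree (atree M) (atree_rev M)"
    and "A \<in> arcs (atree M) \<Longrightarrow> atype M A \<in> arcs (base \<G>)"
    and "C \<in> verts (atree M) \<Longrightarrow> vtype M C \<in> verts (base \<G>)"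
    and "A \<in> arcs (atree M) \<Longrightarrow> vtype M (head (atree M) A) = head (base \<G>) (atype M A)"
    and "A \<in> arcs (atree M) \<Longrightarrow> vtype M (tail (atree M) A) = tail (base \<G>) (atype M A)"
    and "A \<in> arcs (atree M) \<Longrightarrow> atype M (atree_rev M A) = base_rev \<G> (atype M A)"
    and "A \<in> arcs (atree M) \<Longrightarrow>
      adhesion_pair \<G> (atype M A) (amap M A) (amap M (atree_rev M A))"
  using assms by (auto simp: adhesion_model_def graph_hom_def intro: arc_treeI)

lemma amap_into:
  assumes "adhesion_model \<G> M" "A \<in> arcs (atree M)" "y \<in> aset \<G> (atype M A)"
  shows "amap M A y \<in> vset \<G> (vtype M (head (atree M) A))"
  using adhesion_pair_parallel[OF adhesion_modelD(2,7)[OF assms(1,2)]] parallel_into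
    adhesion_modelD(2,4)[OF assms(1,2)] assms(3) by metis

lemma amap_inj:
  assumes "adhesion_model \<G> M" "A \<in> arcs (atree M)"
  shows "inj_on (amap M A) (aset \<G> (atype M A))"
  using adhesion_pair_parallel[OF adhesion_modelD(2,7)[OF assms]] parallel_inj
    adhesion_modelD(2)[OF assms] by metis

lemma amap_image:
  assumes "adhesion_model \<G> M" "A \<in> arcs (atree M)" "g \<in> vgrp \<G> (vtype M (head (atree M) A))"
  shows "g ` amap M A ` aset \<G> (atype M A) \<in> adhesion_sets \<G> (atype M A)"
  using adhesion_pair_parallel[OF adhesion_modelD(2,7)[OF assms(1,2)]] parallel_image
    adhesion_modelD(2,4)[OF assms(1,2)] assms(3) by metis

lemma amap_image_adhesion_set:
  assumes M: "adhesion_model \<G> M" and A: "A \<in> arcs (atree M)"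
  shows "amap M A ` aset \<G> (atype M A) \<in> adhesion_sets \<G> (atype M A)"
proof -
  have "vtype M (head (atree M) A) \<in> verts (base \<G>)"
    using adhesion_modelD(2,4)[OF M A] by simp
  then have "(\<lambda>x\<in>vset \<G> (vtype M (head (atree M) A)). x) ` amap M A ` aset \<G> (atype M A)
      \<in> adhesion_sets \<G> (atype M A)"
    using amap_image[OF M A] vgrpD(2) by blast
  moreover have "(\<lambda>x\<in>vset \<G> (vtype M (head (atree M) A)). x) ` amap M A ` aset \<G> (atype M A)
      = amap M A ` aset \<G> (atype M A)"
    using amap_into[OF M A] by (auto simp: image_iff)
  ultimately show ?thesis by simp
qed

lemma adhesion_model_arc:
  assumes "adhesion_model \<G> M" "C \<in> verts (atree M)" "b \<in> arcs (base \<G>)" "S \<in> adhesion_sets \<G> b"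
    and "head (base \<G>) b = vtype M C"
  shows "\<exists>A\<in>arcs (atree M). head (atree M) A = C \<and> atype M A = b \<and> amap M A ` aset \<G> b = S"
proof -
  have "\<exists>!A. A \<in> arcs (atree M) \<and> head (atree M) A = C \<and> atype M A = b \<and> amap M A ` aset \<G> b = S"
    using assms unfolding adhesion_model_def by simp
  then show ?thesis by blast
qed

text \<open>The uniqueness half of the local condition in \<open>adhesion_model\<close>, in the form
  used whenever two constructed arcs have to coincide.\<close>

lemma adhesion_model_arc_unique:
  assumes M: "adhesion_model \<G> M" and "A \<in> arcs (atree M)" "B \<in> arcs (atree M)"
    and "head (atree M) A = head (atree M) B" "atype M A = atype M B"
    and "amap M A ` aset \<G> (atype M A) = amap M B ` aset \<G> (atype M A)"
  shows "A = B"
proof -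
  interpret arc_tree "atree M" "atree_rev M" using M by (rule adhesion_modelD)
  let ?b = "atype M A" and ?C = "head (atree M) A"
  have "amap M A ` aset \<G> ?b \<in> adhesion_sets \<G> ?b" by (rule amap_image_adhesion_set[OF M assms(2)])
  moreover have "?b \<in> arcs (base \<G>)" "head (base \<G>) ?b = vtype M ?C" "?C \<in> verts (atree M)"
    using adhesion_modelD(2,4)[OF M assms(2)] assms(2) by auto
  ultimately have "\<exists>!D. D \<in> arcs (atree M) \<and> head (atree M) D = ?C \<and> atype M D = ?b \<and>
      amap M D ` aset \<G> ?b = amap M A ` aset \<G> ?b"
    using M unfolding adhesion_model_def by auto
  then show ?thesis using assms(2-) by metis
qed

lemma adhesion_iso_comp:
  assumes M: "adhesion_model \<G> M" and "adhesion_iso \<G> M N fV fA" "adhesion_iso \<G> N P gV gA"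
  shows "adhesion_iso \<G> M P (gV \<circ> fV) (gA \<circ> fA)"
proof -
  interpret arc_tree "atree M" "atree_rev M" using M by (rule adhesion_modelD)
  have iso: "graph_iso (atree M) (atree_rev M) (atree N) (atree_rev N) fV fA"
    "graph_iso (atree N) (atree_rev N) (atree P) (atree_rev P) gV gA"
    using assms(2,3) by (auto simp: adhesion_iso_def)
  have f: "fV C \<in> verts (atree N)" "vtype N (fV C) = vtype M C" if "C \<in> verts (atree M)" for C
    using assms(2) that by (auto simp: adhesion_iso_def graph_iso_def graph_hom_def)
  have fA: "fA A \<in> arcs (atree N)" "atype N (fA A) = atype M A"
    "head (atree N) (fA A) = fV (head (atree M) A)" "fA (atree_rev M A) = atree_rev N (fA A)"
    if "A \<in> arcs (atree M)" for A
    using assms(2) that by (auto simp: adhesion_iso_def graph_iso_def graph_hom_def)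
  obtain g h where gh: "\<And>C. C \<in> verts (atree M) \<Longrightarrow> g C \<in> vgrp \<G> (vtype M C)"
    "\<And>A. A \<in> arcs (atree M) \<Longrightarrow> bij_betw (h A) (aset \<G> (atype M A)) (aset \<G> (atype M A))"
    "\<And>A y. A \<in> arcs (atree M) \<Longrightarrow> y \<in> aset \<G> (atype M A) \<Longrightarrow> h (atree_rev M A) y = h A y \<and>
          g (head (atree M) A) (amap M A y) = amap N (fA A) (h A y)"
    using assms(2) unfolding adhesion_iso_def by blast
  obtain g' h' where gh': "\<And>C. C \<in> verts (atree N) \<Longrightarrow> g' C \<in> vgrp \<G> (vtype N C)"
    "\<And>A. A \<in> arcs (atree N) \<Longrightarrow> bij_betw (h' A) (aset \<G> (atype N A)) (aset \<G> (atype N A))"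
    "\<And>A y. A \<in> arcs (atree N) \<Longrightarrow> y \<in> aset \<G> (atype N A) \<Longrightarrow> h' (atree_rev N A) y = h' A y \<and>
          g' (head (atree N) A) (amap N A y) = amap P (gA A) (h' A y)"
    using assms(3) unfolding adhesion_iso_def by blast
  define k where "k C = compose (vset \<G> (vtype M C)) (g' (fV C)) (g C)" for C
  define l where "l A = h' (fA A) \<circ> h A" for A
  have "k C \<in> vgrp \<G> (vtype M C)" if "C \<in> verts (atree M)" for C
    unfolding k_def using vgrpD(3)[OF adhesion_modelD(3)[OF M that]] gh(1)[OF that] gh'(1) f[OF that] by metis
  moreover have "bij_betw (l A) (aset \<G> (atype M A)) (aset \<G> (atype M A)) \<and>
      (\<forall>y\<in>aset \<G> (atype M A). l (atree_rev M A) y = l A y \<and>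
        k (head (atree M) A) (amap M A y) = amap P ((gA \<circ> fA) A) (l A y))"
    if A: "A \<in> arcs (atree M)" for A
  proof (intro conjI ballI)
    show "bij_betw (l A) (aset \<G> (atype M A)) (aset \<G> (atype M A))"
      using bij_betw_trans[OF gh(2)[OF A]] gh'(2)[OF fA(1)[OF A]] fA(2)[OF A] by (simp add: l_def)
    fix y assume y: "y \<in> aset \<G> (atype M A)"
    then have hy: "h A y \<in> aset \<G> (atype M A)" using gh(2)[OF A] by (auto simp: bij_betw_def)
    show "l (atree_rev M A) y = l A y"
      using gh(3)[OF A y] gh'(3)[OF fA(1)[OF A], of "h A y"] hy fA[OF A] by (simp add: l_def)
    show "k (head (atree M) A) (amap M A y) = amap P ((gA \<circ> fA) A) (l A y)"
      using gh(3)[OF A y] gh'(3)[OF fA(1)[OF A], of "h A y"] hy fA[OF A] amap_into[OF M A y]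
      by (simp add: l_def k_def compose_eq)
  qed
  moreover have "vtype P ((gV \<circ> fV) C) = vtype M C" if "C \<in> verts (atree M)" for C
    using assms(3) f[OF that] by (auto simp: adhesion_iso_def)
  moreover have "atype P ((gA \<circ> fA) A) = atype M A" if "A \<in> arcs (atree M)" for A
    using assms(3) fA[OF that] by (auto simp: adhesion_iso_def)
  ultimately show ?thesis using graph_iso_comp[OF arc_graph_axioms iso]
    unfolding adhesion_iso_def by blast
qed

lemma adhesion_iso_inv:
  assumes M: "adhesion_model \<G> M" and N: "adhesion_model \<G> N" and c: "adhesion_iso \<G> M N fV fA"
  shows "adhesion_iso \<G> N M (inv_into (verts (atree M)) fV) (inv_into (arcs (atree M)) fA)"
    (is "adhesion_iso \<G> N M ?fV ?fA")
proof -
  interpret M: arc_tree "atree M" "atree_rev M" using M by (rule adhesion_modelD)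
  interpret N: arc_tree "atree N" "atree_rev N" using N by (rule adhesion_modelD)
  have iso: "graph_iso (atree M) (atree_rev M) (atree N) (atree_rev N) fV fA"
    using c by (auto simp: adhesion_iso_def)
  note iso' = graph_iso_inv[OF M.arc_graph_axioms N.arc_graph_axioms iso]
  have fV: "vtype N (fV C) = vtype M C" if "C \<in> verts (atree M)" for C
    using c that by (auto simp: adhesion_iso_def)
  have fA: "atype N (fA A) = atype M A" if "A \<in> arcs (atree M)" for A
    using c that by (auto simp: adhesion_iso_def)
  have iV: "?fV C \<in> verts (atree M)" "fV (?fV C) = C" if "C \<in> verts (atree N)" for C
    using iso that by (auto simp: graph_iso_def bij_betw_def inv_into_into f_inv_into_f)
  have iA: "?fA A \<in> arcs (atree M)" "fA (?fA A) = A" if "A \<in> arcs (atree N)" for A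
    using iso that by (auto simp: graph_iso_def bij_betw_def inv_into_into f_inv_into_f)
  have iA': "head (atree M) (?fA A) = ?fV (head (atree N) A)"
    "?fA (atree_rev N A) = atree_rev M (?fA A)" if "A \<in> arcs (atree N)" for A
    using iso' that by (auto simp: graph_iso_def graph_hom_def)
  have tV: "vtype M (?fV C) = vtype N C" if "C \<in> verts (atree N)" for C
    using fV[OF iV(1)[OF that]] iV(2)[OF that] by simp
  have tA: "atype M (?fA A) = atype N A" if "A \<in> arcs (atree N)" for A
    using fA[OF iA(1)[OF that]] iA(2)[OF that] by simp
  obtain g h where gh: "\<And>C. C \<in> verts (atree M) \<Longrightarrow> g C \<in> vgrp \<G> (vtype M C)"
    "\<And>A. A \<in> arcs (atree M) \<Longrightarrow> bij_betw (h A) (aset \<G> (atype M A)) (aset \<G> (atype M A))"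
    "\<And>A y. A \<in> arcs (atree M) \<Longrightarrow> y \<in> aset \<G> (atype M A) \<Longrightarrow> h (atree_rev M A) y = h A y \<and>
          g (head (atree M) A) (amap M A y) = amap N (fA A) (h A y)"
    using c unfolding adhesion_iso_def by blast
  have "\<exists>k\<in>vgrp \<G> (vtype M C). \<forall>x\<in>vset \<G> (vtype M C). k (g C x) = x" if "C \<in> verts (atree M)" for C
    using vgrpD(4)[OF adhesion_modelD(3)[OF M that] gh(1)[OF that]] by blast
  then obtain k where k: "\<And>C. C \<in> verts (atree M) \<Longrightarrow> k C \<in> vgrp \<G> (vtype M C)"
    "\<And>C x. C \<in> verts (atree M) \<Longrightarrow> x \<in> vset \<G> (vtype M C) \<Longrightarrow> k C (g C x) = x"
    by metis
  define l where "l A = inv_into (aset \<G> (atype N A)) (h (?fA A))" for A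
  have "k (?fV C) \<in> vgrp \<G> (vtype N C)" if "C \<in> verts (atree N)" for C
    using k(1)[OF iV(1)[OF that]] tV[OF that] by simp
  moreover have "bij_betw (l A) (aset \<G> (atype N A)) (aset \<G> (atype N A)) \<and>
      (\<forall>y\<in>aset \<G> (atype N A). l (atree_rev N A) y = l A y \<and>
        k (?fV (head (atree N) A)) (amap N A y) = amap M (?fA A) (l A y))"
    if A: "A \<in> arcs (atree N)" for A
  proof (intro conjI ballI)
    let ?Y = "aset \<G> (atype N A)"
    have hb: "bij_betw (h (?fA A)) ?Y ?Y" using gh(2)[OF iA(1)[OF A]] tA[OF A] by simp
    then show lb: "bij_betw (l A) ?Y ?Y" by (simp add: l_def bij_betw_inv_into)
    fix y assume y: "y \<in> ?Y"
    have ly: "l A y \<in> ?Y" "h (?fA A) (l A y) = y"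
      using hb y by (auto simp: l_def bij_betw_def inv_into_into f_inv_into_f)
    have Y': "aset \<G> (atype N (atree_rev N A)) = ?Y"
      using arc_action_rev adhesion_modelD(2,6)[OF N A] by simp
    \<comment> \<open>Agreement on an arc and its reverse survives inversion: the permutation of the
      reverse arc also sends \<open>l A y\<close> to \<open>y\<close>, and it is injective.\<close>
    have "h (?fA (atree_rev N A)) (l A y) = y"
      using gh(3)[OF iA(1)[OF A], of "l A y"] ly tA[OF A] iA'(2)[OF A] by simp
    moreover have "bij_betw (h (?fA (atree_rev N A))) ?Y ?Y"
      using gh(2)[OF iA(1)[OF N.rev_in_arcs[OF A]]] tA[OF N.rev_in_arcs[OF A]] Y' by simp
    ultimately show "l (atree_rev N A) y = l A y"
      using ly(1) unfolding l_def Y' by (metis bij_betw_inv_into_left)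
    have "g (head (atree M) (?fA A)) (amap M (?fA A) (l A y)) = amap N A y"
      using gh(3)[OF iA(1)[OF A], of "l A y"] ly tA[OF A] iA(2)[OF A] by simp
    then show "k (?fV (head (atree N) A)) (amap N A y) = amap M (?fA A) (l A y)"
      using k(2)[of "head (atree M) (?fA A)"] amap_into[OF M iA(1)[OF A], of "l A y"] tA[OF A] ly(1)
        iA'(1)[OF A] iA(1)[OF A] M.head_in_verts[OF iA(1)[OF A]] by metis
  qed
  ultimately show ?thesis unfolding adhesion_iso_def using iso' tV tA
    by (intro conjI exI[of _ "\<lambda>C. k (?fV C)"] exI[of _ l]) simp_all
qed

end

section \<open>Conjugation of automorphism groups\<close>

text \<open>The restriction to \<open>Q\<close> keeps conjugates extensional, hence inside
  \<open>Bij Q\<close>.\<close>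

definition conjugate :: "('p \<Rightarrow> 'q) \<Rightarrow> 'p set \<Rightarrow> 'q set \<Rightarrow> ('p \<Rightarrow> 'p) \<Rightarrow> 'q \<Rightarrow> 'q" where
  "conjugate \<theta> P Q f = restrict (\<theta> \<circ> f \<circ> inv_into P \<theta>) Q"

lemma conjugate_apply: "bij_betw \<theta> P Q \<Longrightarrow> x \<in> P \<Longrightarrow> conjugate \<theta> P Q f (\<theta> x) = \<theta> (f x)"
  by (auto simp: conjugate_def bij_betw_def)

lemma conjugate_Bij: "bij_betw \<theta> P Q \<Longrightarrow> f \<in> Bij P \<Longrightarrow> conjugate \<theta> P Q f \<in> Bij Q"
  unfolding Bij_def conjugate_def
  by (auto intro!: bij_betw_trans[of "inv_into P \<theta>" Q P "\<theta> \<circ> f"] bij_betw_inv_into bij_betw_trans)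

lemma conjugate_compose:
  assumes "bij_betw \<theta> P Q" "f \<in> Bij P" "g \<in> Bij P"
  shows "conjugate \<theta> P Q (compose P f g) = compose Q (conjugate \<theta> P Q f) (conjugate \<theta> P Q g)"
proof
  fix x
  show "conjugate \<theta> P Q (compose P f g) x = compose Q (conjugate \<theta> P Q f) (conjugate \<theta> P Q g) x"
  proof (cases "x \<in> Q")
    case True
    then obtain z where z: "z \<in> P" "x = \<theta> z" using assms(1) by (auto simp: bij_betw_def)
    then have "g z \<in> P" using assms(3) by (auto simp: Bij_def bij_betw_def)
    then show ?thesis using True z conjugate_apply[OF assms(1)] by (simp add: compose_eq)
  qed (simp add: conjugate_def compose_def)
qed

lemma conjugate_inv:
  assumes "bij_betw \<theta> P Q" "f \<in> Bij P"
  shows "conjugate (inv_into P \<theta>) Q P (conjugate \<theta> P Q f) = f"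
proof
  fix x
  show "conjugate (inv_into P \<theta>) Q P (conjugate \<theta> P Q f) x = f x"
  proof (cases "x \<in> P")
    case True
    have "conjugate (inv_into P \<theta>) Q P (conjugate \<theta> P Q f) (inv_into P \<theta> (\<theta> x))
        = inv_into P \<theta> (conjugate \<theta> P Q f (\<theta> x))"
      using True assms(1) by (intro conjugate_apply bij_betw_inv_into) (auto simp: bij_betw_def)
    moreover have "f x \<in> P" using True assms(2) by (auto simp: Bij_def bij_betw_def)
    ultimately show ?thesis
      using True assms by (simp add: conjugate_apply bij_betw_inv_into_left)
  next
    case False
    then show ?thesis
      using assms(2) extensional_arb[of f P x] by (simp add: conjugate_def Bij_def)
  qed
qed

text \<open>Phrased with \<open>inv_into P \<theta>\<close> as in \<open>conjugate_inv\<close>, so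
  that the two lemmas together make conjugation by \<theta> and by its inverse mutually
  inverse.\<close>

lemma conjugate_inv_right:
  assumes "bij_betw \<theta> P Q" "f \<in> Bij Q"
  shows "conjugate \<theta> P Q (conjugate (inv_into P \<theta>) Q P f) = f"
proof
  fix x
  show "conjugate \<theta> P Q (conjugate (inv_into P \<theta>) Q P f) x = f x"
  proof (cases "x \<in> Q")
    case True
    then obtain z where z: "z \<in> P" "x = \<theta> z" using assms(1) by (auto simp: bij_betw_def)
    have "conjugate (inv_into P \<theta>) Q P f (inv_into P \<theta> x) = inv_into P \<theta> (f x)"
      using True assms(1) by (intro conjugate_apply bij_betw_inv_into)
    moreover have "f x \<in> Q" using True assms(2) by (auto simp: Bij_def bij_betw_def)
    moreover have "conjugate \<theta> P Q (conjugate (inv_into P \<theta>) Q P f) (\<theta> z)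
        = \<theta> (conjugate (inv_into P \<theta>) Q P f z)"
      using z(1) by (rule conjugate_apply[OF assms(1)])
    moreover have "inv_into P \<theta> x = z" using assms(1) z by (simp add: bij_betw_inv_into_left)
    ultimately show ?thesis
      using assms(1) z(2) by (simp add: bij_betw_inv_into_right)
  next
    case False
    then show ?thesis
      using assms(2) extensional_arb[of f Q x] by (simp add: conjugate_def Bij_def)
  qed
qed

text \<open>Being an \<open>adhesion_iso\<close> is stable under composition and inversion, so
  conjugation by one carries automorphisms to automorphisms in both directions.\<close>

lemma (in gga) adhesion_auts_isomorphic:
  assumes M: "adhesion_model \<G> M" and N: "adhesion_model \<G> N" and c: "adhesion_iso \<G> M N \<theta>V \<theta>A"
  shows "tree_actions_isomorphic (atree M) (atree_rev M) (adhesion_auts \<G> M)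
    (atree N) (atree_rev N) (adhesion_auts \<G> N)"
proof -
  interpret M: arc_tree "atree M" "atree_rev M" using M by (rule adhesion_modelD)
  interpret N: arc_tree "atree N" "atree_rev N" using N by (rule adhesion_modelD)
  let ?VM = "verts (atree M)" and ?VN = "verts (atree N)"
  let ?AM = "arcs (atree M)" and ?AN = "arcs (atree N)"
  let ?iV = "inv_into ?VM \<theta>V" and ?iA = "inv_into ?AM \<theta>A"
  have iso: "graph_iso (atree M) (atree_rev M) (atree N) (atree_rev N) \<theta>V \<theta>A"
    using c by (simp add: adhesion_iso_def)
  have bV: "bij_betw \<theta>V ?VM ?VN" and bA: "bij_betw \<theta>A ?AM ?AN"
    using iso by (simp_all add: graph_iso_def)
  note c' = adhesion_iso_inv[OF M N c]
  have car: "p \<in> carrier (adhesion_auts \<G> K) \<longleftrightarrow>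
      fst p \<in> Bij (verts (atree K)) \<and> snd p \<in> Bij (arcs (atree K)) \<and> adhesion_iso \<G> K K (fst p) (snd p)"
    for p and K :: "('k, 'l, 'v, 'a, 'x, 'y) adhesion_tree"
    by (auto simp: adhesion_auts_def)
  have mult: "p \<otimes>\<^bsub>adhesion_auts \<G> K\<^esub> q =
      (compose (verts (atree K)) (fst p) (fst q), compose (arcs (atree K)) (snd p) (snd q))"
    if "p \<in> carrier (adhesion_auts \<G> K)" "q \<in> carrier (adhesion_auts \<G> K)"
    for p q and K :: "('k, 'l, 'v, 'a, 'x, 'y) adhesion_tree"
    using that unfolding car by (simp add: adhesion_auts_def mult_DirProd' BijGroup_def)
  define \<phi> where "\<phi> p = (conjugate \<theta>V ?VM ?VN (fst p), conjugate \<theta>A ?AM ?AN (snd p))" for p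
  define \<psi> where "\<psi> p = (conjugate ?iV ?VN ?VM (fst p), conjugate ?iA ?AN ?AM (snd p))" for p
  have \<phi>: "\<phi> p \<in> carrier (adhesion_auts \<G> N)" if p: "p \<in> carrier (adhesion_auts \<G> M)" for p
  proof -
    have "adhesion_iso \<G> N N (\<theta>V \<circ> (fst p \<circ> ?iV)) (\<theta>A \<circ> (snd p \<circ> ?iA))"
      using p[unfolded car] by (intro adhesion_iso_comp[OF N adhesion_iso_comp[OF N c'] c]) simp
    then have "adhesion_iso \<G> N N (fst (\<phi> p)) (snd (\<phi> p))"
      by (subst adhesion_iso_cong[OF N.arc_graph_axioms]) (auto simp: \<phi>_def conjugate_def)
    then show ?thesis using p conjugate_Bij[OF bV] conjugate_Bij[OF bA]
      unfolding car by (simp add: \<phi>_def)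
  qed
  have \<psi>: "\<psi> p \<in> carrier (adhesion_auts \<G> M)" if p: "p \<in> carrier (adhesion_auts \<G> N)" for p
  proof -
    have "adhesion_iso \<G> M M (?iV \<circ> (fst p \<circ> \<theta>V)) (?iA \<circ> (snd p \<circ> \<theta>A))"
      using p[unfolded car] by (intro adhesion_iso_comp[OF M adhesion_iso_comp[OF M c] c']) simp
    then have "adhesion_iso \<G> M M (fst (\<psi> p)) (snd (\<psi> p))"
      using bV bA
      by (subst adhesion_iso_cong[OF M.arc_graph_axioms])
        (auto simp: \<psi>_def conjugate_def inv_into_inv_into_eq)
    then show ?thesis
      using p conjugate_Bij[OF bij_betw_inv_into[OF bV]] conjugate_Bij[OF bij_betw_inv_into[OF bA]]
      unfolding car by (simp add: \<psi>_def)
  qed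
  have "\<phi> (p \<otimes>\<^bsub>adhesion_auts \<G> M\<^esub> q) = \<phi> p \<otimes>\<^bsub>adhesion_auts \<G> N\<^esub> \<phi> q"
    if "p \<in> carrier (adhesion_auts \<G> M)" "q \<in> carrier (adhesion_auts \<G> M)" for p q
    using that[unfolded car] conjugate_compose[OF bV] conjugate_compose[OF bA]
    by (simp add: mult that \<phi>) (simp add: \<phi>_def)
  then have "\<phi> \<in> hom (adhesion_auts \<G> M) (adhesion_auts \<G> N)" using \<phi> by (auto simp: hom_def)
  moreover have "bij_betw \<phi> (carrier (adhesion_auts \<G> M)) (carrier (adhesion_auts \<G> N))"
  proof (rule bij_betw_byWitness[where f' = \<psi>])
    show "\<forall>p\<in>carrier (adhesion_auts \<G> M). \<psi> (\<phi> p) = p"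
      using conjugate_inv[OF bV] conjugate_inv[OF bA] by (simp add: car \<phi>_def \<psi>_def)
    show "\<forall>p\<in>carrier (adhesion_auts \<G> N). \<phi> (\<psi> p) = p"
      using conjugate_inv_right[OF bV] conjugate_inv_right[OF bA] by (simp add: car \<phi>_def \<psi>_def)
  qed (use \<phi> \<psi> in auto)
  ultimately have "\<phi> \<in> iso (adhesion_auts \<G> M) (adhesion_auts \<G> N)" by (simp add: iso_def)
  then show ?thesis unfolding tree_actions_isomorphic_def
    using iso conjugate_apply[OF bV] conjugate_apply[OF bA]
    by (intro exI[of _ \<theta>V] exI[of _ \<theta>A] exI[of _ \<phi>]) (simp add: \<phi>_def)
qed

section \<open>Uniqueness of the associated tree\<close>

context gga
begin

lemma adhesion_sets_nonempty: "a \<in> arcs (base \<G>) \<Longrightarrow> adhesion_sets \<G> a \<noteq> {}"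
  using vgrpD(2)[OF base_head] by (auto simp: adhesion_sets_def adhesion_maps_def)

text \<open>Supplies an image for the root. The local condition lifts arcs ending at a given vertex;
  to get from a vertex over the tail of \<open>a\<close> to one over its head, the reverse of
  \<open>a\<close> is lifted and the origin of the lift is taken.\<close>

lemma vtype_surj:
  assumes M: "adhesion_model \<G> M" and v: "v \<in> verts (base \<G>)"
  shows "\<exists>C\<in>verts (atree M). vtype M C = v"
proof -
  interpret M: arc_tree "atree M" "atree_rev M" using M by (rule adhesion_modelD)
  obtain C where C: "C \<in> verts (atree M)"
    using M.tree by (auto simp: is_tree_def connected_def strongly_connected_def mk_symmetric_def)
  from base_graph base_connected adhesion_modelD(3)[OF M C] v show ?thesis
  proof (induct rule: connected_induct)
    case base
    show ?case using C by blast
  next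
    case (arc a)
    then obtain D where D: "D \<in> verts (atree M)" "vtype M D = tail (base \<G>) a" by blast
    have "base_rev \<G> a \<in> arcs (base \<G>)" "head (base \<G>) (base_rev \<G> a) = tail (base \<G>) a"
      "tail (base \<G>) (base_rev \<G> a) = head (base \<G>) a"
      using arc_graph.tail_eq_head_rev[OF base_graph, of a]
        arc_graph.tail_eq_head_rev[OF base_graph, of "base_rev \<G> a"] arc_graph_simps[OF arc(1)]
        arc(1) by simp_all
    moreover from this obtain S where "S \<in> adhesion_sets \<G> (base_rev \<G> a)"
      using adhesion_sets_nonempty by blast
    ultimately obtain A where "A \<in> arcs (atree M)" "atype M A = base_rev \<G> a"
      using adhesion_model_arc[OF M D(1), of "base_rev \<G> a" S] D(2) by auto
    then show ?case
      using adhesion_modelD(5)[OF M] \<open>tail (base \<G>) (base_rev \<G> a) = head (base \<G>) a\<close>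
      by (metis M.tail_in_verts)
  qed
qed

text \<open>A state \<open>(D, g)\<close> over a vertex \<open>C\<close> of the first tree is a candidate for the image of \<open>C\<close> and
  for the permutation of \<open>X(\<pi>(C))\<close> attached to \<open>C\<close>; \<open>linked\<close> says that the states over the two
  ends of \<open>A\<close> fit together along \<open>A\<close>.\<close>

definition linked ::
  "('w, 'e, 'v, 'a, 'x, 'y) adhesion_tree \<Rightarrow> ('w2, 'e2, 'v, 'a, 'x, 'y) adhesion_tree \<Rightarrow> 'e \<Rightarrow>
    'w2 \<times> ('x \<Rightarrow> 'x) \<Rightarrow> 'w2 \<times> ('x \<Rightarrow> 'x) \<Rightarrow> 'e2 \<Rightarrow> ('y \<Rightarrow> 'y) \<Rightarrow> bool" where
  "linked M N A p q B h \<longleftrightarrow> B \<in> arcs (atree N) \<and> head (atree N) B = fst p \<and> tail (atree N) B = fst q \<and>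
    atype N B = atype M A \<and> bij_betw h (aset \<G> (atype M A)) (aset \<G> (atype M A)) \<and>
    (\<forall>y\<in>aset \<G> (atype M A). snd p (amap M A y) = amap N B (h y) \<and>
      snd q (amap M (atree_rev M A) y) = amap N (atree_rev N B) (h y))"

definition state_at :: "('w, 'e, 'v, 'a, 'x, 'y) adhesion_tree \<Rightarrow>
    ('w2, 'e2, 'v, 'a, 'x, 'y) adhesion_tree \<Rightarrow> 'w \<Rightarrow> 'w2 \<times> ('x \<Rightarrow> 'x) \<Rightarrow> bool" where
  "state_at M N C p \<longleftrightarrow> fst p \<in> verts (atree N) \<and> vtype N (fst p) = vtype M C \<and>
    snd p \<in> vgrp \<G> (vtype M C)"

text \<open>\<open>linked\<close> records the equations at both ends, so reversal merely swaps
  them.\<close>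

lemma linked_rev:
  assumes M: "adhesion_model \<G> M" and N: "adhesion_model \<G> N" and A: "A \<in> arcs (atree M)"
    and l: "linked M N A p q B h"
  shows "linked M N (atree_rev M A) q p (atree_rev N B) h"
proof -
  interpret M: arc_tree "atree M" "atree_rev M" using M by (rule adhesion_modelD)
  interpret N: arc_tree "atree N" "atree_rev N" using N by (rule adhesion_modelD)
  have B: "B \<in> arcs (atree N)" "atype N B = atype M A" using l by (auto simp: linked_def)
  have Y: "aset \<G> (base_rev \<G> (atype M A)) = aset \<G> (atype M A)"
    using arc_action_rev adhesion_modelD(2)[OF M A] by simp
  show ?thesis using l Y adhesion_modelD(6)[OF M A] adhesion_modelD(6)[OF N B(1)] A B
    by (auto simp: linked_def N.rev_in_arcs N.head_rev N.tail_rev M.rev_rev N.rev_rev)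
qed

text \<open>One step outwards. \<open>snd p\<close> carries the adhesion set of \<open>A\<close> to
  an adhesion set at \<open>fst p\<close>, which singles out \<open>B\<close>; on Y the permutation
  \<open>h\<close> is then forced, and \<open>adhesion_pair_transfer\<close> supplies a group
  element at the other end.\<close>

lemma linked_exists:
  assumes M: "adhesion_model \<G> M" and N: "adhesion_model \<G> N" and A: "A \<in> arcs (atree M)"
    and p: "state_at M N (head (atree M) A) p"
  shows "\<exists>q B h. linked M N A p q B h \<and> state_at M N (tail (atree M) A) q"
proof -
  interpret M: arc_tree "atree M" "atree_rev M" using M by (rule adhesion_modelD)
  interpret N: arc_tree "atree N" "atree_rev N" using N by (rule adhesion_modelD)
  let ?a = "atype M A" and ?g = "snd p"
  let ?Y = "aset \<G> ?a"
  have a: "?a \<in> arcs (base \<G>)" by (rule adhesion_modelD(2)[OF M A])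
  have g: "?g \<in> vgrp \<G> (vtype M (head (atree M) A))" using p by (simp add: state_at_def)
  obtain B where B: "B \<in> arcs (atree N)" "head (atree N) B = fst p" "atype N B = ?a"
    "amap N B ` ?Y = ?g ` amap M A ` ?Y"
    using adhesion_model_arc[OF N _ a amap_image[OF M A g], of "fst p"] p adhesion_modelD(4)[OF M A]
    by (auto simp: state_at_def)
  define h where "h = inv_into ?Y (amap N B) \<circ> (?g \<circ> amap M A)"
  have "inj_on ?g (vset \<G> (vtype M (head (atree M) A)))"
    using vgrpD(1)[OF adhesion_modelD(3)[OF M] g] A by (simp add: bij_betw_def)
  then have "inj_on ?g (amap M A ` ?Y)"
    by (rule inj_on_subset) (use amap_into[OF M A] in blast)
  then have "bij_betw (?g \<circ> amap M A) ?Y (amap N B ` ?Y)"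
    using comp_inj_on[OF amap_inj[OF M A]] B(4) by (simp add: bij_betw_def image_comp)
  moreover have "bij_betw (amap N B) ?Y (amap N B ` ?Y)"
    using amap_inj[OF N B(1)] B(3) by (simp add: bij_betw_def)
  ultimately have h: "bij_betw h ?Y ?Y"
    unfolding h_def by (rule bij_betw_trans[OF _ bij_betw_inv_into])
  have eq: "?g (amap M A y) = amap N B (h y)" if "y \<in> ?Y" for y
  proof -
    have "?g (amap M A y) \<in> amap N B ` ?Y" using that B(4) by blast
    then show ?thesis by (simp add: h_def f_inv_into_f)
  qed
  have "\<exists>g'\<in>vgrp \<G> (head (base \<G>) (base_rev \<G> ?a)).
      \<forall>y\<in>?Y. g' (amap M (atree_rev M A) y) = amap N (atree_rev N B) (h y)"
  proof (rule adhesion_pair_transfer[OF a adhesion_modelD(7)[OF M A] _ _ h])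
    show "adhesion_pair \<G> ?a (amap N B) (amap N (atree_rev N B))"
      using adhesion_modelD(7)[OF N B(1)] B(3) by simp
    show "?g \<in> vgrp \<G> (head (base \<G>) ?a)" using g adhesion_modelD(4)[OF M A] by simp
  qed (rule eq)
  then obtain g' where g': "g' \<in> vgrp \<G> (vtype M (tail (atree M) A))"
    "\<And>y. y \<in> ?Y \<Longrightarrow> g' (amap M (atree_rev M A) y) = amap N (atree_rev N B) (h y)"
    using adhesion_modelD(5)[OF M A] arc_graph.tail_eq_head_rev[OF base_graph a] by auto
  have "linked M N A p (tail (atree N) B, g') B h"
    using B h eq g' by (simp add: linked_def)
  moreover have "state_at M N (tail (atree M) A) (tail (atree N) B, g')"
    using adhesion_modelD(5)[OF M A] adhesion_modelD(5)[OF N B(1)] B g' by (simp add: state_at_def)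
  ultimately show ?thesis by blast
qed

lemma adhesion_iso_exists:
  assumes M: "adhesion_model \<G> M" and N: "adhesion_model \<G> N"
  shows "\<exists>\<theta>V \<theta>A. adhesion_iso \<G> M N \<theta>V \<theta>A"
proof -
  interpret M: arc_tree "atree M" "atree_rev M" using M by (rule adhesion_modelD)
  interpret N: arc_tree "atree N" "atree_rev N" using N by (rule adhesion_modelD)
  obtain C0 where C0: "C0 \<in> verts (atree M)"
    using M.tree by (auto simp: is_tree_def connected_def strongly_connected_def mk_symmetric_def)
  obtain D0 where D0: "D0 \<in> verts (atree N)" "vtype N D0 = vtype M C0"
    using vtype_surj[OF N adhesion_modelD(3)[OF M C0]] by blast
  obtain \<rho> where \<rho>: "\<rho> C0 = []"
    "\<And>C. C \<in> verts (atree M) \<Longrightarrow> C \<noteq> C0 \<Longrightarrow>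
      \<exists>A\<in>arcs (atree M). tail (atree M) A = C \<and> \<rho> C = A # \<rho> (head (atree M) A)"
    "\<And>A. A \<in> arcs (atree M) \<Longrightarrow> \<rho> (tail (atree M) A) = A # \<rho> (head (atree M) A) \<or>
      \<rho> (head (atree M) A) = atree_rev M A # \<rho> (tail (atree M) A)"
    using M.rooting_exists[OF C0] by blast
  define next_state where "next_state A p =
    (SOME q. \<exists>B h. linked M N A p q B h \<and> state_at M N (tail (atree M) A) q)" for A p
  \<comment> \<open>\<rho> C lists the arcs from C towards the root, so recursion on this list
    begins at the root, with the image \<open>D0\<close> and the identity permutation, and proceeds
    outwards.\<close>
  define st where "st C = rec_list (D0, \<lambda>x\<in>vset \<G> (vtype M C0). x) (\<lambda>A _. next_state A) (\<rho> C)" for C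
  have next_state: "\<exists>B h. linked M N A p (next_state A p) B h \<and>
      state_at M N (tail (atree M) A) (next_state A p)"
    if "A \<in> arcs (atree M)" "state_at M N (head (atree M) A) p" for A p
    unfolding next_state_def by (rule someI_ex) (use linked_exists[OF M N that] in blast)
  have st_tail: "st (tail (atree M) A) = next_state A (st (head (atree M) A))"
    if "\<rho> (tail (atree M) A) = A # \<rho> (head (atree M) A)" for A
    using that by (simp add: st_def)
  have st: "state_at M N C (st C)" if "C \<in> verts (atree M)" for C
    using that
  proof (induct "length (\<rho> C)" arbitrary: C rule: less_induct)
    case less
    show ?case
    proof (cases "C = C0")
      case True
      then show ?thesis using D0 \<rho>(1) vgrpD(2)[OF adhesion_modelD(3)[OF M C0]]
        by (simp add: st_def state_at_def)
    next
      case False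
      then obtain A where A: "A \<in> arcs (atree M)" "tail (atree M) A = C"
        "\<rho> C = A # \<rho> (head (atree M) A)"
        using \<rho>(2)[OF less.prems] by blast
      then have "state_at M N (head (atree M) A) (st (head (atree M) A))" by (intro less.hyps) auto
      then show ?thesis using next_state[OF A(1)] st_tail[of A] A by auto
    qed
  qed
  \<comment> \<open>The recursion crosses an arc in only one of its two directions;
    \<open>linked_rev\<close> covers the other.\<close>
  have link: "\<exists>B h. linked M N A (st (head (atree M) A)) (st (tail (atree M) A)) B h"
    if A: "A \<in> arcs (atree M)" for A
  proof -
    have *: "\<exists>B h. linked M N A (st (head (atree M) A)) (st (tail (atree M) A)) B h"
      if "A \<in> arcs (atree M)" "\<rho> (tail (atree M) A) = A # \<rho> (head (atree M) A)" for A
      using next_state[OF that(1) st] st_tail[OF that(2)] that(1) by auto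
    from \<rho>(3)[OF A] show ?thesis
    proof
      assume "\<rho> (tail (atree M) A) = A # \<rho> (head (atree M) A)"
      then show ?thesis using * A by blast
    next
      assume "\<rho> (head (atree M) A) = atree_rev M A # \<rho> (tail (atree M) A)"
      then obtain B h where
        "linked M N (atree_rev M A) (st (tail (atree M) A)) (st (head (atree M) A)) B h"
        using *[of "atree_rev M A"] A by (auto simp: M.rev_in_arcs M.head_rev M.tail_rev)
      from linked_rev[OF M N M.rev_in_arcs[OF A] this] show ?thesis using A
        by (auto simp: M.rev_rev)
    qed
  qed
  then obtain \<theta>A h where \<theta>A:
    "\<And>A. A \<in> arcs (atree M) \<Longrightarrow>
        linked M N A (st (head (atree M) A)) (st (tail (atree M) A)) (\<theta>A A) (h A)"
    by metis
  define \<theta>V where "\<theta>V C = fst (st C)" for C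
  define g where "g C = snd (st C)" for C
  have \<theta>V: "\<theta>V C \<in> verts (atree N)" "vtype N (\<theta>V C) = vtype M C" "g C \<in> vgrp \<G> (vtype M C)"
    if "C \<in> verts (atree M)" for C
    using st[OF that] by (auto simp: state_at_def \<theta>V_def g_def)
  have L: "\<theta>A A \<in> arcs (atree N)" "head (atree N) (\<theta>A A) = \<theta>V (head (atree M) A)"
    "tail (atree N) (\<theta>A A) = \<theta>V (tail (atree M) A)" "atype N (\<theta>A A) = atype M A"
    "bij_betw (h A) (aset \<G> (atype M A)) (aset \<G> (atype M A))"
    "\<And>y. y \<in> aset \<G> (atype M A) \<Longrightarrow> g (head (atree M) A) (amap M A y) = amap N (\<theta>A A) (h A y)"
    "\<And>y. y \<in> aset \<G> (atype M A) \<Longrightarrow> g (tail (atree M) A) (amap M (atree_rev M A) y)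
      = amap N (atree_rev N (\<theta>A A)) (h A y)"
    if "A \<in> arcs (atree M)" for A
    using \<theta>A[OF that] by (auto simp: linked_def \<theta>V_def g_def)
  have image: "amap N (\<theta>A A) ` aset \<G> (atype M A) = g (head (atree M) A) ` amap M A ` aset \<G> (atype M A)"
    if A: "A \<in> arcs (atree M)" for A
  proof -
    have "g (head (atree M) A) ` amap M A ` aset \<G> (atype M A) = amap N (\<theta>A A) ` h A ` aset \<G> (atype M A)"
      using L(6)[OF A] by (auto simp: image_iff)
    then show ?thesis using L(5)[OF A] by (simp add: bij_betw_def)
  qed
  \<comment> \<open>\<theta>A and \<open>h\<close> were chosen independently on an arc and its
    reverse. The two candidates for the image of the reverse share terminus, type and adhesion set,
    hence coincide; injectivity of \<open>amap\<close> then makes the permutations agree.\<close>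
  have rev: "\<theta>A (atree_rev M A) = atree_rev N (\<theta>A A)"
    "\<forall>y\<in>aset \<G> (atype M A). h (atree_rev M A) y = h A y"
    if A: "A \<in> arcs (atree M)" for A
  proof -
    let ?A' = "atree_rev M A" and ?Y = "aset \<G> (atype M A)"
    have A': "?A' \<in> arcs (atree M)" by (rule M.rev_in_arcs[OF A])
    have Y: "aset \<G> (base_rev \<G> (atype M A)) = ?Y"
      using arc_action_rev adhesion_modelD(2)[OF M A] by simp
    have t: "atype M ?A' = base_rev \<G> (atype M A)" by (rule adhesion_modelD(6)[OF M A])
    have "g (tail (atree M) A) ` amap M ?A' ` ?Y = amap N (atree_rev N (\<theta>A A)) ` h A ` ?Y"
      using L(7)[OF A] by (auto simp: image_iff)
    then have im: "amap N (\<theta>A ?A') ` ?Y = amap N (atree_rev N (\<theta>A A)) ` ?Y"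
      using image[OF A'] t Y L(5)[OF A] M.head_rev[OF A] by (simp add: bij_betw_def)
    show eq: "\<theta>A ?A' = atree_rev N (\<theta>A A)"
    proof (rule adhesion_model_arc_unique[OF N])
      show "\<theta>A ?A' \<in> arcs (atree N)" by (rule L(1)[OF A'])
      show "atree_rev N (\<theta>A A) \<in> arcs (atree N)" using L(1)[OF A] by (rule N.rev_in_arcs)
      show "head (atree N) (\<theta>A ?A') = head (atree N) (atree_rev N (\<theta>A A))"
        using L(2)[OF A'] L(3)[OF A] M.head_rev[OF A] N.head_rev[OF L(1)[OF A]] by simp
      show "atype N (\<theta>A ?A') = atype N (atree_rev N (\<theta>A A))"
        using L(4)[OF A'] L(4)[OF A] t adhesion_modelD(6)[OF N L(1)[OF A]] by simp
      show "amap N (\<theta>A ?A') ` aset \<G> (atype N (\<theta>A ?A')) =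
          amap N (atree_rev N (\<theta>A A)) ` aset \<G> (atype N (\<theta>A ?A'))"
        using im L(4)[OF A'] t Y by simp
    qed
    show "\<forall>y\<in>?Y. h ?A' y = h A y"
    proof
      fix y assume y: "y \<in> ?Y"
      have "amap N (\<theta>A ?A') (h ?A' y) = amap N (\<theta>A ?A') (h A y)"
        using L(6)[OF A', of y] L(7)[OF A y] eq M.head_rev[OF A] y t Y by simp
      moreover have "h ?A' y \<in> ?Y" "h A y \<in> ?Y"
        using L(5)[OF A'] L(5)[OF A] t Y y by (auto simp: bij_betw_def)
      moreover have "inj_on (amap N (\<theta>A ?A')) ?Y"
        using amap_inj[OF N L(1)[OF A']] L(4)[OF A'] t Y by simp
      ultimately show "h ?A' y = h A y" by (simp add: inj_on_def)
    qed
  qed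
  have gi: "inj_on (g C) (vset \<G> (vtype M C))" if "C \<in> verts (atree M)" for C
    using vgrpD(1)[OF adhesion_modelD(3)[OF M that] \<theta>V(3)[OF that]] by (simp add: bij_betw_def)
  \<comment> \<open>It remains to check bijectivity on the arcs ending at each vertex, since
    \<open>tree_covering_iso\<close> makes this global.\<close>
  have iso: "graph_iso (atree M) (atree_rev M) (atree N) (atree_rev N) \<theta>V \<theta>A"
  proof (rule tree_covering_iso[OF M.tree N.tree])
    show "graph_hom (atree M) (atree_rev M) (atree N) (atree_rev N) \<theta>V \<theta>A"
      using \<theta>V(1) L(1-3) rev(1) by (auto simp: graph_hom_def)
    show "A = B" if AB: "A \<in> arcs (atree M)" "B \<in> arcs (atree M)"
      "head (atree M) A = head (atree M) B" "\<theta>A A = \<theta>A B" for A B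
    proof (rule adhesion_model_arc_unique[OF M AB(1-3)])
      show t: "atype M A = atype M B" using L(4)[OF AB(1)] L(4)[OF AB(2)] AB(4) by simp
      have "g (head (atree M) A) ` amap M A ` aset \<G> (atype M A) =
          g (head (atree M) A) ` amap M B ` aset \<G> (atype M A)"
        using image[OF AB(1)] image[OF AB(2)] AB(3,4) t by simp
      moreover have "amap M A ` aset \<G> (atype M A) \<subseteq> vset \<G> (vtype M (head (atree M) A))"
        "amap M B ` aset \<G> (atype M A) \<subseteq> vset \<G> (vtype M (head (atree M) A))"
        using amap_into[OF M AB(1)] amap_into[OF M AB(2)] AB(3) t by auto
      ultimately show "amap M A ` aset \<G> (atype M A) = amap M B ` aset \<G> (atype M A)"
        using gi[OF M.head_in_verts[OF AB(1)]] inj_on_image_eq_iff by metis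
    qed
    show "\<exists>A\<in>arcs (atree M). head (atree M) A = C \<and> \<theta>A A = B"
      if C: "C \<in> verts (atree M)" and B: "B \<in> arcs (atree N)" "head (atree N) B = \<theta>V C" for C B
    proof -
      let ?b = "atype N B"
      have v: "vtype N (head (atree N) B) = vtype M C" using B(2) \<theta>V(2)[OF C] by simp
      obtain k where k: "k \<in> vgrp \<G> (vtype M C)"
        "\<forall>x\<in>vset \<G> (vtype M C). k (g C x) = x \<and> g C (k x) = x"
        using vgrpD(4)[OF adhesion_modelD(3)[OF M C] \<theta>V(3)[OF C]] by blast
      \<comment> \<open>The inverse \<open>k\<close> of \<open>g C\<close> pulls the adhesion set of
        \<open>B\<close> back to \<open>C\<close> and thereby shows which arc at \<open>C\<close> to
        take.\<close>
      have "k ` amap N B ` aset \<G> ?b \<in> adhesion_sets \<G> ?b"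
        using amap_image[OF N B(1)] k(1) v by simp
      moreover have "head (base \<G>) ?b = vtype M C" using adhesion_modelD(4)[OF N B(1)] v by simp
      ultimately obtain A where A: "A \<in> arcs (atree M)" "head (atree M) A = C" "atype M A = ?b"
        "amap M A ` aset \<G> ?b = k ` amap N B ` aset \<G> ?b"
        using adhesion_model_arc[OF M C adhesion_modelD(2)[OF N B(1)]] by blast
      have "g C ` k ` amap N B ` aset \<G> ?b = amap N B ` aset \<G> ?b"
        using k(2) amap_into[OF N B(1)] v by (auto simp: image_iff)
      then have "amap N (\<theta>A A) ` aset \<G> ?b = amap N B ` aset \<G> ?b" using image[OF A(1)] A by simp
      then have "\<theta>A A = B"
        using L(1,2,4)[OF A(1)] A B by (intro adhesion_model_arc_unique[OF N]) auto
      with A show ?thesis by blast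
    qed
  qed
  have "adhesion_iso \<G> M N \<theta>V \<theta>A"
    unfolding adhesion_iso_def using iso \<theta>V(2,3) L(4,5,6) rev(2)
    by (intro conjI exI[of _ g] exI[of _ h]) auto
  then show ?thesis by blast
qed

end

section \<open>The induced group in terms of the tree\<close>

text \<open>Preservation of \<open>R\<close> in both directions makes the image of a class a whole
  class and not merely part of one.\<close>

lemma quotient_image_bij:
  assumes E: "equiv X R" and g: "bij_betw g X X"
    and iff: "\<And>x y. x \<in> X \<Longrightarrow> y \<in> X \<Longrightarrow> (g x, g y) \<in> R \<longleftrightarrow> (x, y) \<in> R"
  shows "bij_betw ((`) g) (X // R) (X // R)"
proof -
  have sub: "R \<subseteq> X \<times> X" using E by (simp add: equiv_def refl_on_def)
  have im: "g ` (R `` {x}) = R `` {g x}" if x: "x \<in> X" for x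
  proof
    show "g ` (R `` {x}) \<subseteq> R `` {g x}" using sub iff x by blast
    show "R `` {g x} \<subseteq> g ` (R `` {x})"
    proof
      fix z assume z: "z \<in> R `` {g x}"
      then obtain y where "y \<in> X" "z = g y" using sub g by (force simp: bij_betw_def)
      then show "z \<in> g ` (R `` {x})" using z iff x by auto
    qed
  qed
  have "inj_on ((`) g) (X // R)"
  proof (rule inj_onI)
    fix C D assume "C \<in> X // R" "D \<in> X // R" "g ` C = g ` D"
    moreover have "C \<subseteq> X" "D \<subseteq> X" using calculation(1,2) E in_quotient_imp_subset by metis+
    ultimately show "C = D" using g inj_on_image_eq_iff by (metis bij_betw_def)
  qed
  moreover have "(`) g ` (X // R) = X // R"
  proof
    show "(`) g ` (X // R) \<subseteq> X // R"
    proof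
      fix D assume "D \<in> (`) g ` (X // R)"
      then obtain x where "x \<in> X" "D = R `` {g x}" using im by (auto simp: quotient_def)
      then show "D \<in> X // R" using g by (auto simp: bij_betw_def intro: quotientI)
    qed
    show "X // R \<subseteq> (`) g ` (X // R)"
    proof
      fix D assume "D \<in> X // R"
      then obtain z where "z \<in> X" "D = R `` {z}" by (auto simp: quotient_def)
      moreover from this obtain x where "x \<in> X" "z = g x" using g by (auto simp: bij_betw_def)
      ultimately show "D \<in> (`) g ` (X // R)" using im[of x] by (auto simp: quotient_def)
    qed
  qed
  ultimately show ?thesis by (simp add: bij_betw_def)
qed

text \<open>Glues bijections between blocks; a permutation of \<Sigma> will be assembled in this way
  from its restrictions to classes.\<close>

lemma bij_betw_partition:
  assumes disj: "\<And>C D x. C \<in> F \<Longrightarrow> D \<in> F \<Longrightarrow> x \<in> C \<Longrightarrow> x \<in> D \<Longrightarrow> C = D"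
    and f: "bij_betw f F F" and g: "\<And>C. C \<in> F \<Longrightarrow> bij_betw g C (f C)"
  shows "bij_betw g (\<Union>F) (\<Union>F)"
  unfolding bij_betw_def
proof
  have fF: "f C \<in> F" if "C \<in> F" for C using f that by (auto simp: bij_betw_def)
  have gC: "g x \<in> f C" if "C \<in> F" "x \<in> C" for C x using g that by (auto simp: bij_betw_def)
  show "inj_on g (\<Union>F)"
  proof (rule inj_onI)
    fix x y assume "x \<in> \<Union>F" "y \<in> \<Union>F" and eq: "g x = g y"
    then obtain C D where C: "C \<in> F" "x \<in> C" and D: "D \<in> F" "y \<in> D" by blast
    then have "g x \<in> f C" "g x \<in> f D" using gC[OF C] gC[OF D] eq by simp_all
    then have "f C = f D" using disj fF C(1) D(1) by metis
    then have "C = D" using f C D by (auto simp: bij_betw_def inj_on_def)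
    then show "x = y" using g[OF C(1)] C D eq by (auto simp: bij_betw_def inj_on_def)
  qed
  show "g ` \<Union>F = \<Union>F"
  proof
    show "g ` \<Union>F \<subseteq> \<Union>F" using fF gC by blast
    show "\<Union>F \<subseteq> g ` \<Union>F"
    proof
      fix z assume "z \<in> \<Union>F"
      then obtain D where D: "D \<in> F" "z \<in> D" by blast
      then obtain C where C: "C \<in> F" "D = f C" using f by (auto simp: bij_betw_def)
      then show "z \<in> g ` \<Union>F" using D g[OF C(1)] by (auto simp: bij_betw_def)
    qed
  qed
qed

section \<open>Automorphisms of a scaffolding and of its tree\<close>

definition scaffold_tree ::
  "('v, 'a, 'x, 'y) gga_data \<Rightarrow> ('s, 'b, 'v, 'a, 'x, 'y) scaffold_data \<Rightarrow>
    ('s set, 'b set, 'v, 'a, 'x, 'y) adhesion_tree" where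
  "scaffold_tree \<G> \<S> = \<lparr>atree = stree \<S>, atree_rev = stree_rev \<S>, vtype = piV \<S>, atype = piA \<S>,
    amap = Psi \<G> \<S>\<rparr>"

lemma scaffold_tree_simps [simp]:
  "atree (scaffold_tree \<G> \<S>) = stree \<S>" "atree_rev (scaffold_tree \<G> \<S>) = stree_rev \<S>"
  "vtype (scaffold_tree \<G> \<S>) = piV \<S>" "atype (scaffold_tree \<G> \<S>) = piA \<S>"
  "amap (scaffold_tree \<G> \<S>) = Psi \<G> \<S>"
  by (simp_all add: scaffold_tree_def)

context scaffolding
begin

lemma stree_arc_tree: "arc_tree (stree \<S>) (stree_rev \<S>)"
  using tree by (rule arc_treeI)

lemma sarc_rel_equiv: "equiv (arcs (sgraph \<S>)) (sarc_rel \<S>)"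
proof (rule equivI)
  interpret arc_graph "sgraph \<S>" "srev \<S>" by (rule sgraph)
  show "sarc_rel \<S> \<subseteq> arcs (sgraph \<S>) \<times> arcs (sgraph \<S>)" by (auto simp: sarc_rel_def)
  show "refl_on (arcs (sgraph \<S>)) (sarc_rel \<S>)"
    using srel_equiv by (auto simp: refl_on_def sarc_rel_def equiv_def)
  show "sym (sarc_rel \<S>)"
    using srel_equiv by (auto simp: sym_def sarc_rel_def equiv_def)
  show "trans (sarc_rel \<S>)"
    using srel_equiv unfolding equiv_def trans_def sarc_rel_def by blast
qed

text \<open>This includes the empty graph, whose tree has the empty class as its only vertex: the
  union is still empty.\<close>

lemma Union_stree: "\<Union>(verts (stree \<S>)) = verts (sgraph \<S>)" "\<Union>(arcs (stree \<S>)) = arcs (sgraph \<S>)"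
  using Union_quotient[OF srel_equiv] Union_quotient[OF sarc_rel_equiv] by (auto simp: stree_def)

lemma stree_vert_class: "C \<in> verts (stree \<S>) \<Longrightarrow> x \<in> C \<Longrightarrow> C = srel \<S> `` {x}"
  using srel_equiv by (auto simp: stree_def split: if_splits elim!: quotientE dest: equiv_class_eq_iff[THEN iffD1])

lemma stree_arc_class: "A \<in> arcs (stree \<S>) \<Longrightarrow> e \<in> A \<Longrightarrow> A = sarc_rel \<S> `` {e}"
  using sarc_rel_equiv by (auto simp: stree_def elim!: quotientE dest: equiv_class_eq_iff[THEN iffD1])

lemma class_in_stree:
  "x \<in> verts (sgraph \<S>) \<Longrightarrow> srel \<S> `` {x} \<in> verts (stree \<S>) \<and> x \<in> srel \<S> `` {x}"
  "e \<in> arcs (sgraph \<S>) \<Longrightarrow> sarc_rel \<S> `` {e} \<in> arcs (stree \<S>) \<and> e \<in> sarc_rel \<S> `` {e}"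
  using equiv_class_self[OF srel_equiv] equiv_class_self[OF sarc_rel_equiv]
  by (auto simp: stree_def quotient_def)

lemma stree_ends:
  assumes A: "A \<in> arcs (stree \<S>)" "e \<in> A"
  shows "head (sgraph \<S>) e \<in> head (stree \<S>) A" "tail (sgraph \<S>) e \<in> tail (stree \<S>) A"
proof -
  interpret arc_graph "sgraph \<S>" "srev \<S>" by (rule sgraph)
  have "e \<in> arcs (sgraph \<S>)" using A Union_stree by blast
  then have "head (sgraph \<S>) e \<in> verts (sgraph \<S>)" "tail (sgraph \<S>) e \<in> verts (sgraph \<S>)"
    by simp_all
  then show "head (sgraph \<S>) e \<in> head (stree \<S>) A" "tail (sgraph \<S>) e \<in> tail (stree \<S>) A"
    using A(2) class_in_stree(1) by (auto simp: stree_def)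
qed

lemma stree_arc_nonempty: "A \<in> arcs (stree \<S>) \<Longrightarrow> \<exists>e. e \<in> A \<and> e \<in> arcs (sgraph \<S>)"
  using sarc_rel_equiv Union_stree(2) by (auto simp: stree_def dest: in_quotient_imp_non_empty)

lemma Psi_pA:
  assumes A: "A \<in> arcs (stree \<S>)" "e \<in> A"
  shows "Psi \<G> \<S> A (pA \<S> e) = pV \<S> (head (sgraph \<S>) e)" "pA \<S> e \<in> aset \<G> (piA \<S> A)"
  using pA_bij[OF A(1)] A(2) by (auto simp: Psi_def bij_betw_def)

lemma pA_surj:
  assumes "A \<in> arcs (stree \<S>)" "y \<in> aset \<G> (piA \<S> A)"
  shows "\<exists>e\<in>A. e \<in> arcs (sgraph \<S>) \<and> pA \<S> e = y"
proof -
  have "y \<in> pA \<S> ` A" using pA_bij[OF assms(1)] assms(2) by (simp add: bij_betw_def)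
  then show ?thesis using Union_stree(2) assms(1) by blast
qed

end

text \<open>Every graph of group actions satisfies the additional assumptions, and so do its reduced and
  arc-reduced ones, whose sets \<open>X(v)\<close> may be empty.\<close>

locale permuting_scaffolding = scaffolding \<G> \<S>
  for \<G> :: "('v, 'a, 'x, 'y) gga_data" and \<S> :: "('s, 'b, 'v, 'a, 'x, 'y) scaffold_data" +
  assumes vgrp_Bij: "v \<in> verts (base \<G>) \<Longrightarrow> vgrp \<G> v \<subseteq> Bij (vset \<G> v)"
    and aset_rev: "a \<in> arcs (base \<G>) \<Longrightarrow> aset \<G> (base_rev \<G> a) = aset \<G> a"
begin

text \<open>\<open>g\<close> and \<open>h\<close> are the automorphism transported through p.
  Acceptability puts \<open>g C\<close> into G(\<pi>(C)), and \<open>pA_rev\<close> makes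
  \<open>h\<close> agree on an arc and its reverse.\<close>

lemma tree_action_adhesion_iso:
  assumes "u \<in> carrier (universal_group \<G> \<S>)"
  shows "tree_action \<S> u \<in> carrier (adhesion_auts \<G> (scaffold_tree \<G> \<S>))"
proof -
  interpret \<Sigma>: arc_graph "sgraph \<S>" "srev \<S>" by (rule sgraph)
  interpret T: arc_tree "stree \<S>" "stree_rev \<S>" by (rule stree_arc_tree)
  obtain gV gA where u: "u = (gV, gA)" by (cases u)
  have gV: "bij_betw gV (verts (sgraph \<S>)) (verts (sgraph \<S>))"
    and gA: "bij_betw gA (arcs (sgraph \<S>)) (arcs (sgraph \<S>))"
    and ghom: "graph_hom (sgraph \<S>) (srev \<S>) (sgraph \<S>) (srev \<S>) gV gA"
    and rel: "\<And>x y. x \<in> verts (sgraph \<S>) \<Longrightarrow> y \<in> verts (sgraph \<S>) \<Longrightarrow>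
      (gV x, gV y) \<in> srel \<S> \<longleftrightarrow> (x, y) \<in> srel \<S>"
    and pi: "\<And>C. C \<in> verts (stree \<S>) \<Longrightarrow> piV \<S> (gV ` C) = piV \<S> C"
      "\<And>A. A \<in> arcs (stree \<S>) \<Longrightarrow> piA \<S> (gA ` A) = piA \<S> A"
    and acc: "\<And>C. C \<in> verts (stree \<S>) \<Longrightarrow>
      (\<lambda>z\<in>vset \<G> (piV \<S> C). pV \<S> (gV (inv_into C (pV \<S>) z))) \<in> vgrp \<G> (piV \<S> C)"
    using assms u by (auto simp: universal_group_def graph_iso_def)
  have gA': "gA e \<in> arcs (sgraph \<S>)" "tail (sgraph \<S>) (gA e) = gV (tail (sgraph \<S>) e)"
    "head (sgraph \<S>) (gA e) = gV (head (sgraph \<S>) e)" "gA (srev \<S> e) = srev \<S> (gA e)"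
    if "e \<in> arcs (sgraph \<S>)" for e
    using ghom that by (auto simp: graph_hom_def)
  have bV: "bij_betw ((`) gV) (verts (stree \<S>)) (verts (stree \<S>))"
    using quotient_image_bij[OF srel_equiv gV rel] by (auto simp: stree_def bij_betw_def)
  have "bij_betw ((`) gA) (arcs (sgraph \<S>) // sarc_rel \<S>) (arcs (sgraph \<S>) // sarc_rel \<S>)"
    using rel gA' by (intro quotient_image_bij[OF sarc_rel_equiv gA]) (auto simp: sarc_rel_def)
  then have bA: "bij_betw ((`) gA) (arcs (stree \<S>)) (arcs (stree \<S>))" by (simp add: stree_def)
  have imV: "gV ` C \<in> verts (stree \<S>)" if "C \<in> verts (stree \<S>)" for C
    using bV that by (auto simp: bij_betw_def)
  have imA: "gA ` A \<in> arcs (stree \<S>)" if "A \<in> arcs (stree \<S>)" for A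
    using bA that by (auto simp: bij_betw_def)
  have head_im: "head (stree \<S>) (gA ` A) = gV ` head (stree \<S>) A"
    and tail_im: "tail (stree \<S>) (gA ` A) = gV ` tail (stree \<S>) A"
    and rev_im: "gA ` stree_rev \<S> A = stree_rev \<S> (gA ` A)"
    if A: "A \<in> arcs (stree \<S>)" for A
  proof -
    obtain e where e: "e \<in> A" "e \<in> arcs (sgraph \<S>)" using stree_arc_nonempty[OF A] by blast
    \<comment> \<open>Classes with a common member coincide, so it is enough to follow the ends of
      one arc \<open>e\<close> of the class.\<close>
    have "gV (head (sgraph \<S>) e) \<in> head (stree \<S>) (gA ` A)"
      "gV (tail (sgraph \<S>) e) \<in> tail (stree \<S>) (gA ` A)"
      using stree_ends[OF imA[OF A], of "gA e"] e gA' by auto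
    moreover have "gV (head (sgraph \<S>) e) \<in> gV ` head (stree \<S>) A"
      "gV (tail (sgraph \<S>) e) \<in> gV ` tail (stree \<S>) A"
      using stree_ends[OF A e(1)] by auto
    ultimately show "head (stree \<S>) (gA ` A) = gV ` head (stree \<S>) A"
      "tail (stree \<S>) (gA ` A) = gV ` tail (stree \<S>) A"
      using stree_vert_class imV A imA T.head_in_verts T.tail_in_verts by metis+
    have "A \<subseteq> arcs (sgraph \<S>)" using A Union_stree(2) by blast
    then show "gA ` stree_rev \<S> A = stree_rev \<S> (gA ` A)"
      using gA'(4) unfolding stree_rev_def image_image by (intro image_cong) auto
  qed
  define fV where "fV = (\<lambda>C\<in>verts (stree \<S>). gV ` C)"
  define fA where "fA = (\<lambda>A\<in>arcs (stree \<S>). gA ` A)"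
  have f: "tree_action \<S> u = (fV, fA)" by (simp add: tree_action_def fV_def fA_def u)
  have bij: "bij_betw fV (verts (stree \<S>)) (verts (stree \<S>))"
    "bij_betw fA (arcs (stree \<S>)) (arcs (stree \<S>))"
    using bV bA bij_betw_cong[of "verts (stree \<S>)" fV "(`) gV"] bij_betw_cong[of "arcs (stree \<S>)" fA "(`) gA"]
    by (simp_all add: fV_def fA_def)
  have "graph_hom (stree \<S>) (stree_rev \<S>) (stree \<S>) (stree_rev \<S>) fV fA"
    using imV imA head_im tail_im rev_im T.rev_in_arcs
    by (auto simp: graph_hom_def fV_def fA_def)
  then have iso: "graph_iso (stree \<S>) (stree_rev \<S>) (stree \<S>) (stree_rev \<S>) fV fA"
    using bij by (simp add: graph_iso_def)
  define g where "g C = (\<lambda>z\<in>vset \<G> (piV \<S> C). pV \<S> (gV (inv_into C (pV \<S>) z)))" for C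
  define h where "h A y = pA \<S> (gA (inv_into A (pA \<S>) y))" for A y
  have hp: "h A (pA \<S> e) = pA \<S> (gA e)" if "A \<in> arcs (stree \<S>)" "e \<in> A" for A e
    using pA_bij[OF that(1)] that(2) by (simp add: h_def bij_betw_inv_into_left)
  have gp: "g C (pV \<S> x) = pV \<S> (gV x)" if "C \<in> verts (stree \<S>)" "x \<in> C" for C x
    using pV_bij[OF that(1)] that(2) bij_betwE[OF pV_bij[OF that(1)]]
    by (simp add: g_def bij_betw_inv_into_left)
  have "bij_betw (h A) (aset \<G> (piA \<S> A)) (aset \<G> (piA \<S> A))" if A: "A \<in> arcs (stree \<S>)" for A
  proof -
    have "A \<subseteq> arcs (sgraph \<S>)" using A Union_stree(2) by blast
    then have "inj_on gA A" using gA by (auto simp: bij_betw_def intro: inj_on_subset)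
    then have "bij_betw gA A (gA ` A)" by (simp add: bij_betw_def)
    then have "bij_betw (pA \<S> \<circ> (gA \<circ> inv_into A (pA \<S>))) (aset \<G> (piA \<S> A)) (aset \<G> (piA \<S> (gA ` A)))"
      using bij_betw_trans[OF bij_betw_trans[OF bij_betw_inv_into[OF pA_bij[OF A]]] pA_bij[OF imA[OF A]]]
      by simp
    moreover have "h A = pA \<S> \<circ> (gA \<circ> inv_into A (pA \<S>))" by (auto simp: h_def)
    ultimately show ?thesis using pi(2)[OF A] by simp
  qed
  moreover have "h (stree_rev \<S> A) y = h A y \<and>
      g (head (stree \<S>) A) (Psi \<G> \<S> A y) = Psi \<G> \<S> (fA A) (h A y)"
    if A: "A \<in> arcs (stree \<S>)" and y: "y \<in> aset \<G> (piA \<S> A)" for A y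
  proof
    obtain e where e: "e \<in> A" "e \<in> arcs (sgraph \<S>)" "y = pA \<S> e" using pA_surj[OF A y] by blast
    have "srev \<S> e \<in> stree_rev \<S> A" using e by (simp add: stree_rev_def)
    then show "h (stree_rev \<S> A) y = h A y"
      using hp[OF A e(1)] hp[OF T.rev_in_arcs[OF A], of "srev \<S> e"] e gA'[OF e(2)]
        pA_rev[OF e(2)] pA_rev[OF gA'(1)[OF e(2)]] by simp
    show "g (head (stree \<S>) A) (Psi \<G> \<S> A y) = Psi \<G> \<S> (fA A) (h A y)"
      using Psi_pA[OF A e(1)] e hp[OF A e(1)] gp[OF _ stree_ends(1)[OF A e(1)]] A
        Psi_pA[OF imA[OF A], of "gA e"] gA'(3)[OF e(2)] by (simp add: fA_def)
  qed
  moreover have "g C \<in> vgrp \<G> (piV \<S> C)" if "C \<in> verts (stree \<S>)" for C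
    using acc[OF that] by (simp add: g_def)
  moreover have "piV \<S> (fV C) = piV \<S> C" if "C \<in> verts (stree \<S>)" for C
    using pi(1)[OF that] that by (simp add: fV_def)
  moreover have "piA \<S> (fA A) = piA \<S> A" if "A \<in> arcs (stree \<S>)" for A
    using pi(2)[OF that] that by (simp add: fA_def)
  ultimately have "adhesion_iso \<G> (scaffold_tree \<G> \<S>) (scaffold_tree \<G> \<S>) fV fA"
    unfolding adhesion_iso_def scaffold_tree_simps using iso
    by (intro conjI exI[of _ g] exI[of _ h]) auto
  then show ?thesis using bij f
    by (auto simp: adhesion_auts_def Bij_def fV_def fA_def)
qed

text \<open>A tree automorphism lifts to \<Sigma> class by class: p identifies a class and its image
  with the same set, and the lift is p^-1 g p on vertices and p^-1 h p on arcs, where p^-1 goes into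
  the image class.\<close>

lemma adhesion_iso_tree_action:
  assumes "f \<in> carrier (adhesion_auts \<G> (scaffold_tree \<G> \<S>))"
  shows "\<exists>u\<in>carrier (universal_group \<G> \<S>). tree_action \<S> u = f"
proof -
  interpret \<Sigma>: arc_graph "sgraph \<S>" "srev \<S>" by (rule sgraph)
  interpret T: arc_tree "stree \<S>" "stree_rev \<S>" by (rule stree_arc_tree)
  obtain fV fA where f: "f = (fV, fA)" by (cases f)
  have ai: "adhesion_iso \<G> (scaffold_tree \<G> \<S>) (scaffold_tree \<G> \<S>) fV fA"
    using assms f by (simp add: adhesion_auts_def)
  have fB: "fV \<in> Bij (verts (stree \<S>))" "fA \<in> Bij (arcs (stree \<S>))"
    and fhom: "graph_hom (stree \<S>) (stree_rev \<S>) (stree \<S>) (stree_rev \<S>) fV fA"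
    and pi: "\<And>C. C \<in> verts (stree \<S>) \<Longrightarrow> piV \<S> (fV C) = piV \<S> C"
      "\<And>A. A \<in> arcs (stree \<S>) \<Longrightarrow> piA \<S> (fA A) = piA \<S> A"
    using assms f by (auto simp: adhesion_auts_def adhesion_iso_def graph_iso_def)
  obtain g h where gh: "\<And>C. C \<in> verts (stree \<S>) \<Longrightarrow> g C \<in> vgrp \<G> (piV \<S> C)"
    "\<And>A. A \<in> arcs (stree \<S>) \<Longrightarrow> bij_betw (h A) (aset \<G> (piA \<S> A)) (aset \<G> (piA \<S> A))"
    "\<And>A y. A \<in> arcs (stree \<S>) \<Longrightarrow> y \<in> aset \<G> (piA \<S> A) \<Longrightarrow> h (stree_rev \<S> A) y = h A y \<and>
      g (head (stree \<S>) A) (Psi \<G> \<S> A y) = Psi \<G> \<S> (fA A) (h A y)"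
    using ai unfolding adhesion_iso_def scaffold_tree_simps by blast
  have bf: "bij_betw fV (verts (stree \<S>)) (verts (stree \<S>))"
    "bij_betw fA (arcs (stree \<S>)) (arcs (stree \<S>))"
    using fB by (simp_all add: Bij_def)
  have fV: "fV C \<in> verts (stree \<S>)" if "C \<in> verts (stree \<S>)" for C using bf that
    by (auto simp: bij_betw_def)
  have fA: "fA A \<in> arcs (stree \<S>)" "head (stree \<S>) (fA A) = fV (head (stree \<S>) A)"
    "fA (stree_rev \<S> A) = stree_rev \<S> (fA A)" if "A \<in> arcs (stree \<S>)" for A
    using fhom that by (auto simp: graph_hom_def)
  define gV where "gV = (\<lambda>x\<in>verts (sgraph \<S>).
    inv_into (fV (srel \<S> `` {x})) (pV \<S>) (g (srel \<S> `` {x}) (pV \<S> x)))"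
  define gA where "gA = (\<lambda>e\<in>arcs (sgraph \<S>).
    inv_into (fA (sarc_rel \<S> `` {e})) (pA \<S>) (h (sarc_rel \<S> `` {e}) (pA \<S> e)))"
  have gV_eq: "gV x = inv_into (fV C) (pV \<S>) (g C (pV \<S> x))" if "C \<in> verts (stree \<S>)" "x \<in> C"
    for C x
    using that stree_vert_class[OF that] Union_stree(1) by (auto simp: gV_def)
  have gA_eq: "gA e = inv_into (fA A) (pA \<S>) (h A (pA \<S> e))" if "A \<in> arcs (stree \<S>)" "e \<in> A" for A e
    using that stree_arc_class[OF that] Union_stree(2) by (auto simp: gA_def)
  have bV: "bij_betw gV C (fV C)" and pV_gV: "\<And>x. x \<in> C \<Longrightarrow> pV \<S> (gV x) = g C (pV \<S> x)"
    if C: "C \<in> verts (stree \<S>)" for C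
  proof -
    have p: "bij_betw (pV \<S>) C (vset \<G> (piV \<S> C))" "bij_betw (pV \<S>) (fV C) (vset \<G> (piV \<S> C))"
      using pV_bij[OF C] pV_bij[OF fV[OF C]] pi(1)[OF C] by simp_all
    have "piV \<S> C \<in> verts (base \<G>)" using pi_hom C by (auto simp: graph_hom_def)
    then have gb: "bij_betw (g C) (vset \<G> (piV \<S> C)) (vset \<G> (piV \<S> C))"
      using gh(1)[OF C] vgrp_Bij by (auto simp: Bij_def)
    have "bij_betw (inv_into (fV C) (pV \<S>) \<circ> (g C \<circ> pV \<S>)) C (fV C)"
      by (intro bij_betw_trans[OF bij_betw_trans[OF p(1) gb]] bij_betw_inv_into p(2))
    then show "bij_betw gV C (fV C)"
      using bij_betw_cong[of C gV "inv_into (fV C) (pV \<S>) \<circ> (g C \<circ> pV \<S>)"] gV_eq[OF C] by simp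
    show "pV \<S> (gV x) = g C (pV \<S> x)" if "x \<in> C" for x
    proof -
      have "g C (pV \<S> x) \<in> pV \<S> ` fV C"
        using bij_betwE[OF gb] bij_betwE[OF p(1)] that p(2) by (simp add: bij_betw_def)
      then show ?thesis using gV_eq[OF C that] by (simp add: f_inv_into_f)
    qed
  qed
  have bA: "bij_betw gA A (fA A)" and pA_gA: "\<And>e. e \<in> A \<Longrightarrow> pA \<S> (gA e) = h A (pA \<S> e)"
    if A: "A \<in> arcs (stree \<S>)" for A
  proof -
    have p: "bij_betw (pA \<S>) A (aset \<G> (piA \<S> A))" "bij_betw (pA \<S>) (fA A) (aset \<G> (piA \<S> A))"
      using pA_bij[OF A] pA_bij[OF fA(1)[OF A]] pi(2)[OF A] by simp_all
    note hb = gh(2)[OF A]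
    have "bij_betw (inv_into (fA A) (pA \<S>) \<circ> (h A \<circ> pA \<S>)) A (fA A)"
      by (intro bij_betw_trans[OF bij_betw_trans[OF p(1) hb]] bij_betw_inv_into p(2))
    then show "bij_betw gA A (fA A)"
      using bij_betw_cong[of A gA "inv_into (fA A) (pA \<S>) \<circ> (h A \<circ> pA \<S>)"] gA_eq[OF A] by simp
    show "pA \<S> (gA e) = h A (pA \<S> e)" if "e \<in> A" for e
    proof -
      have "h A (pA \<S> e) \<in> pA \<S> ` fA A"
        using bij_betwE[OF hb] bij_betwE[OF p(1)] that p(2) by (simp add: bij_betw_def)
      then show ?thesis using gA_eq[OF A that] by (simp add: f_inv_into_f)
    qed
  qed
  have gV_bij: "bij_betw gV (verts (sgraph \<S>)) (verts (sgraph \<S>))"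
    unfolding Union_stree(1)[symmetric] using stree_vert_class bf(1) bV
    by (intro bij_betw_partition[of _ fV]) metis+
  have gA_bij: "bij_betw gA (arcs (sgraph \<S>)) (arcs (sgraph \<S>))"
    unfolding Union_stree(2)[symmetric] using stree_arc_class bf(2) bA
    by (intro bij_betw_partition[of _ fA]) metis+
  \<comment> \<open>The two vertices to be compared lie in one class and have the same value under
    p, which is injective there; likewise for the two arcs.\<close>
  have E: "head (sgraph \<S>) (gA e) = gV (head (sgraph \<S>) e)" "gA (srev \<S> e) = srev \<S> (gA e)"
    if e: "e \<in> arcs (sgraph \<S>)" for e
  proof -
    define A where "A = sarc_rel \<S> `` {e}"
    have A: "A \<in> arcs (stree \<S>)" "e \<in> A" using class_in_stree(2)[OF e] by (auto simp: A_def)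
    let ?C = "head (stree \<S>) A"
    have C: "?C \<in> verts (stree \<S>)" "head (sgraph \<S>) e \<in> ?C" using stree_ends[OF A] A by auto
    have ge: "gA e \<in> fA A" using bA[OF A(1)] A(2) by (auto simp: bij_betw_def)
    have "gV (head (sgraph \<S>) e) \<in> fV ?C" using bV[OF C(1)] C(2) by (auto simp: bij_betw_def)
    moreover have "head (sgraph \<S>) (gA e) \<in> fV ?C"
      using stree_ends(1)[OF fA(1)[OF A(1)] ge] fA(2)[OF A(1)] by simp
    moreover have "pV \<S> (head (sgraph \<S>) (gA e)) = pV \<S> (gV (head (sgraph \<S>) e))"
      using Psi_pA(1)[OF fA(1)[OF A(1)] ge] pA_gA[OF A] gh(3)[OF A(1) Psi_pA(2)[OF A]]
        Psi_pA(1)[OF A] pV_gV[OF C] by simp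
    moreover have "inj_on (pV \<S>) (fV ?C)" using pV_bij[OF fV[OF C(1)]] by (simp add: bij_betw_def)
    ultimately show "head (sgraph \<S>) (gA e) = gV (head (sgraph \<S>) e)" by (simp add: inj_on_def)
    have A': "stree_rev \<S> A \<in> arcs (stree \<S>)" "srev \<S> e \<in> stree_rev \<S> A"
      using T.rev_in_arcs[OF A(1)] A(2) by (auto simp: stree_rev_def)
    have "gA (srev \<S> e) \<in> stree_rev \<S> (fA A)"
      using bA[OF A'(1)] A'(2) fA(3)[OF A(1)] by (auto simp: bij_betw_def)
    moreover have "srev \<S> (gA e) \<in> stree_rev \<S> (fA A)" using ge by (simp add: stree_rev_def)
    moreover have "gA e \<in> arcs (sgraph \<S>)" using gA_bij e by (auto simp: bij_betw_def)
    then have "pA \<S> (gA (srev \<S> e)) = pA \<S> (srev \<S> (gA e))"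
      using pA_gA[OF A'] pA_gA[OF A] gh(3)[OF A(1) Psi_pA(2)[OF A]] pA_rev e by simp
    moreover have "inj_on (pA \<S>) (stree_rev \<S> (fA A))"
      using pA_bij[OF T.rev_in_arcs[OF fA(1)[OF A(1)]]] by (simp add: bij_betw_def)
    ultimately show "gA (srev \<S> e) = srev \<S> (gA e)" by (simp add: inj_on_def)
  qed
  have "tail (sgraph \<S>) (gA e) = gV (tail (sgraph \<S>) e)" if e: "e \<in> arcs (sgraph \<S>)" for e
  proof -
    have "gA e \<in> arcs (sgraph \<S>)" using gA_bij e by (auto simp: bij_betw_def)
    then show ?thesis using E(2)[OF e] E(1)[OF \<Sigma>.rev_in_arcs[OF e]] \<Sigma>.tail_eq_head_rev e by simp
  qed
  then have iso: "graph_iso (sgraph \<S>) (srev \<S>) (sgraph \<S>) (srev \<S>) gV gA"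
    using E gV_bij gA_bij by (auto simp: graph_iso_def graph_hom_def bij_betw_def)
  have imV: "gV ` C = fV C" if "C \<in> verts (stree \<S>)" for C using bV[OF that]
    by (simp add: bij_betw_def)
  have imA: "gA ` A = fA A" if "A \<in> arcs (stree \<S>)" for A using bA[OF that]
    by (simp add: bij_betw_def)
  have rel: "(gV x, gV y) \<in> srel \<S> \<longleftrightarrow> (x, y) \<in> srel \<S>"
    if x: "x \<in> verts (sgraph \<S>)" and y: "y \<in> verts (sgraph \<S>)" for x y
  proof -
    have iff: "(x, y) \<in> srel \<S> \<longleftrightarrow> srel \<S> `` {x} = srel \<S> `` {y}"
      if "x \<in> verts (sgraph \<S>)" "y \<in> verts (sgraph \<S>)" for x y
      using that eq_equiv_class_iff[OF srel_equiv] by metis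
    have cl: "srel \<S> `` {gV x} = fV (srel \<S> `` {x})" if "x \<in> verts (sgraph \<S>)" for x
      using stree_vert_class[OF fV, of "srel \<S> `` {x}" "gV x"] class_in_stree(1)[OF that]
        imV[of "srel \<S> `` {x}"] by auto
    have "gV x \<in> verts (sgraph \<S>)" "gV y \<in> verts (sgraph \<S>)" using gV_bij x y
      by (auto simp: bij_betw_def)
    then have "(gV x, gV y) \<in> srel \<S> \<longleftrightarrow> fV (srel \<S> `` {x}) = fV (srel \<S> `` {y})"
      using iff cl x y by simp
    also have "\<dots> \<longleftrightarrow> srel \<S> `` {x} = srel \<S> `` {y}"
      using bf(1) class_in_stree(1)[OF x] class_in_stree(1)[OF y]
      by (intro inj_on_eq_iff[of fV "verts (stree \<S>)"]) (simp_all add: bij_betw_def)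
    finally show ?thesis using iff[OF x y] by simp
  qed
  \<comment> \<open>The permutation tested for acceptability is \<open>g C\<close> itself, since
    both are extensional.\<close>
  have acc: "(\<lambda>z\<in>vset \<G> (piV \<S> C). pV \<S> (gV (inv_into C (pV \<S>) z))) = g C"
    if C: "C \<in> verts (stree \<S>)" for C
  proof
    fix z
    have "piV \<S> C \<in> verts (base \<G>)" using pi_hom C by (auto simp: graph_hom_def)
    then have "g C \<in> extensional (vset \<G> (piV \<S> C))" using gh(1)[OF C] vgrp_Bij
      by (auto simp: Bij_def)
    moreover have "pV \<S> (gV (inv_into C (pV \<S>) z)) = g C z" if "z \<in> vset \<G> (piV \<S> C)"
      using pV_gV[OF C] pV_bij[OF C] that by (auto simp: bij_betw_def inv_into_into f_inv_into_f)
    ultimately show "(\<lambda>z\<in>vset \<G> (piV \<S> C). pV \<S> (gV (inv_into C (pV \<S>) z))) z = g C z"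
      using extensional_arb[of "g C" _ z] by auto
  qed
  have "(gV, gA) \<in> carrier (universal_group \<G> \<S>)"
    using gV_bij gA_bij iso rel acc gh(1) imV imA pi
    by (auto simp: universal_group_def BijGroup_def Bij_def gV_def[symmetric] gA_def[symmetric])
      (simp_all add: gV_def gA_def)
  moreover have "tree_action \<S> (gV, gA) = f"
  proof -
    have "(\<lambda>C\<in>verts (stree \<S>). gV ` C) = fV" "(\<lambda>A\<in>arcs (stree \<S>). gA ` A) = fA"
      using imV imA fB extensional_restrict[of fV] extensional_restrict[of fA]
      by (auto simp: Bij_def cong: restrict_cong)
    then show ?thesis by (simp add: tree_action_def f)
  qed
  ultimately show ?thesis by blast
qed

text \<open>\<open>tree_action\<close> may have a kernel, but the induced group is its image, which
  the two preceding lemmas determine.\<close>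

lemma induced_tree_group_eq:
  "induced_tree_group \<G> \<S> = adhesion_auts \<G> (scaffold_tree \<G> \<S>)"
proof -
  have "tree_action \<S> ` carrier (universal_group \<G> \<S>) = carrier (adhesion_auts \<G> (scaffold_tree \<G> \<S>))"
    using tree_action_adhesion_iso adhesion_iso_tree_action by blast
  then show ?thesis by (simp add: induced_tree_group_def adhesion_auts_def)
qed

end

text \<open>Formulated for an arbitrary arc graph as base, so that it applies to the reduced graphs
  of group actions, which may have empty vertex sets.\<close>

lemma scaffolding_adhesion_model:
  assumes "scaffolding \<G> \<S>" and base: "arc_graph (base \<G>) (base_rev \<G>)"
  shows "adhesion_model \<G> (scaffold_tree \<G> \<S>)"
proof -
  interpret scaffolding \<G> \<S> by fact
  interpret T: arc_tree "stree \<S>" "stree_rev \<S>" by (rule stree_arc_tree)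
  have "adhesion_pair \<G> (piA \<S> A) (Psi \<G> \<S> A) (Psi \<G> \<S> (stree_rev \<S> A))"
    if A: "A \<in> arcs (stree \<S>)" for A
  proof (cases "base_rev \<G> (piA \<S> A) = piA \<S> A")
    case True
    then show ?thesis using Psi_self_reverse[OF A] by (simp add: adhesion_pair_def)
  next
    case False
    have "piA \<S> (stree_rev \<S> A) = base_rev \<G> (piA \<S> A)" "piA \<S> A \<in> arcs (base \<G>)"
      using pi_hom A by (auto simp: graph_hom_def)
    then show ?thesis
      using Psi_adhesion[OF A] Psi_adhesion[OF T.rev_in_arcs[OF A]] False
        arc_graph.rev_rev[OF base] by (simp add: adhesion_pair_def)
  qed
  then show ?thesis unfolding adhesion_model_def scaffold_tree_simps
    using tree pi_hom unique_arc by (intro conjI ballI impI) simp_all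
qed

context gga
begin

section \<open>Translates of adhesion sets\<close>

lemma emb_image_adhesion_set:
  assumes "a \<in> arcs (base \<G>)"
  shows "emb \<G> a ` aset \<G> a \<in> adhesion_sets \<G> a"
proof -
  let ?v = "head (base \<G>) a"
  have "compose (aset \<G> a) (\<lambda>x\<in>vset \<G> ?v. x) (emb \<G> a) ` aset \<G> a = emb \<G> a ` aset \<G> a"
    using emb_into[OF assms] by (auto simp: compose_eq image_iff)
  then show ?thesis using vgrpD(2)[OF base_head[OF assms]]
    unfolding adhesion_sets_def adhesion_maps_def by blast
qed

lemma adhesion_set_image:
  assumes "a \<in> arcs (base \<G>)" "S \<in> adhesion_sets \<G> a" "g \<in> vgrp \<G> (head (base \<G>) a)"
  shows "g ` S \<in> adhesion_sets \<G> a"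
  using assms parallel_image[OF assms(1) parallel_adhesion_map assms(3)]
    by (auto simp: adhesion_sets_def)

lemma adhesion_set_sub:
  assumes "a \<in> arcs (base \<G>)" "S \<in> adhesion_sets \<G> a"
  shows "S \<subseteq> vset \<G> (head (base \<G>) a)"
  using assms parallel_into[OF assms(1) parallel_adhesion_map] by (auto simp: adhesion_sets_def)

lemma adhesion_set_nonempty: "a \<in> arcs (base \<G>) \<Longrightarrow> S \<in> adhesion_sets \<G> a \<Longrightarrow> S \<noteq> {}"
  using arc_action by (auto simp: adhesion_sets_def)

text \<open>Yields the reverse inclusion once every group element is known to map a set into
  itself.\<close>

lemma vgrp_inv_image:
  assumes "v \<in> verts (base \<G>)" "g \<in> vgrp \<G> v"
  shows "\<exists>k\<in>vgrp \<G> v. \<forall>S. S \<subseteq> vset \<G> v \<longrightarrow> g ` k ` S = S"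
proof -
  obtain k where k: "k \<in> vgrp \<G> v" "\<forall>x\<in>vset \<G> v. g (k x) = x" using vgrpD(4)[OF assms] by blast
  moreover have "g ` k ` S = S" if "S \<subseteq> vset \<G> v" for S
    unfolding image_image using k(2) that by (simp add: subset_iff cong: image_cong_simp)
  ultimately show ?thesis by blast
qed

section \<open>The reduced graph of group actions\<close>

lemma reduced_simps [simp]:
  "base (reduced_gga \<G>) = base \<G>" "base_rev (reduced_gga \<G>) = base_rev \<G>"
  "vset (reduced_gga \<G>) = reduced_vset \<G>"
  "vgrp (reduced_gga \<G>) v = induced_perms (vgrp \<G> v) (reduced_vset \<G> v)"
  "aset (reduced_gga \<G>) = aset \<G>" "emb (reduced_gga \<G>) = emb \<G>" "agent (reduced_gga \<G>) = agent \<G>"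
  by (simp_all add: reduced_gga_def)

lemma reduced_vsetI:
  "a \<in> arcs (base \<G>) \<Longrightarrow> S \<in> adhesion_sets \<G> a \<Longrightarrow> x \<in> S \<Longrightarrow> x \<in> reduced_vset \<G> (head (base \<G>) a)"
  by (auto simp: reduced_vset_def)

lemma reduced_vset_sub: "reduced_vset \<G> v \<subseteq> vset \<G> v"
  using adhesion_set_sub by (auto simp: reduced_vset_def)

lemma reduced_vset_image:
  assumes v: "v \<in> verts (base \<G>)" and g: "g \<in> vgrp \<G> v"
  shows "g ` reduced_vset \<G> v = reduced_vset \<G> v"
proof -
  have sub: "k ` reduced_vset \<G> v \<subseteq> reduced_vset \<G> v" if "k \<in> vgrp \<G> v" for k
  proof
    fix z assume "z \<in> k ` reduced_vset \<G> v"
    then obtain a S x where "a \<in> arcs (base \<G>)" "head (base \<G>) a = v" "S \<in> adhesion_sets \<G> a"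
      "x \<in> S" "z = k x"
      by (auto simp: reduced_vset_def)
    then show "z \<in> reduced_vset \<G> v"
      using reduced_vsetI[of a "k ` S" z] adhesion_set_image[of a S k] that by auto
  qed
  obtain k where k: "k \<in> vgrp \<G> v" "g ` k ` reduced_vset \<G> v = reduced_vset \<G> v"
    using vgrp_inv_image[OF v g] reduced_vset_sub[of v] by auto
  show ?thesis using sub[OF g] sub[OF k(1)] k(2) by blast
qed

text \<open>The union of the adhesion sets is invariant under G(v), so its setwise stabiliser is the
  whole group.\<close>

lemma reduced_vgrp:
  assumes "v \<in> verts (base \<G>)"
  shows "vgrp (reduced_gga \<G>) v = (\<lambda>g. restrict g (reduced_vset \<G> v)) ` vgrp \<G> v"
  using reduced_vset_image[OF assms] by (auto simp: induced_perms_def)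

lemma reduced_vgrp_Bij:
  assumes v: "v \<in> verts (base \<G>)"
  shows "vgrp (reduced_gga \<G>) v \<subseteq> Bij (vset (reduced_gga \<G>) v)"
proof
  fix f assume "f \<in> vgrp (reduced_gga \<G>) v"
  then obtain g where g: "g \<in> vgrp \<G> v" "f = restrict g (reduced_vset \<G> v)"
    unfolding reduced_vgrp[OF v] by blast
  have "inj_on g (reduced_vset \<G> v)"
    using vgrpD(1)[OF v g(1)] reduced_vset_sub[of v] by (meson bij_betw_def inj_on_subset)
  then show "f \<in> Bij (vset (reduced_gga \<G>) v)"
    using reduced_vset_image[OF v g(1)] g(2) by (simp add: Bij_def bij_betw_def)
qed

lemma emb_in_reduced_vset:
  "a \<in> arcs (base \<G>) \<Longrightarrow> y \<in> aset \<G> a \<Longrightarrow> emb \<G> a y \<in> reduced_vset \<G> (head (base \<G>) a)"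
  using reduced_vsetI emb_image_adhesion_set by blast

text \<open>The embedding takes its values in the reduced vertex set, so restricting
  \<open>g\<close> to that set does not affect the composite.\<close>

lemma reduced_adhesion_maps:
  assumes a: "a \<in> arcs (base \<G>)"
  shows "adhesion_maps (reduced_gga \<G>) a = adhesion_maps \<G> a"
proof -
  have "compose (aset \<G> a) (restrict g (reduced_vset \<G> (head (base \<G>) a))) (emb \<G> a)
      = compose (aset \<G> a) g (emb \<G> a)" for g
    using emb_in_reduced_vset[OF a] by (auto simp: compose_def)
  then have "(\<lambda>g. compose (aset \<G> a) (restrict g (reduced_vset \<G> (head (base \<G>) a))) (emb \<G> a)) ` X
      = (\<lambda>g. compose (aset \<G> a) g (emb \<G> a)) ` X" for X
    by (intro image_cong refl)
  then show ?thesis unfolding adhesion_maps_def Setcompr_eq_image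
    by (simp add: reduced_vgrp[OF base_head[OF a], simplified] image_image)
qed

lemma reduced_twisted_adhesion_maps:
  assumes a: "a \<in> arcs (base \<G>)" "base_rev \<G> a = a"
  shows "twisted_adhesion_maps (reduced_gga \<G>) a = twisted_adhesion_maps \<G> a"
proof -
  have "agent \<G> a y \<in> aset \<G> a" if "y \<in> aset \<G> a" for y
    using agent_conj(4)[OF a] that by (auto simp: bij_betw_def)
  then have "compose (aset \<G> a) (restrict g (reduced_vset \<G> (head (base \<G>) a)))
      (compose (aset \<G> a) (emb \<G> a) (agent \<G> a))
      = compose (aset \<G> a) g (compose (aset \<G> a) (emb \<G> a) (agent \<G> a))" for g
    using emb_in_reduced_vset[OF a(1)] by (auto simp: compose_def)
  then have "(\<lambda>g. compose (aset \<G> a) (restrict g (reduced_vset \<G> (head (base \<G>) a)))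
      (compose (aset \<G> a) (emb \<G> a) (agent \<G> a))) ` X
      = (\<lambda>g. compose (aset \<G> a) g (compose (aset \<G> a) (emb \<G> a) (agent \<G> a))) ` X" for X
    by (intro image_cong refl)
  then show ?thesis unfolding twisted_adhesion_maps_def Setcompr_eq_image
    by (simp add: reduced_vgrp[OF base_head[OF a(1)], simplified] image_image)
qed

lemma reduced_adhesion_sets:
  "a \<in> arcs (base \<G>) \<Longrightarrow> adhesion_sets (reduced_gga \<G>) a = adhesion_sets \<G> a"
  by (simp add: adhesion_sets_def reduced_adhesion_maps)

lemma reduced_aug_digraph: "aug_digraph (reduced_gga \<G>) = aug_digraph \<G>"
  by (auto simp: aug_digraph_def reduced_adhesion_sets)

lemma reduced_adhesion_pair:
  assumes "a \<in> arcs (base \<G>)"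
  shows "adhesion_pair (reduced_gga \<G>) a f f' \<longleftrightarrow> adhesion_pair \<G> a f f'"
  using assms reduced_adhesion_maps[OF assms] reduced_adhesion_maps[OF arc_graph_simps(1)[OF assms]]
    reduced_twisted_adhesion_maps[OF assms]
  by (simp add: adhesion_pair_def)

text \<open>The vertex actions enter \<open>adhesion_model\<close> only through adhesion maps,
  twisted adhesion maps and adhesion sets, all unchanged by the reduction.\<close>

lemma reduced_adhesion_model:
  assumes M: "adhesion_model (reduced_gga \<G>) M"
  shows "adhesion_model \<G> M"
proof -
  have "atype M A \<in> arcs (base \<G>)" if "A \<in> arcs (atree M)" for A
    using M that by (auto simp: adhesion_model_def graph_hom_def)
  then show ?thesis using M reduced_adhesion_pair reduced_adhesion_sets
    unfolding adhesion_model_def reduced_simps by (simp cong: ball_cong)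
qed

text \<open>The vertex permutations are evaluated only at points of adhesion sets. Restriction gives
  one direction; for the other, arbitrary preimages under restriction are chosen in G(v), vertex by
  vertex.\<close>

lemma reduced_adhesion_iso:
  assumes M: "adhesion_model \<G> M"
  shows "adhesion_iso (reduced_gga \<G>) M N fV fA \<longleftrightarrow> adhesion_iso \<G> M N fV fA"
proof -
  interpret arc_tree "atree M" "atree_rev M" using M by (rule adhesion_modelD)
  have amap: "amap M A y \<in> reduced_vset \<G> (vtype M (head (atree M) A))"
    if "A \<in> arcs (atree M)" "y \<in> aset \<G> (atype M A)" for A y
    using reduced_vsetI[OF adhesion_modelD(2)[OF M that(1)] amap_image_adhesion_set[OF M that(1)]]
      that adhesion_modelD(4)[OF M that(1)] by simp
  have grp: "vgrp (reduced_gga \<G>) (vtype M C)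
      = (\<lambda>g. restrict g (reduced_vset \<G> (vtype M C))) ` vgrp \<G> (vtype M C)"
    if "C \<in> verts (atree M)" for C
    using reduced_vgrp[OF adhesion_modelD(3)[OF M that]] .
  show ?thesis
  proof
    assume L: "adhesion_iso (reduced_gga \<G>) M N fV fA"
    then obtain g' h where gh: "\<And>C. C \<in> verts (atree M) \<Longrightarrow> g' C \<in> vgrp (reduced_gga \<G>) (vtype M C)"
      "\<And>A. A \<in> arcs (atree M) \<Longrightarrow> bij_betw (h A) (aset \<G> (atype M A)) (aset \<G> (atype M A)) \<and>
        (\<forall>y\<in>aset \<G> (atype M A). h (atree_rev M A) y = h A y \<and>
          g' (head (atree M) A) (amap M A y) = amap N (fA A) (h A y))"
      unfolding adhesion_iso_def reduced_simps(5) by blast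
    have "\<exists>g\<in>vgrp \<G> (vtype M C). g' C = restrict g (reduced_vset \<G> (vtype M C))"
      if "C \<in> verts (atree M)" for C
      using gh(1)[OF that] unfolding grp[OF that] by blast
    then obtain g where g: "\<And>C. C \<in> verts (atree M) \<Longrightarrow> g C \<in> vgrp \<G> (vtype M C)"
      "\<And>C. C \<in> verts (atree M) \<Longrightarrow> g' C = restrict (g C) (reduced_vset \<G> (vtype M C))" by metis
    have "g (head (atree M) A) (amap M A y) = g' (head (atree M) A) (amap M A y)"
      if "A \<in> arcs (atree M)" "y \<in> aset \<G> (atype M A)" for A y
      using g(2)[OF head_in_verts[OF that(1)]] amap[OF that] by simp
    then show "adhesion_iso \<G> M N fV fA"
      using L gh(2) g(1) unfolding adhesion_iso_def
      by (intro conjI exI[of _ g] exI[of _ h]) simp_all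
  next
    assume R: "adhesion_iso \<G> M N fV fA"
    then obtain g h where gh: "\<And>C. C \<in> verts (atree M) \<Longrightarrow> g C \<in> vgrp \<G> (vtype M C)"
      "\<And>A. A \<in> arcs (atree M) \<Longrightarrow> bij_betw (h A) (aset \<G> (atype M A)) (aset \<G> (atype M A)) \<and>
        (\<forall>y\<in>aset \<G> (atype M A). h (atree_rev M A) y = h A y \<and>
          g (head (atree M) A) (amap M A y) = amap N (fA A) (h A y))"
      unfolding adhesion_iso_def by blast
    have "restrict (g C) (reduced_vset \<G> (vtype M C)) \<in> vgrp (reduced_gga \<G>) (vtype M C)"
      if "C \<in> verts (atree M)" for C
      using gh(1)[OF that] unfolding grp[OF that] by blast
    then show "adhesion_iso (reduced_gga \<G>) M N fV fA"
      using R gh(2) amap unfolding adhesion_iso_def reduced_simps(5)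
      by (intro conjI exI[of _ "\<lambda>C. restrict (g C) (reduced_vset \<G> (vtype M C))"] exI[of _ h])
        simp_all
  qed
qed

lemma reduced_adhesion_auts:
  "adhesion_model \<G> M \<Longrightarrow> adhesion_auts (reduced_gga \<G>) M = adhesion_auts \<G> M"
  by (simp add: adhesion_auts_def reduced_adhesion_iso)

section \<open>The arc-reduced graph of group actions\<close>

lemma arc_reduced_simps [simp]:
  "base (arc_reduced_gga \<G>) = base \<G>" "base_rev (arc_reduced_gga \<G>) = base_rev \<G>"
  "vset (arc_reduced_gga \<G>) = arc_reduced_vset \<G>" "vgrp (arc_reduced_gga \<G>) = arc_reduced_vgrp \<G>"
  "aset (arc_reduced_gga \<G>) = aset \<G>" "agent (arc_reduced_gga \<G>) = agent \<G>"
  "emb (arc_reduced_gga \<G>) = (\<lambda>a y. (a, emb \<G> a ` aset \<G> a, emb \<G> a y))"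
  by (simp_all add: arc_reduced_gga_def)

definition arc_perm :: "'v \<Rightarrow> ('x \<Rightarrow> 'x) \<Rightarrow> 'a \<times> 'x set \<times> 'x \<Rightarrow> 'a \<times> 'x set \<times> 'x" where
  "arc_perm v g = (\<lambda>(a, S, x)\<in>arc_reduced_vset \<G> v. (a, g ` S, g x))"

lemma arc_reduced_vgrp: "vgrp (arc_reduced_gga \<G>) v = arc_perm v ` vgrp \<G> v"
  by (auto simp: arc_reduced_vgrp_def arc_perm_def)

lemma arc_perm_apply:
  "a \<in> arcs (base \<G>) \<Longrightarrow> S \<in> adhesion_sets \<G> a \<Longrightarrow> x \<in> S \<Longrightarrow>
    arc_perm (head (base \<G>) a) g (a, S, x) = (a, g ` S, g x)"
  by (simp add: arc_perm_def arc_reduced_vset_def)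

lemma arc_reduced_vgrp_Bij:
  assumes v: "v \<in> verts (base \<G>)"
  shows "vgrp (arc_reduced_gga \<G>) v \<subseteq> Bij (vset (arc_reduced_gga \<G>) v)"
proof
  fix f assume "f \<in> vgrp (arc_reduced_gga \<G>) v"
  then obtain g where g: "g \<in> vgrp \<G> v" and f: "f = arc_perm v g"
    unfolding arc_reduced_vgrp by blast
  let ?X = "arc_reduced_vset \<G> v"
  obtain k where k: "k \<in> vgrp \<G> v" "\<forall>x\<in>vset \<G> v. k (g x) = x \<and> g (k x) = x"
    using vgrpD(4)[OF v g] by blast
  have perm: "arc_perm v l p \<in> ?X" if "l \<in> vgrp \<G> v" "p \<in> ?X" for l p
    using that adhesion_set_image by (auto simp: arc_perm_def arc_reduced_vset_def)
  have inverse: "arc_perm v l (arc_perm v m p) = p"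
    if m: "m \<in> vgrp \<G> v" and lm: "\<forall>x\<in>vset \<G> v. l (m x) = x" and "p \<in> ?X" for l m p
  proof -
    obtain a S x where p: "p = (a, S, x)" "a \<in> arcs (base \<G>)" "head (base \<G>) a = v"
      "S \<in> adhesion_sets \<G> a" "x \<in> S"
      using \<open>p \<in> ?X\<close> by (auto simp: arc_reduced_vset_def)
    have sub: "S \<subseteq> vset \<G> v" using adhesion_set_sub[OF p(2,4)] p(3) by simp
    then have "l ` m ` S = S" unfolding image_image
      using lm by (simp add: subset_iff cong: image_cong_simp)
    moreover have "l (m x) = x" using lm sub p(5) by blast
    moreover have "m ` S \<in> adhesion_sets \<G> a" using adhesion_set_image[OF p(2,4)] m p(3) by simp
    ultimately show ?thesis
      using arc_perm_apply[OF p(2,4,5), of m] arc_perm_apply[OF p(2), of "m ` S" "m x" l] p by simp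
  qed
  have "bij_betw f ?X ?X"
    unfolding f using perm[OF g] perm[OF k(1)] inverse[OF g] inverse[OF k(1)] k(2)
    by (intro bij_betw_byWitness[where f' = "arc_perm v k"]) auto
  then show "f \<in> Bij (vset (arc_reduced_gga \<G>) v)" by (simp add: Bij_def f arc_perm_def)
qed

text \<open>Lifts \<open>f\<close> into the copy of its own image. The middle component has to be
  that whole image, so the lift is determined by \<open>f\<close>, which is recovered on Y(a) as the
  last component.\<close>

definition arc_lift :: "'a \<Rightarrow> ('y \<Rightarrow> 'x) \<Rightarrow> 'y \<Rightarrow> 'a \<times> 'x set \<times> 'x" where
  "arc_lift a f = (\<lambda>y\<in>aset \<G> a. (a, f ` aset \<G> a, f y))"

lemma arc_lift_image: "arc_lift a f ` aset \<G> a = {a} \<times> {f ` aset \<G> a} \<times> f ` aset \<G> a"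
  by (auto simp: arc_lift_def)

lemma arc_lift_inverse:
  "f \<in> extensional (aset \<G> a) \<Longrightarrow> (\<lambda>y\<in>aset \<G> a. snd (snd (arc_lift a f y))) = f"
  by (auto simp: arc_lift_def extensional_def)

lemma arc_reduced_adhesion_maps:
  assumes a: "a \<in> arcs (base \<G>)"
  shows "adhesion_maps (arc_reduced_gga \<G>) a = arc_lift a ` adhesion_maps \<G> a"
proof -
  let ?Y = "aset \<G> a"
  have "compose ?Y (arc_perm (head (base \<G>) a) g) (\<lambda>y. (a, emb \<G> a ` ?Y, emb \<G> a y))
      = arc_lift a (compose ?Y g (emb \<G> a))" for g
    using arc_perm_apply[OF a emb_image_adhesion_set[OF a]]
    by (auto simp: compose_def arc_lift_def image_image)
  then show ?thesis unfolding adhesion_maps_def Setcompr_eq_image arc_reduced_vgrp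
    by (simp add: image_image)
qed

text \<open>The embedding labels its values with \<Phi>(Y(a)). This is also the image of \<Phi>t,
  because the agent t permutes Y(a), so the labels are those prescribed by
  \<open>arc_lift\<close>.\<close>

lemma arc_reduced_twisted_adhesion_maps:
  assumes a: "a \<in> arcs (base \<G>)" "base_rev \<G> a = a"
  shows "twisted_adhesion_maps (arc_reduced_gga \<G>) a = arc_lift a ` twisted_adhesion_maps \<G> a"
proof -
  let ?Y = "aset \<G> a"
  have t: "agent \<G> a ` ?Y = ?Y" using agent_conj(4)[OF a] by (simp add: bij_betw_def)
  then have tm: "agent \<G> a y \<in> ?Y" if "y \<in> ?Y" for y using that by blast
  have "(\<lambda>y. g (emb \<G> a (agent \<G> a y))) ` ?Y = (\<lambda>y. g (emb \<G> a y)) ` agent \<G> a ` ?Y"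
    for g :: "'x \<Rightarrow> 'x"
    by (simp add: image_image)
  then have "compose ?Y (arc_perm (head (base \<G>) a) g)
        (compose ?Y (\<lambda>y. (a, emb \<G> a ` ?Y, emb \<G> a y)) (agent \<G> a))
      = arc_lift a (compose ?Y g (compose ?Y (emb \<G> a) (agent \<G> a)))" for g
    using arc_perm_apply[OF a(1) emb_image_adhesion_set[OF a(1)]] tm t
    by (auto simp: compose_def arc_lift_def image_image)
  then show ?thesis
    unfolding twisted_adhesion_maps_def Setcompr_eq_image arc_reduced_vgrp
      by (simp add: image_image)
qed

lemma arc_reduced_adhesion_sets:
  assumes "a \<in> arcs (base \<G>)"
  shows "adhesion_sets (arc_reduced_gga \<G>) a = (\<lambda>S. {a} \<times> {S} \<times> S) ` adhesion_sets \<G> a"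
  by (simp add: adhesion_sets_def arc_reduced_adhesion_maps[OF assms] image_image arc_lift_image)

text \<open>Nonemptiness matters: the copy of an empty set would be empty and forget its
  label.\<close>

lemma arc_copy_inj: "S \<noteq> {} \<Longrightarrow> {a} \<times> {S} \<times> S = {a} \<times> {S'} \<times> S' \<longleftrightarrow> S = S'"
  by blast

text \<open>The correspondence sends an adhesion set to its copy in the disjoint union. It is
  injective because Y(a), and hence every adhesion set, is nonempty.\<close>

lemma arc_reduced_aug_digraph: "aug_digraphs_equal \<G> (arc_reduced_gga \<G>)"
proof -
  define \<phi> where "\<phi> = (\<lambda>(a :: 'a, S :: 'x set). (a, {a} \<times> {S} \<times> S))"
  have "inj_on \<phi> (arcs (aug_digraph \<G>))"
  proof (rule inj_onI)
    fix e e' assume "e \<in> arcs (aug_digraph \<G>)" "e' \<in> arcs (aug_digraph \<G>)" "\<phi> e = \<phi> e'"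
    moreover obtain a S where "e = (a, S)" by (cases e)
    moreover obtain a' S' where "e' = (a', S')" by (cases e')
    ultimately show "e = e'"
      using adhesion_set_nonempty[of a S] arc_copy_inj[of S a S']
        by (auto simp: \<phi>_def aug_digraph_def)
  qed
  moreover have "\<phi> ` arcs (aug_digraph \<G>) = arcs (aug_digraph (arc_reduced_gga \<G>))"
    by (force simp: \<phi>_def aug_digraph_def arc_reduced_adhesion_sets)
  ultimately have "bij_betw \<phi> (arcs (aug_digraph \<G>)) (arcs (aug_digraph (arc_reduced_gga \<G>)))"
    by (simp add: bij_betw_def)
  moreover have "\<phi> (old_arc \<G> a) = old_arc (arc_reduced_gga \<G>) a" for a
    by (auto simp: \<phi>_def old_arc_def)
  ultimately show ?thesis unfolding aug_digraphs_equal_def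
    by (auto simp: aug_digraph_def \<phi>_def intro!: exI[of _ \<phi>])
qed

lemma adhesion_pair_extensional:
  assumes "adhesion_pair \<G> a f f'"
  shows "f \<in> extensional (aset \<G> a)" "f' \<in> extensional (aset \<G> (base_rev \<G> a))"
  using assms by (auto simp: adhesion_pair_def adhesion_maps_def twisted_adhesion_maps_def split: if_splits)

lemma arc_reduced_adhesion_pair:
  assumes a: "a \<in> arcs (base \<G>)" and p: "adhesion_pair (arc_reduced_gga \<G>) a f f'"
  shows "\<exists>k k'. adhesion_pair \<G> a k k' \<and> f = arc_lift a k \<and> f' = arc_lift (base_rev \<G> a) k'"
proof (cases "base_rev \<G> a = a")
  case True
  then show ?thesis
    using p arc_reduced_adhesion_maps[OF a] arc_reduced_twisted_adhesion_maps[OF a True]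
    by (auto simp: adhesion_pair_def)
next
  case False
  then show ?thesis
    using p arc_reduced_adhesion_maps[OF a] arc_reduced_adhesion_maps[OF arc_graph_simps(1)[OF a]]
    by (auto simp: adhesion_pair_def)
qed

text \<open>Forgets the labels of the disjoint union. The restriction makes the stripped maps
  extensional, as adhesion maps are.\<close>

definition strip_arcs ::
  "('w, 'e, 'v, 'a, 'a \<times> 'x set \<times> 'x, 'y) adhesion_tree \<Rightarrow> ('w, 'e, 'v, 'a, 'x, 'y) adhesion_tree" where
  "strip_arcs M = \<lparr>atree = atree M, atree_rev = atree_rev M, vtype = vtype M, atype = atype M,
    amap = (\<lambda>A. \<lambda>y\<in>aset \<G> (atype M A). snd (snd (amap M A y)))\<rparr>"

lemma strip_arcs_simps [simp]:
  "atree (strip_arcs M) = atree M" "atree_rev (strip_arcs M) = atree_rev M"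
  "vtype (strip_arcs M) = vtype M" "atype (strip_arcs M) = atype M"
  by (simp_all add: strip_arcs_def)

text \<open>The second claim says that nothing is lost: the labels are restored from the type of the
  arc and the image of the stripped map.\<close>

lemma strip_arcs_pair:
  assumes M: "adhesion_model (arc_reduced_gga \<G>) M" and A: "A \<in> arcs (atree M)"
  shows "adhesion_pair \<G> (atype M A) (amap (strip_arcs M) A) (amap (strip_arcs M) (atree_rev M A))"
    and "amap M A = arc_lift (atype M A) (amap (strip_arcs M) A)"
proof -
  let ?a = "atype M A"
  have a: "?a \<in> arcs (base \<G>)" and rev: "atype M (atree_rev M A) = base_rev \<G> ?a"
    using M A by (auto simp: adhesion_model_def graph_hom_def)
  have "adhesion_pair (arc_reduced_gga \<G>) ?a (amap M A) (amap M (atree_rev M A))"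
    using M A by (auto simp: adhesion_model_def)
  then obtain k k' where k: "adhesion_pair \<G> ?a k k'" "amap M A = arc_lift ?a k"
    "amap M (atree_rev M A) = arc_lift (base_rev \<G> ?a) k'"
    using arc_reduced_adhesion_pair[OF a] by blast
  have "amap (strip_arcs M) A = k" "amap (strip_arcs M) (atree_rev M A) = k'"
    using arc_lift_inverse adhesion_pair_extensional[OF k(1)] k(2,3) rev
      by (simp_all add: strip_arcs_def)
  then show "adhesion_pair \<G> ?a (amap (strip_arcs M) A) (amap (strip_arcs M) (atree_rev M A))"
    and "amap M A = arc_lift ?a (amap (strip_arcs M) A)" using k by simp_all
qed

text \<open>An arc carries the copy of S exactly if its stripped map has image S, so existence and
  uniqueness of arcs carry over.\<close>

lemma strip_arcs_model:
  assumes M: "adhesion_model (arc_reduced_gga \<G>) M"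
  shows "adhesion_model \<G> (strip_arcs M)"
proof -
  have "\<exists>!A. A \<in> arcs (atree M) \<and> head (atree M) A = C \<and> atype M A = b \<and>
      amap (strip_arcs M) A ` aset \<G> b = S"
    if C: "C \<in> verts (atree M)" and b: "b \<in> arcs (base \<G>)" "head (base \<G>) b = vtype M C"
      and S: "S \<in> adhesion_sets \<G> b" for C b S
  proof -
    have "{b} \<times> {S} \<times> S \<in> adhesion_sets (arc_reduced_gga \<G>) b"
      using S by (simp add: arc_reduced_adhesion_sets[OF b(1)])
    then have ex: "\<exists>!A. A \<in> arcs (atree M) \<and> head (atree M) A = C \<and> atype M A = b \<and>
        amap M A ` aset \<G> b = {b} \<times> {S} \<times> S"
      using M C b by (simp add: adhesion_model_def)
    have "amap M A ` aset \<G> b = {b} \<times> {S} \<times> S \<longleftrightarrow> amap (strip_arcs M) A ` aset \<G> b = S"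
      if "A \<in> arcs (atree M)" "atype M A = b" for A
      using strip_arcs_pair(2)[OF M that(1)] that(2) arc_lift_image[of b]
        arc_copy_inj[OF adhesion_set_nonempty[OF b(1) S]] by metis
    then show ?thesis using ex by metis
  qed
  then show ?thesis using M strip_arcs_pair(1)[OF M] unfolding adhesion_model_def by simp
qed

text \<open>One direction drops the labels. In the other the labels have to match as well:
  \<open>g\<close> carries the image of the stripped map at \<open>A\<close> onto that at
  \<open>fA A\<close>, because \<open>h A\<close> permutes Y.\<close>

lemma arc_reduced_adhesion_iso:
  assumes M: "adhesion_model (arc_reduced_gga \<G>) M" and N: "adhesion_model (arc_reduced_gga \<G>) N"
  shows "adhesion_iso (arc_reduced_gga \<G>) M N fV fA \<longleftrightarrow>
    adhesion_iso \<G> (strip_arcs M) (strip_arcs N) fV fA"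
proof -
  let ?M = "strip_arcs M" and ?N = "strip_arcs N"
  note M' = strip_arcs_model[OF M]
  interpret arc_tree "atree M" "atree_rev M" using adhesion_modelD(1)[OF M'] by simp
  have amapM: "amap M A y = (atype M A, amap ?M A ` aset \<G> (atype M A), amap ?M A y)"
    if "A \<in> arcs (atree M)" "y \<in> aset \<G> (atype M A)" for A y
    using fun_cong[OF strip_arcs_pair(2)[OF M that(1)], of y] that(2) by (simp add: arc_lift_def)
  have amapN: "amap N A y = (atype N A, amap ?N A ` aset \<G> (atype N A), amap ?N A y)"
    if "A \<in> arcs (atree N)" "y \<in> aset \<G> (atype N A)" for A y
    using fun_cong[OF strip_arcs_pair(2)[OF N that(1)], of y] that(2) by (simp add: arc_lift_def)
  have perm: "arc_perm (vtype M (head (atree M) A)) g (amap M A y)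
      = (atype M A, g ` amap ?M A ` aset \<G> (atype M A), g (amap ?M A y))"
    if "A \<in> arcs (atree M)" "y \<in> aset \<G> (atype M A)" for A y g
    using amapM[OF that] arc_perm_apply[OF _ amap_image_adhesion_set[OF M'], of A "amap ?M A y" g]
      adhesion_modelD(2,4)[OF M', of A] that by simp
  show ?thesis
  proof
    assume L: "adhesion_iso (arc_reduced_gga \<G>) M N fV fA"
    then obtain g' h where gh: "\<And>C. C \<in> verts (atree M) \<Longrightarrow>
        g' C \<in> vgrp (arc_reduced_gga \<G>) (vtype M C)"
      "\<And>A. A \<in> arcs (atree M) \<Longrightarrow> bij_betw (h A) (aset \<G> (atype M A)) (aset \<G> (atype M A)) \<and>
        (\<forall>y\<in>aset \<G> (atype M A). h (atree_rev M A) y = h A y \<and>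
          g' (head (atree M) A) (amap M A y) = amap N (fA A) (h A y))"
      unfolding adhesion_iso_def arc_reduced_simps(5) by blast
    have "\<exists>g\<in>vgrp \<G> (vtype M C). g' C = arc_perm (vtype M C) g" if "C \<in> verts (atree M)" for C
      using gh(1)[OF that] unfolding arc_reduced_vgrp by blast
    then obtain g where g: "\<And>C. C \<in> verts (atree M) \<Longrightarrow> g C \<in> vgrp \<G> (vtype M C)"
      "\<And>C. C \<in> verts (atree M) \<Longrightarrow> g' C = arc_perm (vtype M C) (g C)" by metis
    have "g (head (atree M) A) (amap ?M A y) = amap ?N (fA A) (h A y)"
      if A: "A \<in> arcs (atree M)" and y: "y \<in> aset \<G> (atype M A)" for A y
    proof -
      have "fA A \<in> arcs (atree N)" "atype N (fA A) = atype M A"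
        using L A by (auto simp: adhesion_iso_def graph_iso_def graph_hom_def)
      moreover have "h A y \<in> aset \<G> (atype M A)" using gh(2)[OF A] y by (auto simp: bij_betw_def)
      moreover have "g' (head (atree M) A) (amap M A y) = amap N (fA A) (h A y)" using gh(2)[OF A] y
        by blast
      ultimately show ?thesis
        unfolding g(2)[OF head_in_verts[OF A]] perm[OF A y] using amapN[of "fA A" "h A y"] by simp
    qed
    then show "adhesion_iso \<G> ?M ?N fV fA"
      using L gh(2) g(1) unfolding adhesion_iso_def strip_arcs_simps
      by (intro conjI exI[of _ g] exI[of _ h]) simp_all
  next
    assume R: "adhesion_iso \<G> ?M ?N fV fA"
    then obtain g h where gh: "\<And>C. C \<in> verts (atree M) \<Longrightarrow> g C \<in> vgrp \<G> (vtype M C)"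
      "\<And>A. A \<in> arcs (atree M) \<Longrightarrow> bij_betw (h A) (aset \<G> (atype M A)) (aset \<G> (atype M A)) \<and>
        (\<forall>y\<in>aset \<G> (atype M A). h (atree_rev M A) y = h A y \<and>
          g (head (atree M) A) (amap ?M A y) = amap ?N (fA A) (h A y))"
      unfolding adhesion_iso_def strip_arcs_simps by blast
    have "arc_perm (vtype M (head (atree M) A)) (g (head (atree M) A)) (amap M A y) = amap N (fA A) (h A y)"
      if A: "A \<in> arcs (atree M)" and y: "y \<in> aset \<G> (atype M A)" for A y
    proof -
      have f: "fA A \<in> arcs (atree N)" "atype N (fA A) = atype M A"
        using R A by (auto simp: adhesion_iso_def graph_iso_def graph_hom_def)
      have h: "h A ` aset \<G> (atype M A) = aset \<G> (atype M A)" using gh(2)[OF A]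
        by (simp add: bij_betw_def)
      have "g (head (atree M) A) ` amap ?M A ` aset \<G> (atype M A) = amap ?N (fA A) ` h A ` aset \<G> (atype M A)"
        unfolding image_image using gh(2)[OF A] by (intro image_cong) simp_all
      moreover have "h A y \<in> aset \<G> (atype M A)" using h y by blast
      ultimately show ?thesis using perm[OF A y] amapN[OF f(1), of "h A y"] f(2) h gh(2)[OF A] y
        by simp
    qed
    moreover have "arc_perm (vtype M C) (g C) \<in> vgrp (arc_reduced_gga \<G>) (vtype M C)"
      if "C \<in> verts (atree M)" for C
      using gh(1)[OF that] unfolding arc_reduced_vgrp by blast
    ultimately show "adhesion_iso (arc_reduced_gga \<G>) M N fV fA"
      using R gh(2) unfolding adhesion_iso_def arc_reduced_simps(5) strip_arcs_simps
      by (intro conjI exI[of _ "\<lambda>C. arc_perm (vtype M C) (g C)"] exI[of _ h]) simp_all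
  qed
qed

lemma arc_reduced_adhesion_auts:
  "adhesion_model (arc_reduced_gga \<G>) M \<Longrightarrow>
    adhesion_auts (arc_reduced_gga \<G>) M = adhesion_auts \<G> (strip_arcs M)"
  by (simp add: adhesion_auts_def arc_reduced_adhesion_iso)

section \<open>Comparison of the three trees and their induced groups\<close>

lemma scaffold_trees_isomorphic:
  assumes "adhesion_model \<G> M" "adhesion_model \<G> N"
  shows "(\<exists>\<theta>V \<theta>A. graph_iso (atree M) (atree_rev M) (atree N) (atree_rev N) \<theta>V \<theta>A) \<and>
    tree_actions_isomorphic (atree M) (atree_rev M) (adhesion_auts \<G> M)
      (atree N) (atree_rev N) (adhesion_auts \<G> N)"
  using adhesion_iso_exists[OF assms] adhesion_auts_isomorphic[OF assms] unfolding adhesion_iso_def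
    by blast

end

text \<open>Scaffoldings are arbitrary and live on separate types, so equality of the associated
  trees takes the form of an isomorphism.\<close>

theorem lemma10p2:
  fixes \<G> :: "('v, 'a, 'x, 'y) gga_data"
  assumes "gga \<G>"
  shows "aug_digraph (reduced_gga \<G>) = aug_digraph \<G> \<and>
    aug_digraphs_equal \<G> (reduced_gga \<G>) \<and>
    aug_digraphs_equal \<G> (arc_reduced_gga \<G>) \<and>
    (\<forall>(\<S> :: ('s, 'b, 'v, 'a, 'x, 'y) scaffold_data)
      (\<S>' :: ('s1, 'b1, 'v, 'a, 'x, 'y) scaffold_data)
      (\<S>'' :: ('s2, 'b2, 'v, 'a, 'a \<times> 'x set \<times> 'x, 'y) scaffold_data).
      scaffolding \<G> \<S> \<longrightarrow>
      scaffolding (reduced_gga \<G>) \<S>' \<longrightarrow>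
      scaffolding (arc_reduced_gga \<G>) \<S>'' \<longrightarrow>
        (\<exists>\<theta>V \<theta>A. graph_iso (stree \<S>) (stree_rev \<S>) (stree \<S>') (stree_rev \<S>') \<theta>V \<theta>A) \<and>
        (\<exists>\<theta>V \<theta>A. graph_iso (stree \<S>) (stree_rev \<S>) (stree \<S>'') (stree_rev \<S>'') \<theta>V \<theta>A) \<and>
        tree_actions_isomorphic
          (stree \<S>) (stree_rev \<S>) (induced_tree_group \<G> \<S>)
          (stree \<S>') (stree_rev \<S>') (induced_tree_group (reduced_gga \<G>) \<S>') \<and>
        tree_actions_isomorphic
          (stree \<S>) (stree_rev \<S>) (induced_tree_group \<G> \<S>)
          (stree \<S>'') (stree_rev \<S>'') (induced_tree_group (arc_reduced_gga \<G>) \<S>''))"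
proof -
  interpret gga \<G> by fact
  have "aug_digraphs_equal \<G> (reduced_gga \<G>)"
    unfolding aug_digraphs_equal_def reduced_aug_digraph
    by (auto simp: old_arc_def intro!: exI[of _ id])
  moreover have "(\<exists>\<theta>V \<theta>A. graph_iso (stree \<S>) (stree_rev \<S>) (stree \<S>') (stree_rev \<S>') \<theta>V \<theta>A) \<and>
        (\<exists>\<theta>V \<theta>A. graph_iso (stree \<S>) (stree_rev \<S>) (stree \<S>'') (stree_rev \<S>'') \<theta>V \<theta>A) \<and>
        tree_actions_isomorphic
          (stree \<S>) (stree_rev \<S>) (induced_tree_group \<G> \<S>)
          (stree \<S>') (stree_rev \<S>') (induced_tree_group (reduced_gga \<G>) \<S>') \<and>
        tree_actions_isomorphic
          (stree \<S>) (stree_rev \<S>) (induced_tree_group \<G> \<S>)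
          (stree \<S>'') (stree_rev \<S>'') (induced_tree_group (arc_reduced_gga \<G>) \<S>'')"
    if S: "scaffolding \<G> \<S>" and S': "scaffolding (reduced_gga \<G>) \<S>'"
      and S'': "scaffolding (arc_reduced_gga \<G>) \<S>''"
    for \<S> :: "('s, 'b, 'v, 'a, 'x, 'y) scaffold_data"
      and \<S>' :: "('s1, 'b1, 'v, 'a, 'x, 'y) scaffold_data"
      and \<S>'' :: "('s2, 'b2, 'v, 'a, 'a \<times> 'x set \<times> 'x, 'y) scaffold_data"
  proof -
    let ?M = "scaffold_tree \<G> \<S>" and ?M' = "scaffold_tree (reduced_gga \<G>) \<S>'"
      and ?M'' = "scaffold_tree (arc_reduced_gga \<G>) \<S>''"
    have M: "adhesion_model \<G> ?M" using S base_graph by (rule scaffolding_adhesion_model)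
    \<comment> \<open>The trees of both reduced versions are converted into trees for \<G> itself,
      the second one by \<open>strip_arcs\<close>, so that \<open>scaffold_trees_isomorphic\<close>
      applies.\<close>
    have M': "adhesion_model \<G> ?M'"
      using S' base_graph by (intro reduced_adhesion_model scaffolding_adhesion_model) simp_all
    have M'': "adhesion_model (arc_reduced_gga \<G>) ?M''"
      using S'' base_graph by (intro scaffolding_adhesion_model) simp_all
    have "permuting_scaffolding \<G> \<S>"
      using S subgroup.subset[OF vgrp_subgroup] arc_action_rev
      by (simp add: permuting_scaffolding_def permuting_scaffolding_axioms_def BijGroup_def)
    moreover have "permuting_scaffolding (reduced_gga \<G>) \<S>'"
      using S' reduced_vgrp_Bij arc_action_rev
      by (simp add: permuting_scaffolding_def permuting_scaffolding_axioms_def)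
    moreover have "permuting_scaffolding (arc_reduced_gga \<G>) \<S>''"
      using S'' arc_reduced_vgrp_Bij arc_action_rev
      by (simp add: permuting_scaffolding_def permuting_scaffolding_axioms_def)
    ultimately have "induced_tree_group \<G> \<S> = adhesion_auts \<G> ?M"
      "induced_tree_group (reduced_gga \<G>) \<S>' = adhesion_auts \<G> ?M'"
      "induced_tree_group (arc_reduced_gga \<G>) \<S>'' = adhesion_auts \<G> (strip_arcs ?M'')"
      using permuting_scaffolding.induced_tree_group_eq reduced_adhesion_auts[OF M']
        arc_reduced_adhesion_auts[OF M''] by metis+
    then show ?thesis
      using scaffold_trees_isomorphic[OF M M'] scaffold_trees_isomorphic[OF M strip_arcs_model[OF M'']]
      by simp
  qed
  ultimately show ?thesis using reduced_aug_digraph arc_reduced_aug_digraph by blast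
qed

end
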